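(* There exists a separable unital residually finite-dimensional $C^*$-algebra $\mathcal{A}$ with the following two properties: (a) for every tracial state $\tau$ on $\mathcal{A}$ there is a positive integer $n_0$ and, for each $n\ge n_0$, a unital $*$-homomorphism $\rho_n:\mathcal{A}\to\mathcal{M}_n(\mathbb{C})$ such that $\tau(a)=\lim_{n\to\infty}\tau_n(\rho_n(a))$ for every $a\in\mathcal{A}$; (b) $\mathcal{A}$ is not matricially tracially stable.
   Context: $\tau_n$ is the normalized trace on $\mathcal{M}_n(\mathbb{C})$. A $C^*$-algebra is residually finite-dimensional (RFD) if its finite-dimensional representations separate points. If $\rho$ is a tracial state on a unital $C^*$-algebra, put $\|x\|_{2,\rho}=\rho(x^*x)^{1/2}$. An ultrafilter $\alpha$ on an infinite set $I$ is nontrivial if there is a sequence $\{E_n\}$ in $\alpha$ with $\bigcap_n E_n=\varnothing$. Given unital $C^*$-algebras $\mathcal{A}_i$ with tracial states $\rho_i$ ($i\in I$), the tracial ultraproduct $\prod_{i\in I}^{\alpha}(\mathcal{A}_i,\rho_i)$ is the $C^*$-product $\prod_{i\in I}\mathcal{A}_i$ (bounded families) modulo the ideal of all $\{a_i\}$ with $\lim_{i\to\alpha}\|a_i\|_{2,\rho_i}=0$; the coset of $\{a_i\}$ is denoted $\{a_i\}_\alpha$. A unital $*$-homomorphism $\pi:\mathcal{A}\to\prod_{i\in I}^{\alpha}(\mathcal{A}_i,\rho_i)$ is approximately liftable if there are $E\in\alpha$ and, for every $i\in E$, a unital $*$-homomorphism $\pi_i:\mathcal{A}\to\mathcal{A}_i$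 such that $\pi(a)=\{\pi_i(a)\}_\alpha$ for every $a\in\mathcal{A}$ (where $\pi_i(a)=0$ for $i\notin E$). A separable unital $\mathcal{A}$ is matricially tracially stable if every unital $*$-homomorphism from $\mathcal{A}$ into any tracial ultraproduct of full matrix algebras (over any nontrivial ultrafilter) is approximately liftable. *)

theory Defs
  imports
    "HOL-Algebra.QuotRing"
    "HOL-Algebra.Module"
    "HOL-Library.Countable_Set"
    "HOL-Library.FuncSet"
    "Jordan_Normal_Form.Schur_Decomposition"
    "Jordan_Normal_Form.VS_Connect"
begin

section \<open>Unital C*-algebras\<close>

record 'a cstar = "(complex, 'a) module" +
  star :: "'a \<Rightarrow> 'a"
  cnorm :: "'a \<Rightarrow> real"

text \<open>Here \<open>class_ring\<close> is the field of complex numbers as a ring record. The module locale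
  of the library does not relate scalars to the (noncommutative) multiplication, hence the two
  \<open>smult_mult\<close> axioms.\<close>

locale unital_cstar_algebra =
  Module.module "class_ring :: complex ring" A + Ring.ring A
  for A :: "'a cstar" (structure) +
  assumes smult_mult_left:
      "\<lbrakk>x \<in> carrier A; y \<in> carrier A\<rbrakk> \<Longrightarrow> (c \<odot> x) \<otimes> y = c \<odot> (x \<otimes> y)"
    and smult_mult_right:
      "\<lbrakk>x \<in> carrier A; y \<in> carrier A\<rbrakk> \<Longrightarrow> x \<otimes> (c \<odot> y) = c \<odot> (x \<otimes> y)"
    and star_closed: "x \<in> carrier A \<Longrightarrow> star A x \<in> carrier A"
    and star_star: "x \<in> carrier A \<Longrightarrow> star A (star A x) = x"
    and star_add:
      "\<lbrakk>x \<in> carrier A; y \<in> carrier A\<rbrakk> \<Longrightarrow> star A (x \<oplus> y) = star A x \<oplus> star A y"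
    and star_smult: "x \<in> carrier A \<Longrightarrow> star A (c \<odot> x) = cnj c \<odot> star A x"
    and star_mult:
      "\<lbrakk>x \<in> carrier A; y \<in> carrier A\<rbrakk> \<Longrightarrow> star A (x \<otimes> y) = star A y \<otimes> star A x"
    and cnorm_nonneg: "x \<in> carrier A \<Longrightarrow> 0 \<le> cnorm A x"
    and cnorm_eq_0: "x \<in> carrier A \<Longrightarrow> cnorm A x = 0 \<longleftrightarrow> x = \<zero>"
    and cnorm_triangle:
      "\<lbrakk>x \<in> carrier A; y \<in> carrier A\<rbrakk> \<Longrightarrow> cnorm A (x \<oplus> y) \<le> cnorm A x + cnorm A y"
    and cnorm_smult: "x \<in> carrier A \<Longrightarrow> cnorm A (c \<odot> x) = cmod c * cnorm A x"
    and cnorm_mult: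
      "\<lbrakk>x \<in> carrier A; y \<in> carrier A\<rbrakk> \<Longrightarrow> cnorm A (x \<otimes> y) \<le> cnorm A x * cnorm A y"
    and cstar_identity: "x \<in> carrier A \<Longrightarrow> cnorm A (star A x \<otimes> x) = (cnorm A x)\<^sup>2"
    and complete:
      "\<lbrakk>\<And>n. X n \<in> carrier A;
        \<forall>e>0. \<exists>N. \<forall>m\<ge>N. \<forall>n\<ge>N. cnorm A (X m \<ominus> X n) < e\<rbrakk>
       \<Longrightarrow> \<exists>x\<in>carrier A. (\<lambda>n. cnorm A (X n \<ominus> x)) \<longlonglongrightarrow> 0"

text \<open>Existence of a separable C*-algebra is later asserted on the type
  \<open>nat \<Rightarrow> complex mat\<close>. This loses no generality: a separable metric space has at most
  continuum many points, so every separable C*-algebra has an isomorphic copy with carrier in that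
  type.\<close>

definition separable_cstar :: "'a cstar \<Rightarrow> bool" where
  "separable_cstar A \<longleftrightarrow>
     (\<exists>D\<subseteq>carrier A. countable D \<and>
        (\<forall>x\<in>carrier A. \<forall>e>0. \<exists>d\<in>D. cnorm A (x \<ominus>\<^bsub>A\<^esub> d) < e))"

definition star_hom :: "'a cstar \<Rightarrow> 'b cstar \<Rightarrow> ('a \<Rightarrow> 'b) set" where
  "star_hom A B = {h \<in> carrier A \<rightarrow> carrier B.
     (\<forall>x\<in>carrier A. \<forall>y\<in>carrier A. h (x \<oplus>\<^bsub>A\<^esub> y) = h x \<oplus>\<^bsub>B\<^esub> h y) \<and>
     (\<forall>c. \<forall>x\<in>carrier A. h (c \<odot>\<^bsub>A\<^esub> x) = c \<odot>\<^bsub>B\<^esub> h x) \<and>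
     (\<forall>x\<in>carrier A. \<forall>y\<in>carrier A. h (x \<otimes>\<^bsub>A\<^esub> y) = h x \<otimes>\<^bsub>B\<^esub> h y) \<and>
     (\<forall>x\<in>carrier A. h (star A x) = star B (h x))}"

definition unital_star_hom :: "'a cstar \<Rightarrow> 'b cstar \<Rightarrow> ('a \<Rightarrow> 'b) set" where
  "unital_star_hom A B = {h \<in> star_hom A B. h \<one>\<^bsub>A\<^esub> = \<one>\<^bsub>B\<^esub>}"

text \<open>Positivity uses the usual partial order on the complex numbers, so it includes that the value
  is real. Only the values on the carrier are constrained, and only those matter.\<close>

definition tracial_state :: "'a cstar \<Rightarrow> ('a \<Rightarrow> complex) \<Rightarrow> bool" where
  "tracial_state A \<tau> \<longleftrightarrow>
     (\<forall>x\<in>carrier A. \<forall>y\<in>carrier A. \<tau> (x \<oplus>\<^bsub>A\<^esub> y) = \<tau> x + \<tau> y) \<and>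
     (\<forall>c. \<forall>x\<in>carrier A. \<tau> (c \<odot>\<^bsub>A\<^esub> x) = c * \<tau> x) \<and>
     (\<forall>x\<in>carrier A. 0 \<le> \<tau> (star A x \<otimes>\<^bsub>A\<^esub> x)) \<and>
     \<tau> \<one>\<^bsub>A\<^esub> = 1 \<and>
     (\<forall>x\<in>carrier A. \<forall>y\<in>carrier A. \<tau> (x \<otimes>\<^bsub>A\<^esub> y) = \<tau> (y \<otimes>\<^bsub>A\<^esub> x))"

definition two_norm :: "'a cstar \<Rightarrow> ('a \<Rightarrow> complex) \<Rightarrow> 'a \<Rightarrow> real" where
  "two_norm A \<rho> x = sqrt (Re (\<rho> (star A x \<otimes>\<^bsub>A\<^esub> x)))"


section \<open>Full matrix algebras\<close>

definition vec_l2norm :: "complex vec \<Rightarrow> real" where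
  "vec_l2norm v = sqrt (Re (v \<bullet>c v))"

definition mat_opnorm :: "complex mat \<Rightarrow> real" where
  "mat_opnorm M = (SUP v\<in>{v \<in> carrier_vec (dim_col M). vec_l2norm v \<le> 1}. vec_l2norm (M *\<^sub>v v))"

definition mat_cstar :: "nat \<Rightarrow> complex mat cstar" where
  "mat_cstar n =
     \<lparr>carrier = carrier_mat n n, monoid.mult = (*), one = 1\<^sub>m n, zero = 0\<^sub>m n n, add = (+),
      module.smult = (\<cdot>\<^sub>m), star = mat_adjoint, cnorm = mat_opnorm\<rparr>"

definition norm_trace :: "nat \<Rightarrow> complex mat \<Rightarrow> complex" where
  "norm_trace n M = (\<Sum>i<n. M $$ (i, i)) / of_nat n"

definition residually_finite_dimensional :: "'a cstar \<Rightarrow> bool" where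
  "residually_finite_dimensional A \<longleftrightarrow>
     (\<forall>x\<in>carrier A. \<forall>y\<in>carrier A. x \<noteq> y \<longrightarrow>
        (\<exists>n. \<exists>h\<in>star_hom A (mat_cstar n). h x \<noteq> h y))"


section \<open>Tracial ultraproducts\<close>

text \<open>An ultrafilter on a set \<open>I\<close> is encoded as a library filter on the ambient type that
  concentrates on \<open>I\<close>; its member sets are the sets \<open>E \<subseteq> I\<close> with
  \<open>eventually (\<lambda>i. i \<in> E) \<alpha>\<close>.\<close>

definition ultrafilter_on :: "'i set \<Rightarrow> 'i filter \<Rightarrow> bool" where
  "ultrafilter_on I \<alpha> \<longleftrightarrow>
     \<alpha> \<noteq> bot \<and> eventually (\<lambda>i. i \<in> I) \<alpha> \<and>
     (\<forall>E\<subseteq>I. eventually (\<lambda>i. i \<in> E) \<alpha> \<or> eventually (\<lambda>i. i \<in> I - E) \<alpha>)"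

definition nontrivial_ultrafilter_on :: "'i set \<Rightarrow> 'i filter \<Rightarrow> bool" where
  "nontrivial_ultrafilter_on I \<alpha> \<longleftrightarrow>
     ultrafilter_on I \<alpha> \<and>
     (\<exists>E :: nat \<Rightarrow> 'i set.
        (\<forall>n. E n \<subseteq> I \<and> eventually (\<lambda>i. i \<in> E n) \<alpha>) \<and> (\<Inter>n. E n) = {})"

definition cstar_product :: "'i set \<Rightarrow> ('i \<Rightarrow> 'a cstar) \<Rightarrow> ('i \<Rightarrow> 'a) cstar" where
  "cstar_product I A =
     \<lparr>carrier = {a \<in> (\<Pi>\<^sub>E i\<in>I. carrier (A i)). \<exists>K. \<forall>i\<in>I. cnorm (A i) (a i) \<le> K},
      monoid.mult = (\<lambda>a b. \<lambda>i\<in>I. a i \<otimes>\<^bsub>A i\<^esub> b i),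
      one = (\<lambda>i\<in>I. \<one>\<^bsub>A i\<^esub>),
      zero = (\<lambda>i\<in>I. \<zero>\<^bsub>A i\<^esub>),
      add = (\<lambda>a b. \<lambda>i\<in>I. a i \<oplus>\<^bsub>A i\<^esub> b i),
      module.smult = (\<lambda>c a. \<lambda>i\<in>I. c \<odot>\<^bsub>A i\<^esub> a i),
      star = (\<lambda>a. \<lambda>i\<in>I. star (A i) (a i)),
      cnorm = (\<lambda>a. SUP i\<in>I. cnorm (A i) (a i))\<rparr>"

text \<open>The ring structure is that of the library quotient \<open>Quot\<close>. For
  scalar multiplication the union of cosets (rather than the image of \<open>X\<close>) is needed because
  of the scalar \<open>0\<close>.\<close>

definition cstar_quotient :: "'a cstar \<Rightarrow> 'a set \<Rightarrow> 'a set cstar" where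
  "cstar_quotient B J =
     \<lparr>carrier = carrier (B Quot J),
      monoid.mult = monoid.mult (B Quot J),
      one = one (B Quot J),
      zero = zero (B Quot J),
      add = add (B Quot J),
      module.smult = (\<lambda>c X. \<Union>x\<in>X. J +>\<^bsub>B\<^esub> (c \<odot>\<^bsub>B\<^esub> x)),
      star = (\<lambda>X. \<Union>x\<in>X. J +>\<^bsub>B\<^esub> star B x),
      cnorm = (\<lambda>X. INF x\<in>X. cnorm B x)\<rparr>"

definition trace_ideal ::
  "'i set \<Rightarrow> 'i filter \<Rightarrow> ('i \<Rightarrow> 'a cstar) \<Rightarrow> ('i \<Rightarrow> 'a \<Rightarrow> complex) \<Rightarrow> ('i \<Rightarrow> 'a) set" where
  "trace_ideal I \<alpha> A \<rho> =
     {a \<in> carrier (cstar_product I A). ((\<lambda>i. two_norm (A i) (\<rho> i) (a i)) \<longlongrightarrow> 0) \<alpha>}"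

definition tracial_ultraproduct ::
  "'i set \<Rightarrow> 'i filter \<Rightarrow> ('i \<Rightarrow> 'a cstar) \<Rightarrow> ('i \<Rightarrow> 'a \<Rightarrow> complex) \<Rightarrow> ('i \<Rightarrow> 'a) set cstar" where
  "tracial_ultraproduct I \<alpha> A \<rho> = cstar_quotient (cstar_product I A) (trace_ideal I \<alpha> A \<rho>)"

definition ultra_coset ::
  "'i set \<Rightarrow> 'i filter \<Rightarrow> ('i \<Rightarrow> 'a cstar) \<Rightarrow> ('i \<Rightarrow> 'a \<Rightarrow> complex) \<Rightarrow> ('i \<Rightarrow> 'a) \<Rightarrow> ('i \<Rightarrow> 'a) set" where
  "ultra_coset I \<alpha> A \<rho> a = trace_ideal I \<alpha> A \<rho> +>\<^bsub>cstar_product I A\<^esub> a"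


section \<open>Tracial stability\<close>

definition approximately_liftable ::
  "'i set \<Rightarrow> 'i filter \<Rightarrow> ('i \<Rightarrow> 'b cstar) \<Rightarrow> ('i \<Rightarrow> 'b \<Rightarrow> complex) \<Rightarrow>
   'a cstar \<Rightarrow> ('a \<Rightarrow> ('i \<Rightarrow> 'b) set) \<Rightarrow> bool" where
  "approximately_liftable I \<alpha> B \<rho> A \<pi> \<longleftrightarrow>
     (\<exists>E\<subseteq>I. eventually (\<lambda>i. i \<in> E) \<alpha> \<and>
        (\<exists>\<phi>. (\<forall>i\<in>E. \<phi> i \<in> unital_star_hom A (B i)) \<and>
             (\<forall>a\<in>carrier A.
                \<pi> a = ultra_coset I \<alpha> B \<rho> (\<lambda>i\<in>I. if i \<in> E then \<phi> i a else \<zero>\<^bsub>B i\<^esub>))))"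

text \<open>Since HOL cannot quantify over all sets, the ambient type \<open>'i\<close> of the index sets is an
  explicit parameter. The notion is strongest for large \<open>'i\<close>, so its failure
  already for \<open>'i = nat\<close> is the strongest form of failure: it exhibits a non-liftable
  homomorphism into an ultraproduct over a countable index set.\<close>

definition matricially_tracially_stable :: "'i itself \<Rightarrow> 'a cstar \<Rightarrow> bool" where
  "matricially_tracially_stable TYPE('i) A \<longleftrightarrow>
     (\<forall>(I :: 'i set) \<alpha> k \<rho> \<pi>.
        infinite I \<longrightarrow> nontrivial_ultrafilter_on I \<alpha> \<longrightarrow>
        (\<forall>i\<in>I. 1 \<le> k i \<and> tracial_state (mat_cstar (k i)) (\<rho> i)) \<longrightarrow>
        \<pi> \<in> unital_star_hom A (tracial_ultraproduct I \<alpha> (\<lambda>i. mat_cstar (k i)) \<rho>) \<longrightarrow>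
        approximately_liftable I \<alpha> (\<lambda>i. mat_cstar (k i)) \<rho> A \<pi>)"

end

theory Submission
  imports "HOL-Analysis.Operator_Norm" "HOL-Analysis.L2_Norm" "HOL-Analysis.Inner_Product"
    "HOL-Analysis.Topology_Euclidean_Space" "HOL-Library.Diagonal_Subsequence" "HOL-Library.Countable"
    "Jordan_Normal_Form.Spectral_Radius" Defs
begin

text \<open>
  The algebra is built from matrix blocks. Choose sizes \<open>k 0 = 1\<close>, \<open>k 1\<close>, \<open>k 2\<close>, ... that grow by a factor
  of at least a million from each to the next, and let \<open>D\<close> be a countable *-algebra over the Gaussian
  rationals of bounded sequences \<open>d\<close> with \<open>d j\<close> a complex matrix of size \<open>k j\<close>. It contains the
  matrix units of each single block, three sequences of unitaries \<open>clock (k j)\<close>, \<open>chirp (k j)\<close>,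
  \<open>fourier (k j)\<close>, and for each \<open>r\<close> a projection whose normalized traces tend to \<open>1 / (r + 1)\<close>. Moreover
  \<open>D\<close> is closed under writing \<open>d - tr(d)\<close> (the normalized trace taken in each block) as a sum of two
  commutators, and after passing to a subsequence of blocks the normalized traces of each \<open>d\<close> in \<open>D\<close>
  converge. The algebra is the norm closure of \<open>D\<close>. It is separable, and its coordinates separate
  points.

  Why every tracial state is a limit of matrix traces. A tracial state \<open>\<phi>\<close> kills commutators, so its
  value at \<open>d\<close> is its value at the sequence of scalars \<open>tr(d j)\<close>. With \<open>w j\<close> the value of \<open>\<phi>\<close> at the unit of
  block \<open>j\<close> and \<open>L\<close> the limit of the normalized traces this gives
  \<open>\<phi> d = L + (\<Sum>j. w j * (tr(d j) - L))\<close>, see \<open>phi_formula\<close>. The weights \<open>w j\<close> have sum at most one, and the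
  missing mass acts like a block far out. Hence direct sums of coordinate
  representations whose multiplicities approximate the weights approximate \<open>\<phi>\<close>; the block of size one
  fills up the dimension to any prescribed \<open>n\<close> (\<open>weight_rounding\<close>, \<open>tracial_approximation\<close>).

  Why stability fails. Compress the coordinate \<open>i\<close> to the corner of size \<open>n = k i - 1\<close>. This is
  multiplicative up to an error of rank one, which vanishes in the tracial ultraproduct of the
  matrix algebras of size \<open>k i - 1\<close>. An approximate lift would supply, for some \<open>i\<close>, a representation \<open>\<theta>\<close> of
  the algebra on the corner that is close in normalized Hilbert-Schmidt norm to the compression of
  the three unitaries. But \<open>\<theta>\<close> cannot see the blocks of size at least \<open>k i\<close>, since \<open>n < k i\<close>, and it is
  supported on the remaining blocks: on a part that vanishes on the blocks, the
  projection of trace about \<open>1 / (n + 1)\<close> would go to a nonzero projection of trace below one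
  (\<open>th_blocks_exhaust\<close>). So \<open>\<theta>\<close> is a direct sum of representations of size at most \<open>n / 4\<close>, and a projection of rank
  between about \<open>n / 4\<close> and \<open>n / 2\<close> commutes with it. This projection nearly commutes with the three unitaries in the full
  matrix algebra of size \<open>k i\<close>. That contradicts a spectral gap: a traceless matrix that nearly
  commutes with \<open>clock N\<close>, \<open>chirp N\<close> and \<open>fourier N\<close> is zero, with a constant that does not depend on \<open>N\<close>
  (\<open>expander_gap\<close>). On Weyl coefficients the three unitaries act by modulation, shear and rotation of
  the discrete torus, and the gap is a ping-pong argument in the plane.

  All matrices live in one type \<open>fmat\<close> of finitely supported infinite matrices, where the corner of
  size \<open>n\<close> plays the matrix algebra of size \<open>n\<close>. Only at the end are the results carried over to the
  matrices of varying dimension in which the theorem is stated.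
\<close>

section \<open>Complex matrices of all sizes\<close>

text \<open>One type for the matrix algebras of all sizes: the algebra of size \<open>n\<close> is the set \<open>corner n\<close> with unit
  \<open>idn n\<close>. Sizes become side conditions, so that compressions, direct sums and sequences of growing
  matrices need no change of type, and the ring laws hold without side conditions.\<close>

typedef fmat = "{f :: nat \<Rightarrow> nat \<Rightarrow> complex. \<exists>n. \<forall>i j. n \<le> i \<or> n \<le> j \<longrightarrow> f i j = 0}"
  morphisms ent Abs_fmat
  by (rule exI[of _ "\<lambda>_ _. 0"]) auto

definition corner :: "nat \<Rightarrow> fmat set" where
  "corner n = {x. \<forall>i j. n \<le> i \<or> n \<le> j \<longrightarrow> ent x i j = 0}"

lemma fmat_eqI: "(\<And>i j. ent x i j = ent y i j) \<Longrightarrow> x = y"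
  by (metis ent_inject ext)

lemma cornerI: "(\<And>i j. n \<le> i \<or> n \<le> j \<Longrightarrow> ent x i j = 0) \<Longrightarrow> x \<in> corner n"
  by (auto simp: corner_def)

lemma cornerD: "x \<in> corner n \<Longrightarrow> n \<le> i \<or> n \<le> j \<Longrightarrow> ent x i j = 0"
  by (auto simp: corner_def)

lemma corner_mono: "x \<in> corner m \<Longrightarrow> m \<le> n \<Longrightarrow> x \<in> corner n"
  by (auto simp: corner_def)

lemma ex_corner: "\<exists>n. x \<in> corner n"
  using ent[of x] by (auto simp: corner_def)

lemma ex_corner2: "\<exists>n. x \<in> corner n \<and> y \<in> corner n"
  by (meson ex_corner corner_mono nat_le_linear)

lemma ex_corner3: "\<exists>n. x \<in> corner n \<and> y \<in> corner n \<and> z \<in> corner n"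
  by (meson ex_corner ex_corner2 corner_mono nat_le_linear)

definition trunc :: "nat \<Rightarrow> (nat \<Rightarrow> nat \<Rightarrow> complex) \<Rightarrow> fmat" where
  "trunc n f = Abs_fmat (\<lambda>i j. if i < n \<and> j < n then f i j else 0)"

lemma ent_trunc: "ent (trunc n f) i j = (if i < n \<and> j < n then f i j else 0)"
  unfolding trunc_def by (subst Abs_fmat_inverse) (auto intro!: exI[of _ n])

lemma trunc_corner [simp]: "trunc n f \<in> corner n"
  by (auto simp: corner_def ent_trunc)

text \<open>The ring operations are defined on a corner that contains the support. Any large enough corner
  gives the same result; \<open>fsize\<close> picks the smallest.\<close>

definition fsize :: "fmat \<Rightarrow> nat" where "fsize x = (LEAST n. x \<in> corner n)"

lemma fsize_corner: "x \<in> corner (fsize x)"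
  unfolding fsize_def by (metis LeastI_ex ex_corner)

instantiation fmat :: ring
begin

definition "zero_fmat = trunc 0 (\<lambda>_ _. 0)"
definition "plus_fmat x y = trunc (max (fsize x) (fsize y)) (\<lambda>i j. ent x i j + ent y i j)"
definition "uminus_fmat x = trunc (fsize x) (\<lambda>i j. - ent x i j)"
definition "minus_fmat x (y::fmat) = x + (- y)"
definition "times_fmat x y =
  trunc (max (fsize x) (fsize y)) (\<lambda>i j. \<Sum>l<max (fsize x) (fsize y). ent x i l * ent y l j)"

lemma ent_0 [simp]: "ent 0 i j = 0"
  by (simp add: zero_fmat_def ent_trunc)

lemma ent_outside: "fsize x \<le> i \<or> fsize x \<le> j \<Longrightarrow> ent x i j = 0"
  using fsize_corner cornerD by blast

lemma ent_add [simp]: "ent (x + y) i j = ent x i j + ent y i j"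
  by (auto simp: plus_fmat_def ent_trunc not_less ent_outside)

lemma ent_uminus [simp]: "ent (- x) i j = - ent x i j"
  by (auto simp: uminus_fmat_def ent_trunc ent_outside)

lemma ent_diff [simp]: "ent (x - y) i j = ent x i j - ent y i j"
  by (simp add: minus_fmat_def)

lemma ent_mult:
  assumes "x \<in> corner n \<or> y \<in> corner n"
  shows "ent (x * y) i j = (\<Sum>l<n. ent x i l * ent y l j)"
proof -
  let ?m = "max (fsize x) (fsize y)"
  have "ent (x * y) i j = (\<Sum>l<?m. ent x i l * ent y l j)"
    by (auto simp: times_fmat_def ent_trunc ent_outside not_less intro!: sum.neutral[symmetric])
  also have "\<dots> = (\<Sum>l<n. ent x i l * ent y l j)"
    by (rule sum.mono_neutral_cong) (use assms in \<open>auto simp: ent_outside dest: cornerD\<close>)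
  finally show ?thesis .
qed

instance
proof
  fix a b c :: fmat
  show "a + b + c = a + (b + c)" "a + b = b + a" "0 + a = a" "- a + a = 0" "a - b = a + - b"
    by (auto intro!: fmat_eqI)
  obtain n where n: "a \<in> corner n" "b \<in> corner n" "c \<in> corner n"
    using ex_corner3 by blast
  show "a * b * c = a * (b * c)"
  proof (rule fmat_eqI)
    fix i j
    have "ent (a * b * c) i j = (\<Sum>l<n. \<Sum>k<n. ent a i k * ent b k l * ent c l j)"
      using n by (simp add: ent_mult[of _ n] sum_distrib_right)
    also have "\<dots> = (\<Sum>k<n. \<Sum>l<n. ent a i k * ent b k l * ent c l j)"
      by (rule sum.swap)
    also have "\<dots> = ent (a * (b * c)) i j"
      using n by (simp add: ent_mult[of _ n] sum_distrib_left mult.assoc)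
    finally show "ent (a * b * c) i j = ent (a * (b * c)) i j" .
  qed
  show "(a + b) * c = a * c + b * c" "a * (b + c) = a * b + a * c"
    using n by (auto intro!: fmat_eqI simp: ent_mult[of _ n] algebra_simps sum.distrib)
qed

end

lemma zero_corner [simp]: "0 \<in> corner n" by (simp add: cornerI)
lemma add_corner [simp]: "x \<in> corner n \<Longrightarrow> y \<in> corner n \<Longrightarrow> x + y \<in> corner n"
  by (auto simp: corner_def)
lemma diff_corner [simp]: "x \<in> corner n \<Longrightarrow> y \<in> corner n \<Longrightarrow> x - y \<in> corner n"
  by (auto simp: corner_def)
lemma uminus_corner [simp]: "x \<in> corner n \<Longrightarrow> - x \<in> corner n"
  by (auto simp: corner_def)
lemma mult_corner [simp]:
  assumes "x \<in> corner n" "y \<in> corner n" shows "x * y \<in> corner n"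
  by (rule cornerI) (use assms in \<open>auto simp: ent_mult[of _ n] dest: cornerD intro!: sum.neutral\<close>)
lemma sum_corner [simp]: "(\<And>i. i \<in> I \<Longrightarrow> f i \<in> corner n) \<Longrightarrow> sum f I \<in> corner n"
  by (induction I rule: infinite_finite_induct) auto

lemma ent_sum [simp]: "ent (sum f I) i j = (\<Sum>k\<in>I. ent (f k) i j)"
  by (induction I rule: infinite_finite_induct) auto

text \<open>Complex scalars act by an explicit function because the type classes of normed spaces provide real
  scalars only.\<close>

definition cscale :: "complex \<Rightarrow> fmat \<Rightarrow> fmat" where "cscale c x = trunc (fsize x) (\<lambda>i j. c * ent x i j)"
definition adj :: "fmat \<Rightarrow> fmat" where "adj x = trunc (fsize x) (\<lambda>i j. cnj (ent x j i))"
definition tr :: "fmat \<Rightarrow> complex" where "tr x = (\<Sum>i<fsize x. ent x i i)"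
definition idn :: "nat \<Rightarrow> fmat" where "idn n = trunc n (\<lambda>i j. if i = j then 1 else 0)"
definition munit :: "nat \<Rightarrow> nat \<Rightarrow> fmat" where
  "munit a b = trunc (Suc (max a b)) (\<lambda>i j. if i = a \<and> j = b then 1 else 0)"

lemma ent_cscale [simp]: "ent (cscale c x) i j = c * ent x i j"
  by (auto simp: cscale_def ent_trunc ent_outside)
lemma ent_adj [simp]: "ent (adj x) i j = cnj (ent x j i)"
  by (auto simp: adj_def ent_trunc ent_outside)
lemma ent_idn: "ent (idn n) i j = (if i = j \<and> i < n then 1 else 0)"
  by (auto simp: idn_def ent_trunc)
lemma ent_munit: "ent (munit a b) i j = (if i = a \<and> j = b then 1 else 0)"
  by (auto simp: munit_def ent_trunc)

lemma cscale_corner [simp]: "x \<in> corner n \<Longrightarrow> cscale c x \<in> corner n" by (auto simp: corner_def)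
lemma adj_corner [simp]: "x \<in> corner n \<Longrightarrow> adj x \<in> corner n" by (auto simp: corner_def)
lemma idn_corner [simp]: "m \<le> n \<Longrightarrow> idn m \<in> corner n" by (auto simp: corner_def ent_idn)
lemma munit_corner [simp]: "a < n \<Longrightarrow> b < n \<Longrightarrow> munit a b \<in> corner n"
  by (auto simp: corner_def ent_munit)

lemma tr_eq: "x \<in> corner n \<Longrightarrow> tr x = (\<Sum>i<n. ent x i i)"
  unfolding tr_def
  by (rule sum.mono_neutral_cong) (auto simp: ent_outside dest: cornerD)

lemma cscale_simps:
  "cscale c (x + y) = cscale c x + cscale c y" "cscale c (x - y) = cscale c x - cscale c y"
  "cscale (c + d) x = cscale c x + cscale d x" "cscale (c - d) x = cscale c x - cscale d x"
  "cscale c (cscale d x) = cscale (c * d) x" "cscale 1 x = x" "cscale 0 x = 0" "cscale c 0 = 0" "cscale (- c) x = - cscale c x"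
  "cscale c (- x) = - cscale c x"
  by (auto intro!: fmat_eqI simp: algebra_simps)

lemma cscale_mult_left: "cscale c x * y = cscale c (x * y)" and cscale_mult_right: "x * cscale c y = cscale c (x * y)"
proof -
  obtain n where n: "x \<in> corner n" "y \<in> corner n" using ex_corner2 by blast
  show "cscale c x * y = cscale c (x * y)" "x * cscale c y = cscale c (x * y)"
    using n by (auto intro!: fmat_eqI simp: ent_mult[of _ n] sum_distrib_left algebra_simps)
qed

lemma adj_simps [simp]:
  "adj (x + y) = adj x + adj y" "adj (x - y) = adj x - adj y" "adj (- x) = - adj x"
  "adj 0 = 0" "adj (adj x) = x" "adj (cscale c x) = cscale (cnj c) (adj x)" "adj (idn n) = idn n"
  "adj (munit a b) = munit b a"
  by (auto intro!: fmat_eqI simp: ent_idn ent_munit)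

lemma adj_mult [simp]: "adj (x * y) = adj y * adj x"
proof -
  obtain n where n: "x \<in> corner n" "y \<in> corner n" using ex_corner2 by blast
  then show ?thesis
    by (auto intro!: fmat_eqI simp: ent_mult[of _ n] algebra_simps)
qed

lemma adj_sum [simp]: "adj (sum f I) = (\<Sum>i\<in>I. adj (f i))"
  by (induction I rule: infinite_finite_induct) auto

lemma tr_simps [simp]:
  "tr (x + y) = tr x + tr y" "tr (x - y) = tr x - tr y" "tr (- x) = - tr x" "tr 0 = 0"
  "tr (cscale c x) = c * tr x" "tr (adj x) = cnj (tr x)"
proof -
  obtain n where n: "x \<in> corner n" "y \<in> corner n" using ex_corner2 by blast
  show "tr (x + y) = tr x + tr y" "tr (x - y) = tr x - tr y" "tr (- x) = - tr x" "tr 0 = 0"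
    "tr (cscale c x) = c * tr x" "tr (adj x) = cnj (tr x)"
    using n by (simp_all add: tr_eq[of _ n] sum.distrib sum_subtractf sum_negf sum_distrib_left)
qed

lemma tr_sum [simp]: "tr (sum f I) = (\<Sum>i\<in>I. tr (f i))"
  by (induction I rule: infinite_finite_induct) auto

lemma tr_idn [simp]: "tr (idn n) = of_nat n"
  by (simp add: tr_eq[of _ n] ent_idn)

lemma tr_munit: "tr (munit a b) = (if a = b then 1 else 0)"
proof -
  have "munit a b \<in> corner (Suc (max a b))" by simp
  from tr_eq[OF this] show ?thesis by (cases "a = b") (auto simp: ent_munit)
qed

lemma tr_mult: "x \<in> corner n \<Longrightarrow> y \<in> corner n \<Longrightarrow> tr (x * y) = (\<Sum>i<n. \<Sum>l<n. ent x i l * ent y l i)"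
  by (simp add: tr_eq[of _ n] ent_mult[of _ n])

lemma tr_commute: "tr (x * y) = tr (y * x)"
proof -
  obtain n where n: "x \<in> corner n" "y \<in> corner n" using ex_corner2 by blast
  show ?thesis
    using n by (simp add: tr_mult[of _ n]) (subst sum.swap, simp add: mult.commute)
qed

lemma idn_mult_left: "x \<in> corner n \<Longrightarrow> n \<le> m \<Longrightarrow> idn m * x = x"
  and idn_mult_right: "x \<in> corner n \<Longrightarrow> n \<le> m \<Longrightarrow> x * idn m = x"
proof -
  assume x: "x \<in> corner n" and nm: "n \<le> m"
  have *: "(\<Sum>l<n. (if i = l \<and> i < m then 1 else 0) * c l) = (if i < n then c i else 0)"
    "(\<Sum>l<n. c l * (if l = i \<and> l < m then 1 else 0)) = (if i < n then c i else 0)"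
    for i and c :: "nat \<Rightarrow> complex"
    using nm by (auto simp: if_distrib if_distribR Int_def sum.delta sum.delta' cong: if_cong
        intro!: sum.neutral)
  show "idn m * x = x" "x * idn m = x"
    using x by (auto intro!: fmat_eqI simp: ent_mult[of _ n] ent_idn * not_less cornerD[of x n])
qed

lemma idn_mult_idn: "idn m * idn n = idn (min m n)"
  by (cases "m \<le> n") (auto simp: idn_mult_right[of _ m] idn_mult_left[of _ n] min_def)

lemma corner_iff: "x \<in> corner n \<longleftrightarrow> idn n * x * idn n = x"
proof
  show "idn n * x * idn n = x" if "x \<in> corner n"
    using that by (simp add: idn_mult_left[of _ n] idn_mult_right[of _ n])
  assume *: "idn n * x * idn n = x"
  show "x \<in> corner n"
  proof (rule cornerI)
    fix i j assume "n \<le> i \<or> n \<le> j"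
    then have "ent (idn n * x * idn n) i j = 0"
      by (simp only: ent_mult[of _ n] idn_corner simp_thms order_refl)
        (auto simp: ent_idn intro!: sum.neutral)
    then show "ent x i j = 0" by (simp add: *)
  qed
qed

lemma compress_corner [simp]: "idn n * x * idn n \<in> corner n"
  unfolding corner_iff by (metis idn_mult_idn min.idem mult.assoc)

lemma ent_munit_mult: "ent (munit a b * x) i j = (if i = a then ent x b j else 0)"
proof -
  obtain n where n: "munit a b \<in> corner n" "x \<in> corner n" using ex_corner2 by blast
  have "b < n" using cornerD[OF n(1), of a b] by (auto simp: ent_munit not_le[symmetric])
  have "ent (munit a b * x) i j = (\<Sum>l<n. if l = b then (if i = a then ent x l j else 0) else 0)"
    unfolding ent_mult[OF disjI1[OF n(1)]] ent_munit by (rule sum.cong) auto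
  also have "\<dots> = (if i = a then ent x b j else 0)"
    using \<open>b < n\<close> by simp
  finally show ?thesis .
qed

lemma munit_mult: "munit a b * munit c d = (if b = c then munit a d else 0)"
  by (rule fmat_eqI) (simp add: ent_munit_mult ent_munit)

lemma ent_mult_munit: "ent (x * munit a b) i j = (if j = b then ent x i a else 0)"
proof -
  have "ent (x * munit a b) i j = cnj (ent (munit b a * adj x) j i)"
    using ent_adj[of "munit b a * adj x" i j] by simp
  then show ?thesis by (simp add: ent_munit_mult)
qed

lemma corner_expand:
  assumes "x \<in> corner n"
  shows "x = (\<Sum>a<n. \<Sum>b<n. cscale (ent x a b) (munit a b))"
proof (rule fmat_eqI)
  fix i j
  have "ent (\<Sum>a<n. \<Sum>b<n. cscale (ent x a b) (munit a b)) i j =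
      (\<Sum>a<n. \<Sum>b<n. if i = a \<and> j = b then ent x a b else 0)"
    unfolding ent_sum ent_cscale ent_munit by (intro sum.cong refl) simp
  also have "\<dots> = (\<Sum>a<n. if i = a then (\<Sum>b<n. if j = b then ent x a b else 0) else 0)"
    by (intro sum.cong refl) simp
  also have "\<dots> = ent x i j"
    using assms by (auto simp: not_less cornerD)
  finally show "ent x i j = ent (\<Sum>a<n. \<Sum>b<n. cscale (ent x a b) (munit a b)) i j" by (rule sym)
qed

lemma idn_expand: "idn n = (\<Sum>a<n. munit a a)"
proof (rule fmat_eqI)
  fix i j
  have "ent (\<Sum>a<n. munit a a) i j = (\<Sum>a<n. if a = i then (if i = j then 1 else 0) else 0)"
    unfolding ent_sum by (rule sum.cong) (auto simp: ent_munit)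
  then show "ent (idn n) i j = ent (\<Sum>a<n. munit a a) i j"
    by (simp add: ent_idn)
qed

section \<open>Hilbert-Schmidt norm and operator norm\<close>

text \<open>The norm of the type class is the Hilbert-Schmidt norm. It is the norm in which the ultraproduct
  compares matrices, and being Euclidean it is convenient for the spectral gap.\<close>

instantiation fmat :: real_inner
begin

definition "scaleR_fmat r (x::fmat) = cscale (of_real r) x"
definition "inner_fmat x (y::fmat) = Re (tr (adj x * y))"
definition "norm_fmat (x::fmat) = sqrt (Re (tr (adj x * x)))"
definition "sgn_fmat (x::fmat) = cscale (of_real (inverse (norm x))) x"
definition "dist_fmat x (y::fmat) = norm (x - y)"
definition [code del]: "(uniformity :: (fmat \<times> fmat) filter) = (INF e\<in>{0 <..}. principal {(x, y). dist x y < e})"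
definition [code del]: "open (U :: fmat set) \<longleftrightarrow> (\<forall>x\<in>U. eventually (\<lambda>(x', y). x' = x \<longrightarrow> y \<in> U) uniformity)"

lemma tr_adj_mult: "x \<in> corner n \<Longrightarrow> y \<in> corner n \<Longrightarrow>
  tr (adj x * y) = (\<Sum>i<n. \<Sum>l<n. cnj (ent x l i) * ent y l i)"
  by (simp add: tr_mult[of _ n])

lemma tr_adj_self: "x \<in> corner n \<Longrightarrow>
  tr (adj x * x) = of_real (\<Sum>i<n. \<Sum>l<n. (cmod (ent x i l))\<^sup>2)"
  by (simp add: tr_adj_mult[of _ n] complex_norm_square mult.commute del: of_real_power)
    (subst sum.swap, simp)

instance
proof
  fix x y z :: fmat and r s :: real
  show "r *\<^sub>R (x + y) = r *\<^sub>R x + r *\<^sub>R y" "(r + s) *\<^sub>R x = r *\<^sub>R x + s *\<^sub>R x"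
    "r *\<^sub>R s *\<^sub>R x = (r * s) *\<^sub>R x" "1 *\<^sub>R x = x"
    by (simp_all add: scaleR_fmat_def cscale_simps)
  show "sgn x = inverse (norm x) *\<^sub>R x" "dist x y = norm (x - y)"
    by (simp_all add: sgn_fmat_def dist_fmat_def scaleR_fmat_def)
  show "(uniformity :: (fmat \<times> fmat) filter) = (INF e\<in>{0 <..}. principal {(x, y). dist x y < e})"
    by (rule uniformity_fmat_def)
  show "open U \<longleftrightarrow> (\<forall>x\<in>U. \<forall>\<^sub>F (x', y) in uniformity. x' = x \<longrightarrow> y \<in> U)" for U :: "fmat set"
    by (rule open_fmat_def)
  have "adj y * x = adj (adj x * y)" by simp
  then have "tr (adj y * x) = cnj (tr (adj x * y))" by (simp only: tr_simps)
  then show "inner x y = inner y x" by (simp add: inner_fmat_def)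
  show "inner (x + y) z = inner x z + inner y z" by (simp add: inner_fmat_def distrib_right)
  show "inner (r *\<^sub>R x) y = r * inner x y"
    by (simp add: inner_fmat_def scaleR_fmat_def cscale_mult_left)
  obtain n where n: "x \<in> corner n" using ex_corner by blast
  show "0 \<le> inner x x"
    by (simp only: inner_fmat_def tr_adj_self[OF n] Re_complex_of_real) (simp add: sum_nonneg)
  have "inner x x = 0 \<longleftrightarrow> (\<forall>i<n. \<forall>l<n. ent x i l = 0)"
    by (simp only: inner_fmat_def tr_adj_self[OF n] Re_complex_of_real)
      (auto simp: sum_nonneg_eq_0_iff sum_nonneg)
  also have "\<dots> \<longleftrightarrow> x = 0"
    using n by (auto intro!: fmat_eqI) (metis cornerD not_less)
  finally show "inner x x = 0 \<longleftrightarrow> x = 0" .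
  show "norm x = sqrt (inner x x)" by (simp add: norm_fmat_def inner_fmat_def)
qed

end

lemma norm_sq_sum: "x \<in> corner n \<Longrightarrow> (norm x)\<^sup>2 = (\<Sum>i<n. \<Sum>l<n. (cmod (ent x i l))\<^sup>2)"
  by (simp only: power2_norm_eq_inner[of x] inner_fmat_def tr_adj_self Re_complex_of_real)

lemma norm_sq_tr: "(norm x)\<^sup>2 = Re (tr (adj x * x))"
  by (simp add: power2_norm_eq_inner inner_fmat_def)

lemma tr_adj_self_norm: "tr (adj x * x) = of_real ((norm x)\<^sup>2)"
proof -
  obtain n where n: "x \<in> corner n" using ex_corner by blast
  show ?thesis by (simp only: norm_sq_sum[OF n] tr_adj_self[OF n])
qed

lemma norm_adj [simp]: "norm (adj x) = norm x"
proof -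
  obtain n where n: "x \<in> corner n" using ex_corner by blast
  have "(norm (adj x))\<^sup>2 = (norm x)\<^sup>2"
    using n by (simp add: norm_sq_sum[of _ n]) (rule sum.swap)
  then show ?thesis by simp
qed

lemma norm_cscale [simp]: "norm (cscale c x) = cmod c * norm x"
proof -
  obtain n where n: "x \<in> corner n" using ex_corner by blast
  have "(norm (cscale c x))\<^sup>2 = (cmod c * norm x)\<^sup>2"
    using n by (simp add: norm_sq_sum[of _ n] norm_mult power_mult_distrib sum_distrib_left)
  then show ?thesis by simp
qed

lemma norm_munit [simp]: "norm (munit a b) = 1"
proof -
  have "(norm (munit a b))\<^sup>2 = 1" by (simp add: norm_sq_tr munit_mult tr_munit)
  then show ?thesis using norm_ge_zero[of "munit a b"] unfolding power2_eq_1_iff by linarith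
qed

lemma norm_mult_fmat: "norm (x * y) \<le> norm x * norm (y::fmat)"
proof -
  obtain n where n: "x \<in> corner n" "y \<in> corner n" using ex_corner2 by blast
  have "(norm (x * y))\<^sup>2 = (\<Sum>i<n. \<Sum>j<n. (cmod (\<Sum>l<n. ent x i l * ent y l j))\<^sup>2)"
    using n by (simp add: norm_sq_sum[of _ n] ent_mult[of _ n])
  also have "\<dots> \<le> (\<Sum>i<n. \<Sum>j<n. (\<Sum>l<n. (cmod (ent x i l))\<^sup>2) * (\<Sum>l<n. (cmod (ent y l j))\<^sup>2))"
  proof (intro sum_mono)
    fix i j
    let ?f = "\<lambda>l. cmod (ent x i l)" and ?g = "\<lambda>l. cmod (ent y l j)"
    have "cmod (\<Sum>l<n. ent x i l * ent y l j) \<le> (\<Sum>l<n. \<bar>?f l\<bar> * \<bar>?g l\<bar>)"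
      by (rule order_trans[OF norm_sum]) (simp add: norm_mult)
    also have "\<dots> \<le> L2_set ?f {..<n} * L2_set ?g {..<n}"
      by (rule L2_set_mult_ineq)
    finally have "(cmod (\<Sum>l<n. ent x i l * ent y l j))\<^sup>2 \<le> (L2_set ?f {..<n} * L2_set ?g {..<n})\<^sup>2"
      by (rule power_mono) simp
    then show "(cmod (\<Sum>l<n. ent x i l * ent y l j))\<^sup>2 \<le> (\<Sum>l<n. (?f l)\<^sup>2) * (\<Sum>l<n. (?g l)\<^sup>2)"
      by (simp add: power_mult_distrib L2_set_def sum_nonneg)
  qed
  also have "\<dots> = (\<Sum>i<n. \<Sum>l<n. (cmod (ent x i l))\<^sup>2) * (\<Sum>j<n. \<Sum>l<n. (cmod (ent y l j))\<^sup>2)"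
    by (rule sum_product[symmetric])
  also have "(\<Sum>j<n. \<Sum>l<n. (cmod (ent y l j))\<^sup>2) = (\<Sum>l<n. \<Sum>j<n. (cmod (ent y l j))\<^sup>2)"
    by (rule sum.swap)
  also have "(\<Sum>i<n. \<Sum>l<n. (cmod (ent x i l))\<^sup>2) * \<dots> = (norm x * norm y)\<^sup>2"
    using n by (simp add: norm_sq_sum[of _ n] power_mult_distrib)
  finally show ?thesis by (rule power2_le_imp_le) simp
qed

instance fmat :: real_normed_algebra
  by standard (simp_all add: scaleR_fmat_def cscale_mult_left cscale_mult_right norm_mult_fmat)

text \<open>Left multiplication on all matrices with the Hilbert-Schmidt norm is a direct sum of copies of the action on
  column vectors, so this is the usual operator norm.\<close>

definition opn :: "fmat \<Rightarrow> real" where "opn x = onorm (\<lambda>v. x * v)"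

lemma norm_mult_opn: "norm (x * v) \<le> opn x * norm v"
  unfolding opn_def by (rule onorm[OF bounded_linear_mult_right])

lemma opn_le: "(\<And>v. norm (x * v) \<le> c * norm v) \<Longrightarrow> opn x \<le> c"
proof -
  assume *: "\<And>v. norm (x * v) \<le> c * norm v"
  have "0 \<le> c" using order_trans[OF norm_ge_zero *[of "munit 0 0"]] by simp
  with * show ?thesis unfolding opn_def by (intro onorm_bound) auto
qed

lemma opn_nonneg [simp]: "0 \<le> opn x"
  unfolding opn_def by (rule onorm_pos_le[OF bounded_linear_mult_right])

lemma opn_le_norm: "opn x \<le> norm x"
  by (rule opn_le) (rule norm_mult_fmat)

lemma opn_triangle: "opn (x + y) \<le> opn x + opn y"
  unfolding opn_def distrib_right
  by (rule onorm_triangle) (rule bounded_linear_mult_right)+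

lemma opn_mult: "opn (x * y) \<le> opn x * opn y"
proof (rule opn_le)
  fix v
  have "norm (x * y * v) \<le> opn x * norm (y * v)"
    unfolding mult.assoc by (rule norm_mult_opn)
  also have "\<dots> \<le> opn x * (opn y * norm v)"
    by (intro mult_left_mono norm_mult_opn) simp
  finally show "norm (x * y * v) \<le> opn x * opn y * norm v" by (simp add: mult.assoc)
qed

lemma opn_cscale [simp]: "opn (cscale c x) = cmod c * opn x"
proof -
  have le: "opn (cscale d y) \<le> cmod d * opn y" for d y
    by (rule opn_le) (simp add: cscale_mult_left mult.assoc mult_left_mono norm_mult_opn)
  show ?thesis
  proof (cases "c = 0")
    case True
    then show ?thesis using le[of 0 x] by (simp add: order_antisym)
  next
    case False
    have "opn x = opn (cscale (inverse c) (cscale c x))" using False by (simp add: cscale_simps)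
    also have "\<dots> \<le> cmod (inverse c) * opn (cscale c x)" by (rule le)
    finally have "cmod c * opn x \<le> opn (cscale c x)"
      using False by (simp add: norm_divide norm_inverse field_simps)
    then show ?thesis using le[of c x] by simp
  qed
qed

lemma opn_uminus [simp]: "opn (- x) = opn x"
  using opn_cscale[of "-1" x] by (simp add: cscale_simps)

lemma opn_0 [simp]: "opn 0 = 0"
  using opn_cscale[of 0 0] by (simp add: cscale_simps)

lemma opn_diff: "opn (x - y) \<le> opn x + opn y"
  using opn_triangle[of x "- y"] by simp

lemma opn_minus_commute: "opn (x - y) = opn (y - x)"
  using opn_uminus[of "x - y"] by simp

lemma opn_sum: "opn (sum f I) \<le> (\<Sum>i\<in>I. opn (f i))"
  by (induction I rule: infinite_finite_induct) (auto intro: order_trans[OF opn_triangle])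

lemma ent_le_opn: "cmod (ent x i j) \<le> opn x"
proof -
  have "munit i i * (x * munit j i) = cscale (ent x i j) (munit i i)"
    by (rule fmat_eqI) (simp add: ent_munit_mult ent_mult_munit ent_munit)
  then have "cmod (ent x i j) = norm (munit i i * (x * munit j i))" by simp
  also have "\<dots> \<le> norm (munit i i) * norm (x * munit j i)" by (rule norm_mult_fmat)
  also have "\<dots> \<le> opn x" using norm_mult_opn[of x "munit j i"] by simp
  finally show ?thesis .
qed

lemma opn_eq_0 [simp]: "opn x = 0 \<longleftrightarrow> x = 0"
  using ent_le_opn[of x] by (auto intro!: fmat_eqI) 

lemma inner_mult_left: "inner (x * v) w = inner v (adj x * w)"
  by (simp add: inner_fmat_def mult.assoc)

text \<open>The Cauchy-Schwarz inequality applied to \<open>\<langle>x v, x v\<rangle> = \<langle>v, x* x v\<rangle>\<close>; this is the nontrivial half of the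
  C*-identity.\<close>

lemma opn_square_le: "(opn x)\<^sup>2 \<le> opn (adj x * x)"
proof -
  have "norm (x * v) \<le> sqrt (opn (adj x * x)) * norm v" for v
  proof (rule power2_le_imp_le)
    have "(norm (x * v))\<^sup>2 = inner v (adj x * x * v)"
      by (simp add: power2_norm_eq_inner inner_mult_left mult.assoc)
    also have "\<dots> \<le> norm v * norm (adj x * x * v)" by (rule norm_cauchy_schwarz)
    also have "\<dots> \<le> norm v * (opn (adj x * x) * norm v)"
      by (intro mult_left_mono norm_mult_opn) simp
    also have "\<dots> = (sqrt (opn (adj x * x)) * norm v)\<^sup>2"
      by (simp add: power_mult_distrib power2_eq_square[of "norm v"])
    finally show "(norm (x * v))\<^sup>2 \<le> (sqrt (opn (adj x * x)) * norm v)\<^sup>2" .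
  qed simp
  then have "opn x \<le> sqrt (opn (adj x * x))" by (rule opn_le)
  then show ?thesis by (metis opn_nonneg real_sqrt_pow2 power_mono)
qed

lemma opn_adj [simp]: "opn (adj x) = opn x"
proof -
  have "opn y \<le> opn (adj y)" for y
  proof (cases "opn y = 0")
    case False
    have "opn y * opn y \<le> opn (adj y) * opn y"
      using opn_square_le[of y] opn_mult[of "adj y" y] by (simp add: power2_eq_square)
    then show ?thesis using False by (simp add: mult_le_cancel_right) (metis less_eq_real_def opn_nonneg opn_eq_0)
  qed simp
  from this[of x] this[of "adj x"] show ?thesis by simp
qed

lemma opn_cstar: "opn (adj x * x) = (opn x)\<^sup>2"
  using opn_square_le[of x] opn_mult[of "adj x" x] by (simp add: power2_eq_square)

lemma norm_mult_opn_right: "norm (v * x) \<le> norm v * opn x"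
proof -
  have "norm (v * x) = norm (adj (v * x))" by (simp only: norm_adj)
  also have "\<dots> \<le> opn (adj x) * norm (adj v)" using norm_mult_opn[of "adj x" "adj v"] by simp
  finally show ?thesis by (simp add: mult.commute)
qed

lemma opn_idn_le: "opn (idn n) \<le> 1"
proof (cases "opn (idn n) = 0")
  case False
  have "(opn (idn n))\<^sup>2 = opn (idn n)" using opn_cstar[of "idn n"] by (simp add: idn_mult_idn)
  then show ?thesis using False by (simp add: power2_eq_square)
qed simp

lemma opn_unitary_le:
  assumes "adj u * u = idn n" shows "opn u \<le> 1"
proof -
  have "(opn u)\<^sup>2 \<le> 1" using opn_cstar[of u] opn_idn_le[of n] assms by simp
  then show ?thesis using power2_le_imp_le[of "opn u" 1] by simp
qed

lemma tr_le_opn: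
  assumes "x \<in> corner n" shows "cmod (tr x) \<le> n * opn x"
proof -
  have "cmod (tr x) \<le> (\<Sum>i<n. cmod (ent x i i))"
    unfolding tr_eq[OF assms] by (rule norm_sum)
  also have "\<dots> \<le> (\<Sum>i<n. opn x)" by (intro sum_mono ent_le_opn)
  finally show ?thesis by simp
qed

text \<open>The trace of a projection is the square of its Hilbert-Schmidt norm, and it dominates the operator
  norm, which is one unless the projection vanishes. This stands in for the rank.\<close>

lemma projection_tr:
  assumes "adj q = q" "q * q = q"
  shows "tr q = of_real ((norm q)\<^sup>2)" "q = 0 \<or> 1 \<le> norm q"
proof -
  show "tr q = of_real ((norm q)\<^sup>2)" using tr_adj_self_norm[of q] assms by simp
  show "q = 0 \<or> 1 \<le> norm q"
  proof (cases "q = 0")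
    case False
    have "norm q * 1 \<le> norm q * norm q" using norm_mult_fmat[of q q] assms(2) by simp
    then show ?thesis using False by (simp only: mult_le_cancel_left) (smt (verit) zero_less_norm_iff)
  qed simp
qed

section \<open>Almost invariant functions on the discrete torus\<close>

lemma periodic_mod:
  fixes g :: "int \<Rightarrow> 'b"
  assumes "\<And>x. g (x + N) = g x"
  shows "g (x mod N) = g x"
proof -
  have *: "g (y + k * N) = g y" for y k
  proof (induction k rule: int_induct[of _ 0])
    case (step1 i)
    have "g (y + (i + 1) * N) = g ((y + i * N) + N)" by (simp add: algebra_simps)
    then show ?case using step1 assms by simp
  next
    case (step2 i)
    have "g (y + i * N) = g ((y + (i - 1) * N) + N)" by (simp add: algebra_simps)
    then show ?case using step2 assms by simp
  qed simp
  show ?thesis using *[of "x mod N" "x div N"] by simp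
qed

lemma periodic_sum:
  fixes g :: "int \<Rightarrow> 'b::comm_monoid_add"
  assumes "\<And>x. g (x + N) = g x" "N > 0"
  shows "(\<Sum>x\<in>{lo..<lo + N}. g x) = (\<Sum>x\<in>{0..<N}. g x)"
proof (rule sum.reindex_bij_witness[of _ "\<lambda>y. lo + (y - lo) mod N" "\<lambda>x. x mod N"])
  fix x assume "x \<in> {lo..<lo + N}"
  then show "lo + (x mod N - lo) mod N = x" by (simp add: mod_diff_left_eq)
next
  fix y assume "y \<in> {0..<N}"
  then show "(lo + (y - lo) mod N) mod N = y" by (simp add: mod_add_right_eq)
qed (use assms in \<open>auto simp: periodic_mod[of g N]\<close>)

lemma periodic_sum_shift:
  fixes g :: "int \<Rightarrow> 'b::comm_monoid_add"
  assumes "\<And>x. g (x + N) = g x" "N > 0"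
  shows "(\<Sum>x\<in>{0..<N}. g (x + s)) = (\<Sum>x\<in>{0..<N}. g x)"
proof -
  have "(\<Sum>x\<in>{0..<N}. g (x + s)) = (\<Sum>x\<in>{s..<s + N}. g x)"
    by (rule sum.reindex_bij_witness[of _ "\<lambda>x. x - s" "\<lambda>x. x + s"]) auto
  then show ?thesis by (simp add: periodic_sum[of g N, OF assms])
qed

lemma periodic_sum_reflect:
  fixes g :: "int \<Rightarrow> 'b::comm_monoid_add"
  assumes "\<And>x. g (x + N) = g x" "N > 0"
  shows "(\<Sum>x\<in>{lo..<lo + N}. g (- x)) = (\<Sum>x\<in>{lo..<lo + N}. g x)"
proof -
  have "(\<Sum>x\<in>{lo..<lo + N}. g (- x)) = (\<Sum>x\<in>{1 - lo - N..<(1 - lo - N) + N}. g x)"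
    by (rule sum.reindex_bij_witness[of _ "\<lambda>x. - x" "\<lambda>x. - x"]) auto
  then show ?thesis by (simp only: periodic_sum[of g N, OF assms])
qed

text \<open>The core of the spectral gap. Suppose a unit vector \<open>f\<close> on the torus of size \<open>N\<close>, zero at the origin, is moved by at most
  \<open>\<eta>\<close> under modulation, shear and rotation. Modulation pushes the mass into the strip of small \<open>t\<close>,
  and rotation then also into the strip of small \<open>x\<close>, that is into a square around the origin where the
  torus looks like the plane. There the shear and the rotation play ping-pong on the two pairs of opposite
  quadrants: the images of one pair under the shear, and of the sheared-back other pair under the rotation, are
  disjoint and both lie in one pair up to the mass outside the square. So the mass of that pair is
  about twice itself, hence small. The constant is \<open>8\<^sup>2 + 9\<^sup>2 + 8\<close>: one pair of quadrants has norm at most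
  \<open>8 \<eta>\<close>, the other at most \<open>9 \<eta>\<close>, and the mass outside the square is at most \<open>8 \<eta>\<^sup>2\<close>.\<close>

lemma no_almost_invariant_mass:
  fixes f :: "int \<times> int \<Rightarrow> real" and N :: int
  assumes N: "N > 0" and per: "\<And>t x. f (t, x + N) = f (t, x)" and zero: "f (0, 0) = 0"
  defines "B \<equiv> {- (N div 2)..<- (N div 2) + N} \<times> {- (N div 2)..<- (N div 2) + N}"
  assumes total: "(\<Sum>p\<in>B. (f p)\<^sup>2) = 1"
    and modulate: "(\<Sum>(t, x)\<in>B. (cmod (cis (2 * pi * t / N) - 1) * f (t, x))\<^sup>2) \<le> \<eta>\<^sup>2"
    and shear: "(\<Sum>(t, x)\<in>B. (f (t, x - 2 * t) - f (t, x))\<^sup>2) \<le> \<eta>\<^sup>2"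
    and rotate: "(\<Sum>(t, x)\<in>B. (f (x, - t) - f (t, x))\<^sup>2) \<le> \<eta>\<^sup>2"
    and \<eta>: "0 \<le> \<eta>"
  shows "1 \<le> 153 * \<eta>\<^sup>2"
proof -
  define m where "m = N div 8"
  define I where "I = {- (N div 2)..<- (N div 2) + N}"
  have B: "B = I \<times> I" by (simp add: B_def I_def)
  have finB: "finite B" by (simp add: B_def)
  define sh where "sh = (\<lambda>(t::int, x::int). (t, x - 2 * t))"
  define ro where "ro = (\<lambda>(t::int, x::int). (x, - t))"
  define L where "L = L2_set f"
  have L2: "(L E)\<^sup>2 = (\<Sum>p\<in>E. (f p)\<^sup>2)" for E
    by (simp add: L_def L2_set_def sum_nonneg)
  have L0: "0 \<le> L E" for E by (simp add: L_def)
  have move: "\<bar>L2_set (\<lambda>p. f (\<phi> p)) E - L E\<bar> \<le> \<eta>"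
    if E: "E \<subseteq> B" and \<phi>: "(\<Sum>p\<in>B. (f (\<phi> p) - f p)\<^sup>2) \<le> \<eta>\<^sup>2" for \<phi> E
  proof -
    have "(\<Sum>p\<in>E. (f (\<phi> p) - f p)\<^sup>2) \<le> \<eta>\<^sup>2"
      using \<phi> sum_mono2[OF finB E, of "\<lambda>p. (f (\<phi> p) - f p)\<^sup>2"] by simp
    then have d: "L2_set (\<lambda>p. f (\<phi> p) - f p) E \<le> \<eta>"
      unfolding L2_set_def using \<eta> by (metis real_sqrt_le_iff real_sqrt_abs abs_of_nonneg)
    have d': "L2_set (\<lambda>p. f p - f (\<phi> p)) E \<le> \<eta>"
      using d unfolding L2_set_def by (simp add: power2_commute)
    have "L2_set (\<lambda>p. f (\<phi> p)) E \<le> L E + \<eta>"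
      using L2_set_triangle_ineq[of f "\<lambda>p. f (\<phi> p) - f p" E] d by (simp add: L_def)
    moreover have "L E \<le> L2_set (\<lambda>p. f (\<phi> p)) E + \<eta>"
      using L2_set_triangle_ineq[of "\<lambda>p. f (\<phi> p)" "\<lambda>p. f p - f (\<phi> p)" E] d' by (simp add: L_def)
    ultimately show ?thesis by linarith
  qed
  have image: "L2_set (\<lambda>p. f (\<phi> p)) E = L (\<phi> ` E)" if "inj \<phi>" for \<phi> E
    unfolding L_def L2_set_def
    by (subst sum.reindex) (use that in \<open>auto simp: inj_on_def\<close>)
  have inj: "inj sh" "inj ro" by (auto simp: sh_def ro_def inj_on_def)
  have sh: "\<bar>L (sh ` E) - L E\<bar> \<le> \<eta>" if "E \<subseteq> B" for E
    using move[OF that, of sh] shear image[OF inj(1)] by (simp add: sh_def case_prod_unfold)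
  have ro': "\<bar>L2_set (\<lambda>p. f (ro p)) E - L E\<bar> \<le> \<eta>" if "E \<subseteq> B" for E
    using move[OF that, of ro] rotate by (simp add: ro_def case_prod_unfold)
  have ro: "\<bar>L (ro ` E) - L E\<bar> \<le> \<eta>" if "E \<subseteq> B" for E
    using ro'[OF that] image[OF inj(2)] by simp

  \<comment> \<open>Outside the strip \<open>\<bar>t\<bar> \<le> N div 8\<close> the modulation moves every value by a fixed proportion.\<close>
  define T1 where "T1 = {(t, x) \<in> B. m < \<bar>t\<bar>}"
  define T2 where "T2 = {(t, x) \<in> B. m < \<bar>x\<bar>}"
  have T: "T1 \<subseteq> B" "T2 \<subseteq> B" by (auto simp: T1_def T2_def)
  have far: "1/2 \<le> (cmod (cis (2 * pi * t / N) - 1))\<^sup>2" if t: "t \<in> I" "m < \<bar>t\<bar>" for t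
  proof -
    have "N < 8 * \<bar>t\<bar>" using t(2) unfolding m_def by linarith
    moreover have "2 * \<bar>t\<bar> \<le> N" using t(1) unfolding I_def by auto
    ultimately have b: "real_of_int N \<le> 8 * \<bar>t\<bar>" "2 * real_of_int \<bar>t\<bar> \<le> N" by linarith+
    let ?u = "2 * pi * \<bar>real_of_int t\<bar> / N"
    have "pi / 4 \<le> ?u" "?u \<le> pi" using b N by (auto simp: field_simps)
    then have "cos ?u \<le> cos (pi / 4)" by (intro cos_monotone_0_pi_le) auto
    moreover have "cos ?u = cos (2 * pi * t / N)"
      using cos_abs_real[of "2 * pi * t / N"] N by (simp add: abs_mult)
    moreover have "sqrt 2 \<le> 3/2" by (rule real_le_lsqrt) (auto simp: power2_eq_square)
    moreover have "(cmod (cis (2 * pi * t / N) - 1))\<^sup>2 = 2 - 2 * cos (2 * pi * t / N)"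
    proof -
      let ?w = "2 * pi * t / N"
      have "(cmod (cis ?w - 1))\<^sup>2 = (cos ?w - 1)\<^sup>2 + (sin ?w)\<^sup>2" by (simp add: cmod_power2)
      also have "\<dots> = (sin ?w)\<^sup>2 + (cos ?w)\<^sup>2 + 1 - 2 * cos ?w" by (simp add: power2_diff)
      finally show ?thesis by simp
    qed
    ultimately show ?thesis by (simp add: cos_45)
  qed
  have "(1/2) * (L T1)\<^sup>2 \<le> (\<Sum>(t, x)\<in>T1. (cmod (cis (2 * pi * t / N) - 1) * f (t, x))\<^sup>2)"
    unfolding L2 sum_distrib_left
  proof (rule sum_mono, clarify)
    fix t x assume "(t, x) \<in> T1"
    then have "1/2 \<le> (cmod (cis (2 * pi * t / N) - 1))\<^sup>2"
      by (intro far) (auto simp: T1_def B)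
    then show "1/2 * (f (t, x))\<^sup>2 \<le> (cmod (cis (2 * pi * t / N) - 1) * f (t, x))\<^sup>2"
      unfolding power_mult_distrib by (rule mult_right_mono) simp
  qed
  also have "\<dots> \<le> (\<Sum>(t, x)\<in>B. (cmod (cis (2 * pi * t / N) - 1) * f (t, x))\<^sup>2)"
    by (rule sum_mono2[OF finB T(1)]) auto
  also note modulate
  finally have T1: "(L T1)\<^sup>2 \<le> 2 * \<eta>\<^sup>2" by simp
  have "(L2_set (\<lambda>p. f (ro p)) T2)\<^sup>2 = (L T1)\<^sup>2"
  proof -
    have "(L2_set (\<lambda>p. f (ro p)) T2)\<^sup>2 = (\<Sum>(t, x)\<in>T2. (f (x, - t))\<^sup>2)"
      by (simp add: L2_set_def sum_nonneg ro_def case_prod_unfold)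
    also have "\<dots> = (\<Sum>(t, x)\<in>I \<times> {x \<in> I. m < \<bar>x\<bar>}. (f (x, - t))\<^sup>2)"
      by (rule sum.cong) (auto simp: T2_def B)
    also have "\<dots> = (\<Sum>x\<in>{x \<in> I. m < \<bar>x\<bar>}. \<Sum>t\<in>I. (f (x, - t))\<^sup>2)"
      by (subst sum.swap) (simp add: sum.cartesian_product)
    also have "\<dots> = (\<Sum>x\<in>{x \<in> I. m < \<bar>x\<bar>}. \<Sum>t\<in>I. (f (x, t))\<^sup>2)"
      unfolding I_def by (intro sum.cong refl periodic_sum_reflect) (simp_all add: per N)
    also have "\<dots> = (\<Sum>p\<in>{x \<in> I. m < \<bar>x\<bar>} \<times> I. (f p)\<^sup>2)"
      by (simp add: sum.cartesian_product)
    also have "{x \<in> I. m < \<bar>x\<bar>} \<times> I = T1" by (auto simp: T1_def B)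
    finally show ?thesis by (simp add: L2)
  qed
  then have "L2_set (\<lambda>p. f (ro p)) T2 = L T1"
    using L0 by (simp add: power2_eq_iff_nonneg)
  then have T2: "L T2 \<le> L T1 + \<eta>" using ro'[OF T(2)] by simp

  \<comment> \<open>The square \<open>C\<close> is so small that shears and rotations of it do not wrap around the torus. The half-open boundaries are chosen such that \<open>H\<close>, \<open>H'\<close> and the origin partition it.\<close>
  define C where "C = {(t, x). \<bar>t\<bar> \<le> m \<and> \<bar>x\<bar> \<le> m}"
  define H where "H = {(t, x) \<in> C. (0 < t \<and> 0 \<le> x) \<or> (t < 0 \<and> x \<le> 0)}"
  define H' where "H' = {(t, x) \<in> C. (0 \<le> t \<and> x < 0) \<or> (t \<le> 0 \<and> 0 < x)}"
  define U where "U = (\<lambda>(t, x). (t, x + 2 * t)) ` H"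
  have inI: "t \<in> I" if "\<bar>t\<bar> \<le> 3 * m" for t
    using that N unfolding I_def m_def atLeastLessThan_iff by linarith
  have m0: "0 \<le> m" using N by (simp add: m_def)
  have sub: "C \<subseteq> B" "H \<subseteq> B" "H' \<subseteq> B" "U \<subseteq> B" "sh ` H' \<subseteq> B" "ro ` U \<subseteq> B"
    by (auto simp: C_def H_def H'_def U_def B sh_def ro_def intro!: inI)
  have "sh ` U = H" by (auto simp: U_def sh_def image_image case_prod_unfold)
  then have U: "L H - \<eta> \<le> L U" using sh[OF sub(4)] by simp
  have "ro ` H = H'"
  proof
    show "ro ` H \<subseteq> H'" by (auto simp: ro_def H_def H'_def C_def)
    show "H' \<subseteq> ro ` H"
    proof clarify
      fix a b assume "(a, b) \<in> H'"
      then have "(- b, a) \<in> H" "(a, b) = ro (- b, a)" by (auto simp: ro_def H_def H'_def C_def)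
      then show "(a, b) \<in> ro ` H" by blast
    qed
  qed
  then have HH': "\<bar>L H' - L H\<bar> \<le> \<eta>" using ro[OF sub(2)] by simp
  have sH': "L H' - \<eta> \<le> L (sh ` H')" using sh[OF sub(3)] by simp
  have rU: "L U - \<eta> \<le> L (ro ` U)" using ro[OF sub(4)] by simp
  have fin: "finite E" if "E \<subseteq> B" for E using that finB finite_subset by blast
  have un: "(\<Sum>p\<in>X \<union> Y. (f p)\<^sup>2) \<le> (L X)\<^sup>2 + (L Y)\<^sup>2" if "X \<subseteq> B" "Y \<subseteq> B" for X Y
    unfolding L2 using sum.union_inter[OF fin[OF that(1)] fin[OF that(2)], of "\<lambda>p. (f p)\<^sup>2"]
      sum_nonneg[of "X \<inter> Y" "\<lambda>p. (f p)\<^sup>2"] by simp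
  have disj: "sh ` H' \<inter> ro ` U = {}"
    by (auto simp: sh_def ro_def H'_def H_def U_def)
  have "(L (sh ` H'))\<^sup>2 + (L (ro ` U))\<^sup>2 = (\<Sum>p\<in>sh ` H' \<union> ro ` U. (f p)\<^sup>2)"
    unfolding L2 by (rule sum.union_disjoint[symmetric]) (use disj fin sub in auto)
  also have "\<dots> \<le> (\<Sum>p\<in>H' \<union> (B - C). (f p)\<^sup>2)"
  proof (rule sum_mono2)
    show "finite (H' \<union> (B - C))" using fin sub finB by auto
    have "sh ` H' \<union> ro ` U \<subseteq> H' \<union> - C"
      by (auto simp: sh_def ro_def H'_def H_def U_def C_def)
    then show "sh ` H' \<union> ro ` U \<subseteq> H' \<union> (B - C)" using sub by auto
  qed simp
  also have "\<dots> \<le> (L H')\<^sup>2 + (L (B - C))\<^sup>2" by (rule un) (use sub in auto)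
  finally have main: "(L (sh ` H'))\<^sup>2 + (L (ro ` U))\<^sup>2 \<le> (L H')\<^sup>2 + (L (B - C))\<^sup>2" .
  have "B - C = T1 \<union> T2" by (auto simp: C_def T1_def T2_def)
  then have tail: "(L (B - C))\<^sup>2 \<le> (L T1)\<^sup>2 + (L T2)\<^sup>2" using un[OF T] by (simp add: L2)
  have Ceq: "C = insert (0, 0) (H \<union> H')" using m0 by (auto simp: C_def H_def H'_def)
  have "(\<Sum>p\<in>C. (f p)\<^sup>2) = (\<Sum>p\<in>H \<union> H'. (f p)\<^sup>2)"
    unfolding Ceq by (subst sum.insert) (use fin sub zero in \<open>auto simp: H_def H'_def\<close>)
  then have "(\<Sum>p\<in>C. (f p)\<^sup>2) \<le> (L H)\<^sup>2 + (L H')\<^sup>2" using un[OF sub(2,3)] by simp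
  moreover have "(\<Sum>p\<in>B. (f p)\<^sup>2) = (\<Sum>p\<in>C. (f p)\<^sup>2) + (L (B - C))\<^sup>2"
    unfolding L2 by (rule sum.subset_diff[THEN trans, OF sub(1) finB]) (simp add: add.commute)
  ultimately have tot: "1 \<le> (L H)\<^sup>2 + (L H')\<^sup>2 + (L (B - C))\<^sup>2" using total by simp

  define l where "l = L H'"
  have sq: "a \<le> b \<Longrightarrow> 0 \<le> a \<Longrightarrow> a\<^sup>2 \<le> b\<^sup>2" for a b :: real by (rule power_mono)
  have "(L T2)\<^sup>2 \<le> 2 * \<eta>\<^sup>2 + \<eta>\<^sup>2 + 2 * L T1 * \<eta>"
    using sq[OF T2 L0] T1 by (simp add: power2_sum)
  moreover have "L T1 \<le> 3/2 * \<eta>"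
  proof (rule power2_le_imp_le)
    show "(L T1)\<^sup>2 \<le> (3/2 * \<eta>)\<^sup>2"
      using T1 zero_le_power2[of \<eta>] unfolding power_mult_distrib power2_eq_square[of "3/2"] by linarith
  qed (use \<eta> in simp)
  then have "L T1 * \<eta> \<le> 3/2 * \<eta> * \<eta>" using \<eta> by (intro mult_right_mono)
  ultimately have tail8: "(L (B - C))\<^sup>2 \<le> 8 * \<eta>\<^sup>2"
    using tail T1 by (simp add: power2_eq_square)
  have l8: "l \<le> 8 * \<eta>"
  proof (rule ccontr)
    assume "\<not> l \<le> 8 * \<eta>"
    then have l: "8 * \<eta> < l" by simp
    have "l - 3 * \<eta> \<le> L (ro ` U)" using rU U HH' by (simp add: l_def)
    then have "(l - 3 * \<eta>)\<^sup>2 \<le> (L (ro ` U))\<^sup>2" by (rule sq) (use l \<eta> in simp)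
    moreover have "(l - \<eta>)\<^sup>2 \<le> (L (sh ` H'))\<^sup>2"
      by (rule sq) (use sH' l \<eta> in \<open>auto simp: l_def\<close>)
    ultimately have "(l - 3 * \<eta>)\<^sup>2 + (l - \<eta>)\<^sup>2 \<le> l\<^sup>2 + 8 * \<eta>\<^sup>2"
      using main tail8 by (simp add: l_def)
    then have "l * (l - 8 * \<eta>) + 2 * \<eta>\<^sup>2 \<le> 0" by (simp add: power2_eq_square algebra_simps)
    moreover have "0 < l * (l - 8 * \<eta>)" using l \<eta> by simp
    ultimately show False by (smt (verit) zero_le_power2)
  qed
  have "(L H')\<^sup>2 \<le> (8 * \<eta>)\<^sup>2" using l8 L0[of H'] by (intro sq) (auto simp: l_def)
  moreover have "(L H)\<^sup>2 \<le> (9 * \<eta>)\<^sup>2" using l8 HH' L0[of H] by (intro sq) (auto simp: l_def)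
  ultimately show ?thesis using tot tail8 by (simp add: power_mult_distrib)
qed

section \<open>Weyl coefficients of a matrix\<close>

definition unit_root :: "nat \<Rightarrow> int \<Rightarrow> complex" where "unit_root N z = cis (2 * pi * z / N)"

lemma unit_root_add: "unit_root N (a + b) = unit_root N a * unit_root N b"
  by (simp add: unit_root_def cis_mult add_divide_distrib ring_distribs)

lemma unit_root_0 [simp]: "unit_root N 0 = 1" by (simp add: unit_root_def)

lemma cnj_unit_root: "cnj (unit_root N a) = unit_root N (- a)" by (simp add: unit_root_def cis_cnj)

lemma norm_unit_root [simp]: "cmod (unit_root N a) = 1" by (simp add: unit_root_def)

lemma unit_root_diff: "unit_root N (a - b) = unit_root N a * unit_root N (- b)"
  using unit_root_add[of N a "- b"] by simp

lemma unit_root_cancel [simp]: "unit_root N a * unit_root N (- a) = 1" "unit_root N (- a) * unit_root N a = 1"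
  using unit_root_add[of N a "- a"] by (simp_all add: mult.commute)

text \<open>The clock matrix, the quadratic chirp and the discrete Fourier transform: unitaries that normalize
  the group of Weyl matrices of size \<open>N\<close>.\<close>

definition clock :: "nat \<Rightarrow> fmat" where
  "clock N = trunc N (\<lambda>i j. if i = j then unit_root N (int i) else 0)"
definition chirp :: "nat \<Rightarrow> fmat" where
  "chirp N = trunc N (\<lambda>i j. if i = j then unit_root N (int i * int i) else 0)"
definition fourier :: "nat \<Rightarrow> fmat" where
  "fourier N = trunc N (\<lambda>i j. unit_root N (int i * int j) / of_real (sqrt N))"

context
  fixes N :: nat assumes N: "N > 0"
begin

lemma unit_root_period: "unit_root N (int N * k) = 1"
proof -
  have *: "2 * pi * real_of_int (int N * k) / N = 2 * pi * of_int k" using N by simp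
  show ?thesis unfolding unit_root_def * by (simp add: complex_eq_iff cos_int_2pin sin_int_2pin)
qed

lemma unit_root_period' [simp]: "unit_root N (a + int N * k) = unit_root N a" "unit_root N (int N * k + a) = unit_root N a"
  by (simp_all add: unit_root_add unit_root_period)

lemma unit_root_add_N: "unit_root N (a + int N) = unit_root N a"
  using unit_root_period'(1)[of a 1] by simp

lemma unit_root_mod: "unit_root N (a mod int N) = unit_root N a"
  by (rule periodic_mod) (rule unit_root_add_N)

lemma unit_root_eq_1: "unit_root N z = 1 \<longleftrightarrow> int N dvd z"
proof
  assume "unit_root N z = 1"
  then have "cos (2 * pi * z / N) = 1" by (simp add: unit_root_def complex_eq_iff)
  then obtain k :: int where "2 * pi * z / N = of_int k * 2 * pi" by (auto simp: cos_one_2pi_int)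
  then have "real_of_int z = of_int (k * int N)" using N by (simp add: field_simps)
  then have "z = k * int N" by (simp only: of_int_eq_iff)
  then show "int N dvd z" by simp
qed (auto simp: unit_root_period)

lemma sum_unit_root: "(\<Sum>x\<in>{0..<int N}. unit_root N (x * z)) = (if int N dvd z then of_nat N else 0)"
proof (cases "int N dvd z")
  case True
  then obtain k where k: "z = int N * k" by auto
  have "unit_root N (x * z) = 1" for x using unit_root_period[of "x * k"] by (simp add: k algebra_simps)
  then show ?thesis using True by simp
next
  case False
  let ?S = "\<Sum>x\<in>{0..<int N}. unit_root N (x * z)"
  have "unit_root N ((x + int N) * z) = unit_root N (x * z)" for x
    using unit_root_period'(1)[of "x * z" z] by (simp add: algebra_simps)
  then have "?S = (\<Sum>x\<in>{0..<int N}. unit_root N ((x + 1) * z))"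
    by (intro periodic_sum_shift[symmetric]) (use N in auto)
  also have "\<dots> = unit_root N z * ?S"
    by (simp add: sum_distrib_left unit_root_add[symmetric] algebra_simps)
  finally have "(unit_root N z - 1) * ?S = 0" by (simp add: algebra_simps)
  then show ?thesis using False by (simp add: unit_root_eq_1)
qed

abbreviation (input) "R \<equiv> {0..<int N}"

definition doubly_periodic :: "(int \<Rightarrow> int \<Rightarrow> complex) \<Rightarrow> bool" where
  "doubly_periodic A \<longleftrightarrow> (\<forall>x y. A (x + int N) y = A x y \<and> A x (y + int N) = A x y)"

text \<open>The coefficient of a matrix at the Weyl unitary that translates by \<open>t\<close> and modulates by \<open>\<xi>\<close>. Matrices are
  represented by kernels on the integers with period \<open>N\<close> in both variables, which makes all index
  shifts total.\<close>

definition weyl_coeff :: "(int \<Rightarrow> int \<Rightarrow> complex) \<Rightarrow> int \<Rightarrow> int \<Rightarrow> complex" where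
  "weyl_coeff A t \<xi> = (\<Sum>x\<in>R. unit_root N (- (\<xi> * x)) * A (x + t) x) / of_nat N"

lemma weyl_coeff_diff: "weyl_coeff (\<lambda>x y. A x y - B x y) t \<xi> = weyl_coeff A t \<xi> - weyl_coeff B t \<xi>"
  by (simp add: weyl_coeff_def algebra_simps sum_subtractf diff_divide_distrib)

lemma parseval_line:
  "(\<Sum>\<xi>\<in>R. (cmod ((\<Sum>x\<in>R. unit_root N (- (\<xi> * x)) * b x) / of_nat N))\<^sup>2) =
   (\<Sum>x\<in>R. (cmod (b x))\<^sup>2) / N"
proof -
  have "complex_of_real (\<Sum>\<xi>\<in>R. (cmod (\<Sum>x\<in>R. unit_root N (- (\<xi> * x)) * b x))\<^sup>2) =
     (\<Sum>\<xi>\<in>R. \<Sum>x\<in>R. \<Sum>y\<in>R. unit_root N (\<xi> * (y - x)) * (b x * cnj (b y)))"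
    by (simp add: complex_norm_square sum_product cnj_unit_root of_real_sum right_diff_distrib unit_root_diff mult_ac
      del: of_real_power)
  also have "\<dots> = (\<Sum>x\<in>R. \<Sum>\<xi>\<in>R. \<Sum>y\<in>R. unit_root N (\<xi> * (y - x)) * (b x * cnj (b y)))"
    by (rule sum.swap)
  also have "\<dots> = (\<Sum>x\<in>R. \<Sum>y\<in>R. \<Sum>\<xi>\<in>R. unit_root N (\<xi> * (y - x)) * (b x * cnj (b y)))"
    by (intro sum.cong refl sum.swap)
  also have "\<dots> = (\<Sum>x\<in>R. \<Sum>y\<in>R. if y = x then of_nat N * (b x * cnj (b y)) else 0)"
  proof (intro sum.cong refl)
    fix x y assume xy: "x \<in> R" "y \<in> R"
    have "int N dvd y - x \<longleftrightarrow> y = x"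
      using xy by (auto simp: mod_eq_dvd_iff[symmetric])
    then show "(\<Sum>\<xi>\<in>R. unit_root N (\<xi> * (y - x)) * (b x * cnj (b y))) =
        (if y = x then of_nat N * (b x * cnj (b y)) else 0)"
      by (simp only: sum_distrib_right[symmetric] sum_unit_root) simp
  qed
  also have "\<dots> = of_nat N * (\<Sum>x\<in>R. b x * cnj (b x))"
    by (simp add: sum_distrib_left)
  also have "\<dots> = complex_of_real (of_nat N * (\<Sum>x\<in>R. (cmod (b x))\<^sup>2))"
    by (simp add: complex_norm_square del: of_real_power)
  finally have "(\<Sum>\<xi>\<in>R. (cmod (\<Sum>x\<in>R. unit_root N (- (\<xi> * x)) * b x))\<^sup>2) = N * (\<Sum>x\<in>R. (cmod (b x))\<^sup>2)"
    by (simp only: of_real_eq_iff)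
  then show ?thesis
    using N by (simp add: norm_divide power_divide sum_divide_distrib[symmetric] power2_eq_square)
qed

text \<open>The Weyl unitaries are orthogonal with norm \<open>sqrt N\<close>.\<close>

lemma parseval:
  assumes "doubly_periodic A"
  shows "(\<Sum>t\<in>R. \<Sum>\<xi>\<in>R. (cmod (weyl_coeff A t \<xi>))\<^sup>2) = (\<Sum>x\<in>R. \<Sum>y\<in>R. (cmod (A x y))\<^sup>2) / N"
proof -
  have "(\<Sum>t\<in>R. \<Sum>\<xi>\<in>R. (cmod (weyl_coeff A t \<xi>))\<^sup>2) = (\<Sum>t\<in>R. \<Sum>x\<in>R. (cmod (A (x + t) x))\<^sup>2) / N"
    unfolding weyl_coeff_def parseval_line by (simp add: sum_divide_distrib)
  also have "(\<Sum>t\<in>R. \<Sum>x\<in>R. (cmod (A (x + t) x))\<^sup>2) = (\<Sum>x\<in>R. \<Sum>t\<in>R. (cmod (A (x + t) x))\<^sup>2)"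
    by (rule sum.swap)
  also have "\<dots> = (\<Sum>x\<in>R. \<Sum>t\<in>R. (cmod (A t x))\<^sup>2)"
  proof (rule sum.cong[OF refl])
    fix x
    show "(\<Sum>t\<in>R. (cmod (A (x + t) x))\<^sup>2) = (\<Sum>t\<in>R. (cmod (A t x))\<^sup>2)"
      using periodic_sum_shift[of "\<lambda>t. (cmod (A t x))\<^sup>2" "int N" x] assms N
      by (simp add: doubly_periodic_def add.commute)
  qed
  also have "\<dots> = (\<Sum>x\<in>R. \<Sum>y\<in>R. (cmod (A x y))\<^sup>2)" by (rule sum.swap)
  finally show ?thesis .
qed

lemma weyl_coeff_period:
  assumes "doubly_periodic A"
  shows "weyl_coeff A (t + int N) \<xi> = weyl_coeff A t \<xi>" "weyl_coeff A t (\<xi> + int N) = weyl_coeff A t \<xi>"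
proof -
  have "A (x + (t + int N)) x = A (x + t) x" for x
    using assms unfolding doubly_periodic_def by (metis add.assoc)
  then show "weyl_coeff A (t + int N) \<xi> = weyl_coeff A t \<xi>" by (simp add: weyl_coeff_def)
  have "unit_root N (- ((\<xi> + int N) * x)) = unit_root N (- (\<xi> * x))" for x
    using unit_root_period'(1)[of "- (\<xi> * x)" "- x"] by (simp add: algebra_simps)
  then show "weyl_coeff A t (\<xi> + int N) = weyl_coeff A t \<xi>" by (simp add: weyl_coeff_def)
qed

definition periodic_ent :: "fmat \<Rightarrow> int \<Rightarrow> int \<Rightarrow> complex" where
  "periodic_ent a x y = ent a (nat (x mod int N)) (nat (y mod int N))"

lemma doubly_periodic_periodic_ent: "doubly_periodic (periodic_ent a)" by (simp add: doubly_periodic_def periodic_ent_def)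

lemma nat_mod_less: "nat (x mod int N) < N"
  using N by (simp add: nat_less_iff)

lemma periodic_ent_nat: "i < N \<Longrightarrow> j < N \<Longrightarrow> periodic_ent a (int i) (int j) = ent a i j"
  by (simp add: periodic_ent_def)

lemma sum_R: "(\<Sum>x\<in>R. g x) = (\<Sum>i<N. g (int i))"
  by (rule sum.reindex_bij_witness[of _ int nat]) auto

lemma norm_periodic_ent: "a \<in> corner N \<Longrightarrow> (norm a)\<^sup>2 = (\<Sum>x\<in>R. \<Sum>y\<in>R. (cmod (periodic_ent a x y))\<^sup>2)"
  by (simp add: norm_sq_sum[of _ N] sum_R periodic_ent_nat)

lemma norm_weyl_coeff: "a \<in> corner N \<Longrightarrow> (norm a)\<^sup>2 = N * (\<Sum>t\<in>R. \<Sum>\<xi>\<in>R. (cmod (weyl_coeff (periodic_ent a) t \<xi>))\<^sup>2)"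
  using N by (simp add: norm_periodic_ent parseval[OF doubly_periodic_periodic_ent])

lemma weyl_coeff_00: "a \<in> corner N \<Longrightarrow> weyl_coeff (periodic_ent a) 0 0 = tr a / N"
  by (simp add: weyl_coeff_def sum_R periodic_ent_nat tr_eq)

lemma diag_conj:
  assumes a: "a \<in> corner N" and i: "i < N" "j < N"
  defines "d c \<equiv> trunc N (\<lambda>i j. if i = j then c i else 0)"
  shows "ent (d c * a * adj (d c)) i j = c i * ent a i j * cnj (c j)"
proof -
  have d: "d c \<in> corner N" by (simp add: d_def)
  have 1: "ent (d c * a) i l = c i * ent a i l" for l
    using i by (simp add: ent_mult[OF disjI1[OF d]]) (simp add: d_def ent_trunc if_distrib if_distribR cong: if_cong)
  have "ent (d c * a * adj (d c)) i j = (\<Sum>l<N. c i * ent a i l * cnj (ent (d c) j l))"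
    using d a by (simp add: ent_mult[of "d c * a" N] 1)
  also have "\<dots> = (\<Sum>l<N. if l = j then c i * ent a i l * cnj (c j) else 0)"
    by (rule sum.cong) (use i in \<open>auto simp: d_def ent_trunc\<close>)
  finally show ?thesis using i by simp
qed

lemma diag_unitary:
  assumes "\<And>i. cmod (c i) = 1"
  defines "d \<equiv> trunc N (\<lambda>i j. if i = j then c i else 0)"
  shows "d * adj d = idn N"
proof (rule fmat_eqI)
  fix i j
  show "ent (d * adj d) i j = ent (idn N) i j"
  proof (cases "i < N \<and> j < N")
    case True
    have c: "c i * cnj (c i) = 1" using assms(1)[of i] by (simp add: complex_norm_square[symmetric])
    have "d * idn N = d" by (simp add: idn_mult_right[of _ N] d_def)
    then have "ent (d * adj d) i j = c i * ent (idn N) i j * cnj (c j)"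
      using diag_conj[of "idn N" i j c] True by (simp add: d_def)
    then show ?thesis using c by (auto simp: ent_idn)
  next
    case False
    have "d * adj d \<in> corner N" by (simp add: d_def)
    then show ?thesis using False by (auto simp: ent_idn not_less cornerD)
  qed
qed

lemma clock_unitary: "clock N * adj (clock N) = idn N"
  unfolding clock_def by (rule diag_unitary) simp

lemma chirp_unitary: "chirp N * adj (chirp N) = idn N"
  unfolding chirp_def by (rule diag_unitary) simp

lemma fourier_conj:
  assumes a: "a \<in> corner N" and i: "i < N" "j < N"
  shows "ent (fourier N * a * adj (fourier N)) i j =
    (\<Sum>u<N. \<Sum>v<N. unit_root N (int i * int u - int j * int v) * ent a u v) / N"
proof -
  have d: "fourier N \<in> corner N" by (simp add: fourier_def)
  have sq: "complex_of_real (sqrt N) * complex_of_real (sqrt N) = N"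
    by (simp flip: of_real_mult)
  have "ent (fourier N * a * adj (fourier N)) i j =
      (\<Sum>v<N. (\<Sum>u<N. ent (fourier N) i u * ent a u v) * cnj (ent (fourier N) j v))"
    using d a by (simp add: ent_mult[of "fourier N * a" N] ent_mult[of "fourier N" N])
  also have "\<dots> = (\<Sum>v<N. \<Sum>u<N. unit_root N (int i * int u - int j * int v) * ent a u v / N)"
    unfolding sum_distrib_right
  proof (intro sum.cong refl)
    fix u v assume "v \<in> {..<N}" "u \<in> {..<N}"
    then show "ent (fourier N) i u * ent a u v * cnj (ent (fourier N) j v) =
        unit_root N (int i * int u - int j * int v) * ent a u v / N"
      using i by (simp add: fourier_def ent_trunc cnj_unit_root unit_root_diff sq[symmetric] mult_ac)
  qed
  also have "\<dots> = (\<Sum>u<N. \<Sum>v<N. unit_root N (int i * int u - int j * int v) * ent a u v / N)"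
    by (rule sum.swap)
  finally show ?thesis by (simp add: sum_divide_distrib)
qed

lemma fourier_unitary: "fourier N * adj (fourier N) = idn N"
proof (rule fmat_eqI)
  fix i j
  show "ent (fourier N * adj (fourier N)) i j = ent (idn N) i j"
  proof (cases "i < N \<and> j < N")
    case True
    have "fourier N * idn N = fourier N" by (simp add: idn_mult_right[of _ N] fourier_def)
    then have "ent (fourier N * adj (fourier N)) i j =
        (\<Sum>u<N. \<Sum>v<N. unit_root N (int i * int u - int j * int v) * ent (idn N) u v) / N"
      using fourier_conj[of "idn N" i j] True by simp
    also have "(\<Sum>u<N. \<Sum>v<N. unit_root N (int i * int u - int j * int v) * ent (idn N) u v) =
        (\<Sum>u<N. unit_root N (int i * int u - int j * int u))"
      by (rule sum.cong) (auto simp: ent_idn if_distrib cong: if_cong)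
    also have "\<dots> = (\<Sum>u\<in>{0..<int N}. unit_root N (u * (int i - int j)))"
      by (simp add: sum_R algebra_simps)
    also have "\<dots> = (if int N dvd int i - int j then of_nat N else 0)" by (rule sum_unit_root)
    also have "int N dvd int i - int j \<longleftrightarrow> i = j"
      using True by (auto simp: mod_eq_dvd_iff[symmetric])
    finally show ?thesis using N True by (auto simp: ent_idn)
  next
    case False
    have "fourier N * adj (fourier N) \<in> corner N" by (simp add: fourier_def)
    then show ?thesis using False by (auto simp: ent_idn not_less cornerD)
  qed
qed

lemma periodic_ent_clock: "a \<in> corner N \<Longrightarrow> periodic_ent (clock N * a * adj (clock N)) x y = unit_root N (x - y) * periodic_ent a x y"
proof -
  assume a: "a \<in> corner N"
  show ?thesis
    using N unfolding periodic_ent_def clock_def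
    by (subst diag_conj[OF a nat_mod_less nat_mod_less]) (simp add: unit_root_diff cnj_unit_root[symmetric] unit_root_mod)
qed

lemma periodic_ent_chirp: "a \<in> corner N \<Longrightarrow>
  periodic_ent (chirp N * a * adj (chirp N)) x y = unit_root N (x * x - y * y) * periodic_ent a x y"
proof -
  assume a: "a \<in> corner N"
  have sq: "unit_root N ((x mod int N) * (x mod int N)) = unit_root N (x * x)" for x
    using unit_root_mod[of "x * x"] unit_root_mod[of "(x mod int N) * (x mod int N)"] by (simp add: mod_mult_eq)
  show ?thesis
    using N unfolding periodic_ent_def chirp_def
    by (subst diag_conj[OF a nat_mod_less nat_mod_less]) (simp add: unit_root_diff cnj_unit_root[symmetric] sq)
qed

lemma periodic_ent_fourier: "a \<in> corner N \<Longrightarrow>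
  periodic_ent (fourier N * a * adj (fourier N)) x y = (\<Sum>u\<in>{0..<int N}. \<Sum>v\<in>{0..<int N}. unit_root N (x * u - y * v) * periodic_ent a u v) / N"
proof -
  assume a: "a \<in> corner N"
  have "unit_root N ((x mod int N) * u - (y mod int N) * v) = unit_root N (x * u - y * v)" for u v
  proof -
    have "((x mod int N) * u - (y mod int N) * v) mod int N = (x * u - y * v) mod int N"
      by (metis mod_diff_eq mod_mult_left_eq)
    then show ?thesis by (metis unit_root_mod)
  qed
  then show ?thesis
    using N unfolding periodic_ent_def
    by (subst fourier_conj[OF a nat_mod_less nat_mod_less]) (simp add: sum_R)
qed

lemma weyl_coeff_clock: "a \<in> corner N \<Longrightarrow> weyl_coeff (periodic_ent (clock N * a * adj (clock N))) t \<xi> = unit_root N t * weyl_coeff (periodic_ent a) t \<xi>"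
  by (simp add: weyl_coeff_def periodic_ent_clock sum_distrib_left mult.left_commute)

text \<open>The chirp acts by conjugation as a shear of the torus, up to a phase.\<close>

lemma weyl_coeff_chirp: "a \<in> corner N \<Longrightarrow>
  weyl_coeff (periodic_ent (chirp N * a * adj (chirp N))) t \<xi> = unit_root N (t * t) * weyl_coeff (periodic_ent a) t (\<xi> - 2 * t)"
proof -
  assume a: "a \<in> corner N"
  have *: "unit_root N (- (\<xi> * x)) * (unit_root N ((x + t) * (x + t) - x * x) * c) = unit_root N (t * t) * (unit_root N (- ((\<xi> - 2 * t) * x)) * c)"
    for x c
    by (simp only: mult.assoc[symmetric] unit_root_add[symmetric]) (simp add: algebra_simps)
  show ?thesis
    unfolding weyl_coeff_def periodic_ent_chirp[OF a] * sum_distrib_left[symmetric] by simp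
qed

text \<open>The Fourier transform acts by conjugation as a rotation by a right angle, up to a phase.\<close>

lemma weyl_coeff_fourier: "a \<in> corner N \<Longrightarrow>
  weyl_coeff (periodic_ent (fourier N * a * adj (fourier N))) t \<xi> = unit_root N (t * \<xi>) * weyl_coeff (periodic_ent a) \<xi> (- t)"
proof -
  assume a: "a \<in> corner N"
  let ?R = "{0..<int N}" and ?A = "periodic_ent a"
  have key: "(\<Sum>u\<in>?R. (if int N dvd u - v - \<xi> then of_nat N else 0) * (unit_root N (t * u) * ?A u v)) =
      of_nat N * (unit_root N (t * (v + \<xi>)) * ?A (v + \<xi>) v)" for v
  proof -
    let ?g = "\<lambda>u. (if int N dvd u - v - \<xi> then of_nat N else 0) * (unit_root N (t * u) * ?A u v)"
    have per: "?g (u + int N) = ?g u" for u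
    proof -
      have "int N dvd u + int N - v - \<xi> \<longleftrightarrow> int N dvd u - v - \<xi>"
        using dvd_add_right_iff[of "int N" "int N" "u - v - \<xi>"] by (simp add: algebra_simps)
      moreover have "unit_root N (t * (u + int N)) = unit_root N (t * u)"
        using unit_root_period'(1)[of "t * u" t] by (simp add: algebra_simps)
      ultimately show ?thesis by (simp add: periodic_ent_def)
    qed
    have "(\<Sum>u\<in>?R. ?g u) = (\<Sum>u\<in>?R. ?g (u + (v + \<xi>)))"
      using periodic_sum_shift[of ?g "int N" "v + \<xi>", OF per] N by simp
    also have "\<dots> = (\<Sum>u\<in>?R. if u = 0 then of_nat N * (unit_root N (t * (v + \<xi>)) * ?A (v + \<xi>) v) else 0)"
      by (rule sum.cong) (use N in \<open>auto dest: zdvd_imp_le\<close>)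
    also have "\<dots> = of_nat N * (unit_root N (t * (v + \<xi>)) * ?A (v + \<xi>) v)"
      using N by simp
    finally show ?thesis .
  qed
  have *: "unit_root N (- (\<xi> * x)) * (unit_root N ((x + t) * u - x * v) * c) = unit_root N (x * (u - v - \<xi>)) * (unit_root N (t * u) * c)"
    for x u v c
    by (simp only: mult.assoc[symmetric] unit_root_add[symmetric]) (simp add: algebra_simps)
  have "(\<Sum>x\<in>?R. unit_root N (- (\<xi> * x)) * periodic_ent (fourier N * a * adj (fourier N)) (x + t) x) =
     (\<Sum>x\<in>?R. \<Sum>u\<in>?R. \<Sum>v\<in>?R. unit_root N (x * (u - v - \<xi>)) * (unit_root N (t * u) * ?A u v)) / N"
  proof -
    have "unit_root N (- (\<xi> * x)) * periodic_ent (fourier N * a * adj (fourier N)) (x + t) x =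
        (\<Sum>u\<in>?R. \<Sum>v\<in>?R. unit_root N (x * (u - v - \<xi>)) * (unit_root N (t * u) * ?A u v)) / N" for x
      by (simp only: periodic_ent_fourier[OF a] times_divide_eq_right sum_distrib_left *)
    then show ?thesis by (simp only: sum_divide_distrib)
  qed
  also have "(\<Sum>x\<in>?R. \<Sum>u\<in>?R. \<Sum>v\<in>?R. unit_root N (x * (u - v - \<xi>)) * (unit_root N (t * u) * ?A u v)) =
     (\<Sum>x\<in>?R. \<Sum>v\<in>?R. \<Sum>u\<in>?R. unit_root N (x * (u - v - \<xi>)) * (unit_root N (t * u) * ?A u v))"
    by (intro sum.cong refl sum.swap)
  also have "\<dots> = (\<Sum>v\<in>?R. \<Sum>x\<in>?R. \<Sum>u\<in>?R. unit_root N (x * (u - v - \<xi>)) * (unit_root N (t * u) * ?A u v))"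
    by (rule sum.swap)
  also have "\<dots> = (\<Sum>v\<in>?R. \<Sum>u\<in>?R. \<Sum>x\<in>?R. unit_root N (x * (u - v - \<xi>)) * (unit_root N (t * u) * ?A u v))"
    by (intro sum.cong refl sum.swap)
  also have "\<dots> = (\<Sum>v\<in>?R. \<Sum>u\<in>?R. (if int N dvd u - v - \<xi> then of_nat N else 0) * (unit_root N (t * u) * ?A u v))"
    by (simp only: sum_distrib_right[symmetric] sum_unit_root)
  also have "\<dots> = (\<Sum>v\<in>?R. of_nat N * (unit_root N (t * (v + \<xi>)) * ?A (v + \<xi>) v))"
    by (simp only: key)
  also have "\<dots> = of_nat N * (unit_root N (t * \<xi>) * (\<Sum>v\<in>?R. unit_root N (- (- t * v)) * ?A (v + \<xi>) v))"
    by (simp add: sum_distrib_left ring_distribs unit_root_add mult_ac cong: sum.cong)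
  finally show ?thesis using N by (simp add: weyl_coeff_def)
qed

end

section \<open>A spectral gap uniform in the size\<close>

definition expander :: "nat \<Rightarrow> fmat set" where
  "expander N = {clock N, chirp N, fourier N}"

lemma expander_corner: "g \<in> expander N \<Longrightarrow> g \<in> corner N"
  by (auto simp: expander_def clock_def chirp_def fourier_def)

lemma expander_unitary: "N > 0 \<Longrightarrow> g \<in> expander N \<Longrightarrow> g * adj g = idn N"
  by (auto simp: expander_def clock_unitary chirp_unitary fourier_unitary)

lemma opn_expander: "N > 0 \<Longrightarrow> g \<in> expander N \<Longrightarrow> opn g \<le> 1"
  using opn_unitary_le[of "adj g" N] expander_unitary[of N g] by simp

text \<open>Normalized absolute values of the Weyl coefficients of \<open>a\<close> form a unit vector on the torus, with value
  zero at the origin since \<open>a\<close> has trace zero. If \<open>a\<close> nearly commutes with the three unitaries, this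
  vector is almost invariant, and \<open>no_almost_invariant_mass\<close> gives a contradiction because
  \<open>153 < 13\<^sup>2\<close>.\<close>

theorem expander_gap:
  assumes N: "N > 0" and a: "a \<in> corner N" and tr: "tr a = 0"
    and comm: "\<And>g. g \<in> expander N \<Longrightarrow> norm (g * a - a * g) \<le> norm a / 13"
  shows "a = 0"
proof (rule ccontr)
  assume "a \<noteq> 0"
  then have na: "norm a > 0" by simp
  let ?N = "int N"
  let ?I = "{- (?N div 2)..<- (?N div 2) + ?N}"
  let ?c = "\<lambda>x. weyl_coeff N (periodic_ent N x)"
  define f where "f = (\<lambda>(t, \<xi>). sqrt N * cmod (?c a t \<xi>) / norm a)"
  have box: "(\<Sum>(t, \<xi>)\<in>?I \<times> ?I. (cmod (?c x t \<xi>))\<^sup>2) = (norm x)\<^sup>2 / N" if x: "x \<in> corner N" for x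
  proof -
    note per = weyl_coeff_period[OF N doubly_periodic_periodic_ent[OF N]]
    have "(\<Sum>(t, \<xi>)\<in>?I \<times> ?I. (cmod (?c x t \<xi>))\<^sup>2) = (\<Sum>t\<in>?I. \<Sum>\<xi>\<in>{0..<?N}. (cmod (?c x t \<xi>))\<^sup>2)"
      unfolding sum.cartesian_product[symmetric]
      by (intro sum.cong refl periodic_sum) (simp_all add: per N)
    also have "\<dots> = (\<Sum>t\<in>{0..<?N}. \<Sum>\<xi>\<in>{0..<?N}. (cmod (?c x t \<xi>))\<^sup>2)"
      by (rule periodic_sum) (simp_all add: per N)
    finally show ?thesis using norm_weyl_coeff[OF N x] N by simp
  qed
  have box': "(\<Sum>(t, \<xi>)\<in>?I \<times> ?I. r * (cmod (?c x t \<xi>))\<^sup>2) = r * ((norm x)\<^sup>2 / N)"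
    if "x \<in> corner N" for x r
    unfolding box[OF that, symmetric] sum_distrib_left by (rule sum.cong) auto
  have close: "(\<Sum>(t, \<xi>)\<in>?I \<times> ?I. (h (t, \<xi>))\<^sup>2) \<le> (1/13)\<^sup>2"
    if g: "g \<in> expander N"
      and h: "\<And>t \<xi>. \<bar>h (t, \<xi>)\<bar> \<le> sqrt N * cmod (?c (g * a * adj g) t \<xi> - ?c a t \<xi>) / norm a" for g h
  proof -
    define d where "d = g * a * adj g - a"
    have gc: "g \<in> corner N" by (rule expander_corner[OF g])
    have d: "d \<in> corner N" using gc a by (simp add: d_def)
    have "(g * a - a * g) * adj g = d"
      using expander_unitary[OF N g] a by (simp add: d_def left_diff_distrib mult.assoc idn_mult_right[of _ N])
    then have "norm d \<le> norm (g * a - a * g) * opn (adj g)" using norm_mult_opn_right by metis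
    also have "\<dots> \<le> norm a / 13 * 1"
      using comm[OF g] opn_expander[OF N g] by (intro mult_mono) auto
    finally have nd: "norm d / norm a \<le> 1/13" using na by (simp add: field_simps)
    have "?c d t \<xi> = ?c (g * a * adj g) t \<xi> - ?c a t \<xi>" for t \<xi>
      using weyl_coeff_diff[OF N, of "periodic_ent N (g * a * adj g)" "periodic_ent N a"]
      by (simp add: d_def periodic_ent_def[OF N] weyl_coeff_def[OF N])
    then have h': "\<bar>h (t, \<xi>)\<bar> \<le> sqrt N * cmod (?c d t \<xi>) / norm a" for t \<xi> using h by simp
    have "(\<Sum>(t, \<xi>)\<in>?I \<times> ?I. (h (t, \<xi>))\<^sup>2) \<le>
        (\<Sum>(t, \<xi>)\<in>?I \<times> ?I. N / (norm a)\<^sup>2 * (cmod (?c d t \<xi>))\<^sup>2)"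
    proof (rule sum_mono, clarify)
      fix t \<xi>
      have "(h (t, \<xi>))\<^sup>2 \<le> (sqrt N * cmod (?c d t \<xi>) / norm a)\<^sup>2"
        using power_mono[OF h' abs_ge_zero, where n = 2] by simp
      then show "(h (t, \<xi>))\<^sup>2 \<le> N / (norm a)\<^sup>2 * (cmod (?c d t \<xi>))\<^sup>2"
        by (simp add: power_mult_distrib power_divide)
    qed
    also have "\<dots> = N / (norm a)\<^sup>2 * ((norm d)\<^sup>2 / N)" by (rule box'[OF d])
    also have "\<dots> = (norm d / norm a)\<^sup>2" using N by (simp add: power_divide)
    also have "\<dots> \<le> (1/13)\<^sup>2" using nd na by (intro power_mono) auto
    finally show ?thesis .
  qed
  have "1 \<le> 153 * (1/13 :: real)\<^sup>2"
  proof (rule no_almost_invariant_mass[where f = f and N = ?N])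
    show "0 < ?N" using N by simp
    show "f (t, x + ?N) = f (t, x)" for t x
      by (simp add: f_def weyl_coeff_period[OF N doubly_periodic_periodic_ent[OF N]])
    show "f (0, 0) = 0" using weyl_coeff_00[OF N a] tr by (simp add: f_def)
    have "(\<Sum>p\<in>?I \<times> ?I. (f p)\<^sup>2) = (\<Sum>(t, \<xi>)\<in>?I \<times> ?I. N / (norm a)\<^sup>2 * (cmod (?c a t \<xi>))\<^sup>2)"
      by (intro sum.cong) (auto simp: f_def power_mult_distrib power_divide)
    also have "\<dots> = N / (norm a)\<^sup>2 * ((norm a)\<^sup>2 / N)" by (rule box'[OF a])
    finally show "(\<Sum>p\<in>?I \<times> ?I. (f p)\<^sup>2) = 1" using N na by simp
    have f: "f (t, \<xi>) = sqrt N * cmod (?c a t \<xi>) / norm a" for t \<xi> by (simp add: f_def)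
    have diff: "\<bar>sqrt N * x / norm a - sqrt N * y / norm a\<bar> = sqrt N * \<bar>x - y\<bar> / norm a" for x y
      using na by (simp add: diff_divide_distrib[symmetric] right_diff_distrib[symmetric] abs_mult)
    have le: "sqrt N * x / norm a \<le> sqrt N * y / norm a" if "x \<le> y" for x y
      using that na by (simp add: divide_right_mono mult_left_mono)
    show "(\<Sum>(t, x)\<in>?I \<times> ?I. (cmod (cis (2 * pi * t / ?N) - 1) * f (t, x))\<^sup>2) \<le> (1/13)\<^sup>2"
      using close[of "clock N" "\<lambda>(t, x). cmod (cis (2 * pi * t / ?N) - 1) * f (t, x)"]
    proof (simp add: expander_def, elim meta_mp)
      fix t \<xi>
      have "cmod (unit_root N t - 1) * f (t, \<xi>) = sqrt N * cmod (unit_root N t * ?c a t \<xi> - ?c a t \<xi>) / norm a"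
        by (simp add: f norm_mult[symmetric] left_diff_distrib)
      then show "\<bar>cmod (cis (2 * pi * t / N) - 1) * f (t, \<xi>)\<bar> \<le>
          sqrt N * cmod (?c (clock N * a * adj (clock N)) t \<xi> - ?c a t \<xi>) / norm a"
        by (simp add: weyl_coeff_clock[OF N a] unit_root_def)
    qed
    show "(\<Sum>(t, x)\<in>?I \<times> ?I. (f (t, x - 2 * t) - f (t, x))\<^sup>2) \<le> (1/13)\<^sup>2"
      using close[of "chirp N" "\<lambda>(t, x). f (t, x - 2 * t) - f (t, x)"]
    proof (simp add: expander_def, elim meta_mp)
      fix t \<xi>
      have "\<bar>cmod (?c a t (\<xi> - 2 * t)) - cmod (?c a t \<xi>)\<bar> \<le> cmod (unit_root N (t * t) * ?c a t (\<xi> - 2 * t) - ?c a t \<xi>)"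
        using norm_triangle_ineq3[of "unit_root N (t * t) * ?c a t (\<xi> - 2 * t)" "?c a t \<xi>"] by (simp add: norm_mult)
      then show "\<bar>f (t, \<xi> - 2 * t) - f (t, \<xi>)\<bar> \<le>
          sqrt N * cmod (?c (chirp N * a * adj (chirp N)) t \<xi> - ?c a t \<xi>) / norm a"
        unfolding f diff weyl_coeff_chirp[OF N a] by (rule le)
    qed
    show "(\<Sum>(t, x)\<in>?I \<times> ?I. (f (x, - t) - f (t, x))\<^sup>2) \<le> (1/13)\<^sup>2"
      using close[of "fourier N" "\<lambda>(t, x). f (x, - t) - f (t, x)"]
    proof (simp add: expander_def, elim meta_mp)
      fix t \<xi>
      have "\<bar>cmod (?c a \<xi> (- t)) - cmod (?c a t \<xi>)\<bar> \<le> cmod (unit_root N (t * \<xi>) * ?c a \<xi> (- t) - ?c a t \<xi>)"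
        using norm_triangle_ineq3[of "unit_root N (t * \<xi>) * ?c a \<xi> (- t)" "?c a t \<xi>"] by (simp add: norm_mult)
      then show "\<bar>f (\<xi>, - t) - f (t, \<xi>)\<bar> \<le>
          sqrt N * cmod (?c (fourier N * a * adj (fourier N)) t \<xi> - ?c a t \<xi>) / norm a"
        unfolding f diff weyl_coeff_fourier[OF N a] by (rule le)
    qed
  qed simp
  then show False by (simp add: power2_eq_square)
qed

section \<open>Finitely supported and ordinary matrices; the spectral theorem\<close>

definition to_mat :: "nat \<Rightarrow> fmat \<Rightarrow> complex mat" where
  "to_mat n x = mat n n (\<lambda>(i, j). ent x i j)"

definition of_mat :: "complex mat \<Rightarrow> fmat" where
  "of_mat A = trunc (dim_row A) (\<lambda>i j. A $$ (i, j))"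

lemma to_mat_carrier [simp]: "to_mat n x \<in> carrier_mat n n" by (simp add: to_mat_def)
lemma to_mat_dim [simp]: "dim_row (to_mat n x) = n" "dim_col (to_mat n x) = n" by (simp_all add: to_mat_def)
lemma of_mat_corner [simp]: "A \<in> carrier_mat n n \<Longrightarrow> of_mat A \<in> corner n" by (auto simp: of_mat_def)
lemma ent_of_mat: "ent (of_mat A) i j = (if i < dim_row A \<and> j < dim_row A then A $$ (i, j) else 0)"
  by (simp add: of_mat_def ent_trunc)
lemma to_mat_index [simp]: "i < n \<Longrightarrow> j < n \<Longrightarrow> to_mat n x $$ (i, j) = ent x i j"
  by (simp add: to_mat_def)

lemma to_of_mat: "A \<in> carrier_mat n n \<Longrightarrow> to_mat n (of_mat A) = A"
  by (rule eq_matI) (auto simp: ent_of_mat)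
lemma of_to_mat: "x \<in> corner n \<Longrightarrow> of_mat (to_mat n x) = x"
  by (rule fmat_eqI) (auto simp: ent_of_mat not_less cornerD)
lemma to_mat_hom:
  assumes "x \<in> corner n" "y \<in> corner n"
  shows "to_mat n (x + y) = to_mat n x + to_mat n y" "to_mat n (x * y) = to_mat n x * to_mat n y"
    "to_mat n (cscale c x) = c \<cdot>\<^sub>m to_mat n x" "to_mat n (adj x) = mat_adjoint (to_mat n x)"
    "to_mat n (idn n) = 1\<^sub>m n" "to_mat n 0 = 0\<^sub>m n n"
proof -
  show "to_mat n (x + y) = to_mat n x + to_mat n y" "to_mat n (cscale c x) = c \<cdot>\<^sub>m to_mat n x"
    "to_mat n (idn n) = 1\<^sub>m n" "to_mat n 0 = 0\<^sub>m n n"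
    by (auto intro!: eq_matI simp: ent_idn)
  show "to_mat n (x * y) = to_mat n x * to_mat n y"
    using assms by (auto intro!: eq_matI simp: ent_mult[of _ n] scalar_prod_def lessThan_atLeast0)
  show "to_mat n (adj x) = mat_adjoint (to_mat n x)"
    by (rule eq_matI) (auto simp: mat_adjoint_def mat_of_rows_def conjugate_vec_def)
qed

lemma of_mat_hom:
  assumes A: "A \<in> carrier_mat n n" and B: "B \<in> carrier_mat n n"
  shows "of_mat (A + B) = of_mat A + of_mat B" "of_mat (A * B) = of_mat A * of_mat B"
    "of_mat (c \<cdot>\<^sub>m A) = cscale c (of_mat A)" "of_mat (mat_adjoint A) = adj (of_mat A)"
    "of_mat (1\<^sub>m n) = idn n" "of_mat (0\<^sub>m n n) = 0"
proof -
  note c = of_mat_corner[OF A] of_mat_corner[OF B]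
  note h = to_mat_hom[OF c] and t = to_of_mat[OF A] to_of_mat[OF B]
  have *: "X = to_mat n x \<Longrightarrow> x \<in> corner n \<Longrightarrow> of_mat X = x" for X x
    by (simp only: of_to_mat)
  show "of_mat (A + B) = of_mat A + of_mat B"
    by (rule *) (simp_all only: h(1) t add_corner[OF c])
  show "of_mat (A * B) = of_mat A * of_mat B"
    by (rule *) (simp_all only: h(2) t mult_corner[OF c])
  show "of_mat (c \<cdot>\<^sub>m A) = cscale c (of_mat A)"
    by (rule *) (simp_all only: h(3) t cscale_corner[OF c(1)])
  show "of_mat (mat_adjoint A) = adj (of_mat A)"
    by (rule *) (simp_all only: h(4) t adj_corner[OF c(1)])
  show "of_mat (1\<^sub>m n) = idn n"
    by (rule *) (simp_all only: h(5) idn_corner order_refl)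
  show "of_mat (0\<^sub>m n n) = 0"
    by (rule *) (simp_all only: h(6) zero_corner)
qed

lemma mat_adjoint_carrier [simp]:
  fixes A :: "complex mat"
  shows "A \<in> carrier_mat n n \<Longrightarrow> mat_adjoint A \<in> carrier_mat n n"
  using to_mat_hom(4)[of "of_mat A" n "of_mat A"] to_of_mat[of A n] of_mat_corner[of A n] to_mat_carrier by metis

text \<open>Column vectors are represented as matrices with one nonzero column, so that the Hilbert-Schmidt
  norm of a matrix product also measures the action on vectors.\<close>

definition colv :: "nat \<Rightarrow> nat \<Rightarrow> complex vec \<Rightarrow> fmat" where
  "colv n c v = trunc n (\<lambda>i j. if j = c then v $ i else 0)"

lemma ent_colv: "ent (colv n c v) i j = (if i < n \<and> j < n \<and> j = c then v $ i else 0)"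
  by (auto simp: colv_def ent_trunc)

lemma colv_corner [simp]: "colv n c v \<in> corner n" by (simp add: colv_def)

lemma colv_mult:
  assumes "A \<in> carrier_mat n n" "v \<in> carrier_vec n"
  shows "of_mat A * colv n c v = colv n c (A *\<^sub>v v)"
proof (rule fmat_eqI)
  fix i j
  have "ent (of_mat A * colv n c v) i j = (\<Sum>l<n. ent (of_mat A) i l * ent (colv n c v) l j)"
    by (rule ent_mult) (use assms in auto)
  also have "\<dots> = ent (colv n c (A *\<^sub>v v)) i j"
    using assms by (auto simp: ent_of_mat ent_colv scalar_prod_def lessThan_atLeast0)
  finally show "ent (of_mat A * colv n c v) i j = ent (colv n c (A *\<^sub>v v)) i j" .
qed

lemma eigenvector_exists:
  assumes h: "h \<in> corner (Suc c)"
  obtains l v where "v \<in> corner (Suc c)" "v \<noteq> 0" "v * munit c c = v" "h * v = cscale l v"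
proof -
  let ?n = "Suc c" and ?A = "to_mat (Suc c) h"
  have "spectrum ?A \<noteq> {}" by (rule spectrum_non_empty) auto
  then obtain l w where "eigenvector ?A w l" by (auto simp: spectrum_def eigenvalue_def)
  then have w: "w \<in> carrier_vec ?n" "w \<noteq> 0\<^sub>v ?n" "?A *\<^sub>v w = l \<cdot>\<^sub>v w"
    by (auto simp: eigenvector_def)
  show thesis
  proof (rule that[of "colv ?n c w" l])
    show "h * colv ?n c w = cscale l (colv ?n c w)"
      using colv_mult[of ?A ?n w c] w of_to_mat[OF h]
      by (auto intro!: fmat_eqI simp: ent_colv)
    show "colv ?n c w \<noteq> 0"
    proof
      assume "colv ?n c w = 0"
      then have *: "ent (colv ?n c w) i c = 0" for i by simp
      have "w $ i = 0" if "i < ?n" for i using *[of i] that by (simp add: ent_colv)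
      then show False using w by (auto simp: vec_eq_iff)
    qed
    show "colv ?n c w * munit c c = colv ?n c w"
      by (rule fmat_eqI) (auto simp: ent_mult_munit ent_colv)
  qed simp
qed

lemma column_gram:
  assumes "v * munit c c = v"
  shows "adj v * v = cscale (of_real ((norm v)\<^sup>2)) (munit c c)"
proof -
  have v: "munit c c * adj v = adj v" using arg_cong[OF assms, of adj] by simp
  have e: "ent (adj v * v) i j = 0" if "\<not> (i = c \<and> j = c)" for i j
  proof -
    have "adj v * v = munit c c * (adj v * v * munit c c)"
      using assms v by (metis mult.assoc)
    then have "ent (adj v * v) i j = ent (munit c c * (adj v * v * munit c c)) i j" by simp
    then show ?thesis using that by (auto simp: ent_munit_mult ent_mult_munit)
  qed
  obtain n where n: "adj v * v \<in> corner n" "munit c c \<in> corner n" using ex_corner2 by blast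
  have "c < n" using cornerD[OF n(2), of c c] by (auto simp: ent_munit not_le[symmetric])
  have "tr (adj v * v) = (\<Sum>i<n. if i = c then ent (adj v * v) c c else 0)"
    unfolding tr_eq[OF n(1)] by (rule sum.cong) (auto simp: e)
  then have "tr (adj v * v) = ent (adj v * v) c c" using \<open>c < n\<close> by simp
  then have "ent (adj v * v) c c = of_real ((norm v)\<^sup>2)" using tr_adj_self_norm by metis
  then show ?thesis using e by (auto intro!: fmat_eqI simp: ent_munit)
qed

text \<open>The reflection that exchanges the last basis vector and \<open>u\<close>. It exists because the inner product of
  the two is real.\<close>

lemma householder:
  assumes u: "u \<in> corner (Suc c)" "u * munit c c = u" "norm u = 1" "ent u c c = of_real r"
  obtains W where "W \<in> corner (Suc c)" "adj W = W" "W * W = idn (Suc c)" "W * munit c c = u"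
proof (cases "u = munit c c")
  case True
  then show thesis using that[of "idn (Suc c)"] by (simp add: idn_mult_idn idn_mult_left[of _ "Suc c"])
next
  case False
  let ?e = "munit c c" and ?n = "Suc c"
  define w where "w = ?e - u"
  define s where "s = (norm w)\<^sup>2"
  have s: "s \<noteq> 0" using False by (simp add: s_def w_def)
  have we: "w * ?e = w" using u by (simp add: w_def left_diff_distrib munit_mult)
  have ew: "?e * adj w = adj w" using arg_cong[OF we, of adj] by simp
  have wn: "w \<in> corner ?n" using u by (simp add: w_def)
  have ww: "adj w * w = cscale (of_real s) ?e" unfolding s_def by (rule column_gram[OF we])
  have ue: "?e * adj u = adj u" using arg_cong[OF u(2), of adj] by simp
  have uu: "adj u * u = ?e" using column_gram[OF u(2)] u(3) by (simp add: cscale_simps)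
  have "?e * u = cscale (of_real r) ?e"
  proof (rule fmat_eqI)
    fix i j
    have "ent (?e * u) i j = ent (?e * (u * ?e)) i j" using u(2) by simp
    then show "ent (?e * u) i j = ent (cscale (of_real r) ?e) i j"
      using u(4) by (simp add: ent_munit_mult ent_mult_munit ent_munit)
  qed
  then have eu: "?e * u = cscale (of_real r) ?e" .
  have "adj u * ?e = adj (?e * u)" by simp
  then have eu: "?e * u = cscale (of_real r) ?e" "adj u * ?e = cscale (of_real r) ?e"
    using eu by (simp_all only: adj_simps complex_cnj_complex_of_real)
  have "adj w * w = cscale (of_real (2 - 2 * r)) ?e"
    by (simp add: w_def left_diff_distrib right_diff_distrib munit_mult uu eu cscale_simps)
      (auto intro!: fmat_eqI simp: algebra_simps)
  then have "ent (cscale (of_real s) ?e) c c = ent (cscale (of_real (2 - 2 * r)) ?e) c c" by (simp add: ww)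
  then have "complex_of_real s = of_real (2 - 2 * r)" unfolding ent_cscale ent_munit by simp
  then have sr: "s = 2 - 2 * r" by (simp only: of_real_eq_iff)
  define W where "W = idn ?n - cscale (of_real (2 / s)) (w * adj w)"
  have aw: "adj w * ?e = cscale (of_real (1 - r)) ?e"
    by (simp add: w_def left_diff_distrib munit_mult eu cscale_simps)
  have p: "w * adj w * (w * adj w) = cscale (of_real s) (w * adj w)"
  proof -
    have "w * adj w * (w * adj w) = w * (adj w * w) * adj w" by (simp add: mult.assoc)
    also have "\<dots> = cscale (of_real s) (w * ?e * adj w)" by (simp add: ww cscale_mult_left cscale_mult_right)
    finally show ?thesis by (simp add: we)
  qed
  show thesis
  proof (rule that[of W])
    show "W \<in> corner ?n" using wn by (simp add: W_def)
    show "adj W = W" by (simp add: W_def)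
    have pn: "w * adj w \<in> corner ?n" using wn by simp
    have "W * W = idn ?n - cscale (of_real (2/s)) (w * adj w) - cscale (of_real (2/s)) (w * adj w)
        + cscale (of_real (2/s)) (cscale (of_real (2/s)) (cscale (of_real s) (w * adj w)))"
      by (simp add: W_def left_diff_distrib right_diff_distrib idn_mult_idn cscale_mult_left cscale_mult_right
        idn_mult_left[OF pn] idn_mult_right[OF pn] p cscale_simps(2))
    also have "cscale (of_real (2/s)) (cscale (of_real (2/s)) (cscale (of_real s) (w * adj w)))
        = cscale (of_real (2/s)) (w * adj w) + cscale (of_real (2/s)) (w * adj w)"
      using s by (simp add: cscale_simps(3)[symmetric] cscale_simps(5))
    also have "idn ?n - cscale (of_real (2/s)) (w * adj w) - cscale (of_real (2/s)) (w * adj w)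
        + (cscale (of_real (2/s)) (w * adj w) + cscale (of_real (2/s)) (w * adj w)) = idn ?n" by simp
    finally show "W * W = idn ?n" .
    have "W * ?e = ?e - cscale (of_real (2/s)) (w * (adj w * ?e))"
      by (simp add: W_def left_diff_distrib cscale_mult_left mult.assoc idn_mult_left[of _ ?n])
    also have "\<dots> = ?e - cscale (of_real (2 / s * (1 - r))) w"
      by (simp only: aw cscale_mult_right we cscale_simps(5) of_real_mult)
    also have "2 / s * (1 - r) = 1" using s sr by (simp add: field_simps)
    finally show "W * ?e = u" by (simp add: cscale_simps w_def)
  qed
qed

text \<open>Induction on the size: an eigenvector exists over the complex numbers, a Householder reflection
  moves it to the last coordinate, and for a hermitian matrix the last row and column then split
  off.\<close>

lemma spectral:
  assumes "h \<in> corner n" "adj h = h"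
  shows "\<exists>U D. U \<in> corner n \<and> D \<in> corner n \<and> U * adj U = idn n \<and> adj U * U = idn n \<and>
    (\<forall>i j. i \<noteq> j \<longrightarrow> ent D i j = 0) \<and> adj D = D \<and> h = U * D * adj U"
  using assms
proof (induction n arbitrary: h)
  case 0
  then have "h = 0" by (auto intro!: fmat_eqI cornerD)
  moreover have "idn 0 = 0" by (rule fmat_eqI) (simp add: ent_idn)
  ultimately show ?case by (intro exI[of _ 0]) auto
next
  case (Suc c)
  let ?e = "munit c c" and ?n = "Suc c"
  obtain l v where v: "v \<in> corner ?n" "v \<noteq> 0" "v * ?e = v" "h * v = cscale l v"
    using eigenvector_exists[OF Suc.prems(1)] .
  \<comment> \<open>A phase that makes the last entry real, as the Householder reflection requires.\<close>
  define z where "z = (if ent v c c = 0 then 1 else cnj (sgn (ent v c c)))"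
  have z: "cmod z = 1" by (simp add: z_def norm_sgn)
  have zv: "z * ent v c c = of_real (cmod (ent v c c))"
    by (auto simp: z_def sgn_eq complex_norm_square[symmetric] power2_eq_square mult.commute)
  define u where "u = cscale (z / of_real (norm v)) v"
  have u: "u \<in> corner ?n" "u * ?e = u" "norm u = 1" "ent u c c = of_real (cmod (ent v c c) / norm v)"
    "h * u = cscale l u"
    using v z zv by (auto simp: u_def cscale_mult_left cscale_mult_right norm_divide cscale_simps mult.commute)
  obtain W where W: "W \<in> corner ?n" "adj W = W" "W * W = idn ?n" "W * ?e = u"
    using householder[OF u(1-4)] .
  define k where "k = W * h * W"
  have kn: "k \<in> corner ?n" using W Suc.prems by (simp add: k_def)
  have ak: "adj k = k" using W Suc.prems by (simp add: k_def mult.assoc)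
  have "k * ?e = W * (h * u)" by (simp add: k_def mult.assoc W(4))
  also have "\<dots> = cscale l (W * W * ?e)" by (simp add: u(5) cscale_mult_right W(4) mult.assoc)
  finally have ke: "k * ?e = cscale l ?e" by (simp add: W(3) idn_mult_left[of _ ?n])
  have col: "ent k i c = (if i = c then l else 0)" for i
    using arg_cong[OF ke, of "\<lambda>x. ent x i c"] by (simp add: ent_mult_munit ent_munit)
  have row: "ent k c j = (if j = c then l else 0)" for j
    using arg_cong[OF ak, of "\<lambda>x. ent x c j"] arg_cong[OF ak, of "\<lambda>x. ent x c c"] col[of j] col[of c]
    by (cases "j = c") simp_all
  define k' where "k' = k - cscale l ?e"
  have l: "cnj l = l" using arg_cong[OF ak, of "\<lambda>x. ent x c c"] col[of c] by simp
  have "k' \<in> corner c"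
  proof (rule cornerI)
    fix i j assume "c \<le> i \<or> c \<le> j"
    then consider "i = c" | "j = c" | "?n \<le> i \<or> ?n \<le> j" by linarith
    then show "ent k' i j = 0"
      by cases (use col row cornerD[OF kn] in \<open>auto simp: k'_def ent_munit\<close>)
  qed
  moreover have "adj k' = k'" by (simp add: k'_def ak l)
  ultimately obtain U D where UD: "U \<in> corner c" "D \<in> corner c" "U * adj U = idn c" "adj U * U = idn c"
    "\<forall>i j. i \<noteq> j \<longrightarrow> ent D i j = 0" "adj D = D" "k' = U * D * adj U"
    using Suc.IH by blast
  have z: "x * ?e = 0" "?e * x = 0" if "x \<in> corner c" for x
    using that by (auto intro!: fmat_eqI simp: ent_mult_munit ent_munit_mult cornerD)
  have unit_root: "?e * ?e = ?e" by (simp add: munit_mult)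
  have idn: "idn c + ?e = idn ?n" by (auto intro!: fmat_eqI simp: ent_idn ent_munit)
  define V where "V = U + ?e"
  have V: "V \<in> corner ?n" "V * adj V = idn ?n" "adj V * V = idn ?n"
    using UD(1-4) by (auto simp: V_def corner_mono[of U c] distrib_left distrib_right z unit_root idn)
  have "V * (D + cscale l ?e) * adj V = U * D * adj U + cscale l ?e"
    using UD by (simp add: V_def distrib_left distrib_right cscale_mult_left cscale_mult_right z unit_root cscale_simps)
  then have k: "k = V * (D + cscale l ?e) * adj V" using UD(7) by (metis diff_add_cancel k'_def)
  have "h = W * W * h * (W * W)"
    using Suc.prems by (simp add: W idn_mult_left[of _ ?n] idn_mult_right[of _ ?n])
  also have "\<dots> = W * k * W" by (simp add: k_def mult.assoc)
  finally have h: "h = W * V * (D + cscale l ?e) * adj (W * V)" by (simp add: k W mult.assoc)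
  have "W * V * adj (W * V) = W * (V * adj V) * W" by (simp add: W mult.assoc)
  then have 1: "W * V * adj (W * V) = idn ?n" using W V by (simp add: idn_mult_right[of _ ?n])
  have "adj (W * V) * (W * V) = adj V * (W * W) * V" by (simp only: adj_mult W(2) mult.assoc)
  then have 2: "adj (W * V) * (W * V) = idn ?n" using W V by (simp add: idn_mult_right[of _ ?n])
  show ?case
    by (rule exI[of _ "W * V"], rule exI[of _ "D + cscale l ?e"])
    (intro conjI, use UD W V h 1 2 l in \<open>simp_all add: corner_mono[of D c] ent_munit\<close>)
qed

section \<open>Traceless matrices are sums of two commutators\<close>

text \<open>As long as the total is zero, some remaining term has the sign opposite to the current partial sum (or the
  partial sum is zero), and appending it keeps the partial sum in the interval from \<open>- M\<close> to \<open>M\<close>.\<close>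

lemma bounded_rearrangement:
  fixes f :: "'a \<Rightarrow> real"
  assumes "finite A" "\<And>a. a \<in> A \<Longrightarrow> \<bar>f a\<bar> \<le> M" "\<bar>c\<bar> \<le> M" "c + sum f A = 0"
  shows "\<exists>xs. distinct xs \<and> set xs = A \<and> (\<forall>m. \<bar>c + sum_list (map f (take m xs))\<bar> \<le> M)"
  using assms
proof (induction "card A" arbitrary: A c)
  case 0
  then show ?case by (intro exI[of _ "[]"]) auto
next
  case (Suc k)
  have "\<exists>a\<in>A. \<bar>c + f a\<bar> \<le> M"
  proof (rule ccontr)
    assume *: "\<not> (\<exists>a\<in>A. \<bar>c + f a\<bar> \<le> M)"
    have ne: "A \<noteq> {}" using Suc.hyps(2) by auto
    show False
    \<comment> \<open>If no term can be appended, all remaining terms have the sign of the partial sum, so the total is not zero.\<close>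
    proof (cases "0 < c")
      case True
      have "f a > 0" if "a \<in> A" for a
        using * that True Suc.prems(2)[OF that] Suc.prems(3) by (smt (verit))
      then have "sum f A > 0" using ne Suc.prems(1) by (intro sum_pos) auto
      then show False using True Suc.prems(4) by simp
    next
      case False
      have neg: "f a < 0" if "a \<in> A" for a
        using * that False Suc.prems(2)[OF that] Suc.prems(3) by (smt (verit))
      have "sum f A < 0" using ne Suc.prems(1) neg sum_strict_mono[of A f "\<lambda>_. 0"] by simp
      then show False using False Suc.prems(4) by simp
    qed
  qed
  then obtain a where a: "a \<in> A" "\<bar>c + f a\<bar> \<le> M" by blast
  have "\<exists>xs. distinct xs \<and> set xs = A - {a} \<and> (\<forall>m. \<bar>c + f a + sum_list (map f (take m xs))\<bar> \<le> M)"
  proof (rule Suc.hyps(1))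
    show "k = card (A - {a})" using Suc.hyps(2) Suc.prems(1) a by simp
    show "c + f a + sum f (A - {a}) = 0"
      using Suc.prems(1,4) a sum.remove[of A a f] by simp
  qed (use Suc.prems a in auto)
  then obtain xs where xs: "distinct xs" "set xs = A - {a}"
    "\<And>m. \<bar>c + f a + sum_list (map f (take m xs))\<bar> \<le> M" by blast
  have "\<bar>c + sum_list (map f (take m (a # xs)))\<bar> \<le> M" for m
    using xs(3) Suc.prems(3) by (cases m) (auto simp: add.assoc)
  then show ?case using xs a by (intro exI[of _ "a # xs"]) auto
qed

text \<open>A function with sum zero is a coboundary along a cyclic permutation, with the partial sums as
  potential. The order of the cycle can be chosen so that the potential is bounded by the function.\<close>

lemma cyclic_potential:
  fixes f :: "nat \<Rightarrow> real"
  assumes "\<And>i. i < n \<Longrightarrow> \<bar>f i\<bar> \<le> M" "0 \<le> M" "(\<Sum>i<n. f i) = 0"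
  obtains p s where "bij_betw p {..<n} {..<n}" "\<And>i. i < n \<Longrightarrow> \<bar>s i\<bar> \<le> M"
    "\<And>i. i < n \<Longrightarrow> f (p i) = s (p i) - s i"
proof -
  obtain xs where xs: "distinct xs" "set xs = {..<n}" "\<And>m. \<bar>sum_list (map f (take m xs))\<bar> \<le> M"
    using bounded_rearrangement[of "{..<n}" f M 0] assms by auto
  have len: "length xs = n" using distinct_card[OF xs(1)] xs(2) by simp
  have bij: "bij_betw ((!) xs) {..<n} {..<n}" using bij_betw_nth[OF xs(1)] len xs(2) by simp
  define idx where "idx = the_inv_into {..<n} ((!) xs)"
  have bidx: "bij_betw idx {..<n} {..<n}" unfolding idx_def by (rule bij_betw_the_inv_into[OF bij])
  have idx: "idx i < n" "xs ! idx i = i" if "i < n" for i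
    using that bij_betw_apply[OF bidx] f_the_inv_into_f_bij_betw[OF bij] by (auto simp: idx_def)
  have idx': "idx (xs ! m) = m" if "m < n" for m
    using that the_inv_into_f_f[OF bij_betw_imp_inj_on[OF bij]] by (auto simp: idx_def)
  define rot where "rot m = Suc m mod n" for m
  have rot: "bij_betw rot {..<n} {..<n}"
  proof (rule bij_betw_byWitness[where f' = "\<lambda>m. (m + (n - 1)) mod n"])
    show "\<forall>a\<in>{..<n}. (rot a + (n - 1)) mod n = a"
      by (auto simp: rot_def mod_Suc)
    show "\<forall>a\<in>{..<n}. rot ((a + (n - 1)) mod n) = a"
      by (auto simp: rot_def mod_Suc_eq)
  qed (auto simp: rot_def)
  define p where "p i = xs ! rot (idx i)" for i
  define s where "s i = sum_list (map f (take (Suc (idx i)) xs))" for i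
  have tot: "sum_list (map f xs) = 0"
    using assms(3) xs by (simp add: sum_list_distinct_conv_sum_set)
  show thesis
  proof (rule that[of p s])
    have "p = (!) xs \<circ> (rot \<circ> idx)" by (auto simp: p_def)
    then show "bij_betw p {..<n} {..<n}"
      using bij_betw_trans[OF bij_betw_trans[OF bidx rot] bij] by simp
    show "\<bar>s i\<bar> \<le> M" for i unfolding s_def by (rule xs(3))
    fix i assume i: "i < n"
    let ?m = "rot (idx i)"
    have m: "?m < n" using i by (simp add: rot_def)
    have st: "sum_list (map f (take (Suc k) xs)) = sum_list (map f (take k xs)) + f (xs ! k)" if "k < n" for k
      using that len by (simp add: take_Suc_conv_app_nth)
    have "sum_list (map f (take ?m xs)) = s i"
    proof (cases "Suc (idx i) < n")
      case True
      then show ?thesis by (simp add: s_def rot_def)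
    next
      case False
      then have "Suc (idx i) = n" using idx(1)[OF i] by simp
      then show ?thesis using len tot by (simp add: s_def rot_def)
    qed
    then show "f (p i) = s (p i) - s i"
      using st[OF m] idx'[OF m] by (simp add: p_def s_def[of "xs ! ?m"])
  qed
qed

definition diag :: "nat \<Rightarrow> (nat \<Rightarrow> complex) \<Rightarrow> fmat" where
  "diag n c = trunc n (\<lambda>i j. if i = j then c i else 0)"

lemma ent_diag: "ent (diag n c) i j = (if i = j \<and> i < n then c i else 0)"
  by (auto simp: diag_def ent_trunc)

lemma diag_corner [simp]: "diag n c \<in> corner n" by (simp add: diag_def)

lemma ent_diag_mult: "ent (diag n c * x) i j = (if i < n then c i * ent x i j else 0)"
proof -
  have "ent (diag n c * x) i j = (\<Sum>l<n. if l = i then c i * ent x i j else 0)"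
    unfolding ent_mult[OF disjI1[OF diag_corner]] by (rule sum.cong) (auto simp: ent_diag)
  then show ?thesis by simp
qed

lemma opn_diag_le:
  assumes "\<And>i. i < n \<Longrightarrow> cmod (c i) \<le> M" "0 \<le> M"
  shows "opn (diag n c) \<le> M"
proof (rule opn_le)
  fix v
  obtain m where m: "diag n c * v \<in> corner m" "v \<in> corner m" using ex_corner2 by blast
  show "norm (diag n c * v) \<le> M * norm v"
  proof (rule power2_le_imp_le)
    show "(norm (diag n c * v))\<^sup>2 \<le> (M * norm v)\<^sup>2"
      unfolding norm_sq_sum[OF m(1)] power_mult_distrib norm_sq_sum[OF m(2)] sum_distrib_left
    proof (intro sum_mono)
      fix i j
      show "(cmod (ent (diag n c * v) i j))\<^sup>2 \<le> M\<^sup>2 * (cmod (ent v i j))\<^sup>2"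
        using assms by (auto simp: ent_diag_mult norm_mult power_mult_distrib intro!: mult_right_mono power_mono)
    qed
  qed (use assms in simp)
qed

text \<open>With \<open>C\<close> the permutation matrix of the cycle and \<open>S\<close> the diagonal matrix of the potential, the matrix is
  \<open>S - C S C* = [S C*, C]\<close>. What matters is that the bounds do not depend on the size.\<close>

lemma diag_commutator:
  fixes f :: "nat \<Rightarrow> real"
  assumes f: "\<And>i. i < n \<Longrightarrow> \<bar>f i\<bar> \<le> M" "0 \<le> M" "(\<Sum>i<n. f i) = 0"
  obtains x v where "x \<in> corner n" "v \<in> corner n" "diag n (\<lambda>i. of_real (f i)) = x * v - v * x"
    "opn x \<le> M" "opn v \<le> 1"
proof -
  obtain p s where p: "bij_betw p {..<n} {..<n}" and s: "\<And>i. i < n \<Longrightarrow> \<bar>s i\<bar> \<le> M"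
    and fs: "\<And>i. i < n \<Longrightarrow> f (p i) = s (p i) - s i"
    using cyclic_potential[of n f M] f by metis
  define C where "C = trunc n (\<lambda>i j. if i = p j then 1 else 0)"
  define S where "S = diag n (\<lambda>i. of_real (s i))"
  have C: "C \<in> corner n" by (simp add: C_def)
  have pn: "p j < n" if "j < n" for j using p that by (auto simp: bij_betw_def)
  have inj: "p i = p j \<longleftrightarrow> i = j" if "i < n" "j < n" for i j
    using p that by (auto simp: bij_betw_def inj_on_def)
  have CxC: "ent (adj C * x * C) i j = ent x (p i) (p j)" if x: "x \<in> corner n" and ij: "i < n" "j < n" for x i j
  proof -
    have 1: "ent (adj C * x) i l = ent x (p i) l" for l
    proof -
      have "ent (adj C * x) i l = (\<Sum>k<n. if k = p i then ent x (p i) l else 0)"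
        unfolding ent_mult[OF disjI2[OF x]] by (rule sum.cong) (use ij pn in \<open>auto simp: C_def ent_trunc\<close>)
      then show ?thesis using pn ij by simp
    qed
    have "ent (adj C * x * C) i j = (\<Sum>l<n. if l = p j then ent x (p i) (p j) else 0)"
      unfolding ent_mult[OF disjI2[OF C]] 1 by (rule sum.cong) (use ij pn in \<open>auto simp: C_def ent_trunc\<close>)
    then show ?thesis using pn ij by simp
  qed
  have CC: "adj C * C = idn n"
  proof (rule fmat_eqI)
    fix i j
    show "ent (adj C * C) i j = ent (idn n) i j"
    proof (cases "i < n \<and> j < n")
      case True
      have "adj C * idn n = adj C" using C by (simp add: idn_mult_right[of _ n])
      then have "ent (adj C * C) i j = ent (idn n) (p i) (p j)" using CxC[of "idn n" i j] True by simp
      then show ?thesis using True pn inj by (auto simp: ent_idn)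
    next
      case False
      have "adj C * C \<in> corner n" using C by simp
      then show ?thesis using False by (auto simp: ent_idn not_less cornerD)
    qed
  qed
  have conj: "adj C * (diag n (\<lambda>i. of_real (f i)) - S) * C = - S"
  proof (rule fmat_eqI)
    fix i j
    let ?d = "diag n (\<lambda>i. complex_of_real (f i)) - S"
    have d: "?d \<in> corner n" by (simp add: S_def)
    show "ent (adj C * ?d * C) i j = ent (- S) i j"
    proof (cases "i < n \<and> j < n")
      case True
      then show ?thesis using CxC[OF d, of i j] pn inj[of i j] fs[of i] by (auto simp: S_def ent_diag)
    next
      case False
      have "adj C * ?d * C \<in> corner n" using C d by simp
      then show ?thesis using False by (auto simp: S_def ent_diag not_less cornerD)
    qed
  qed
  have CC': "C * adj C = idn n"
  proof (rule fmat_eqI)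
    fix i j
    have Cn: "C * adj C \<in> corner n" using C by simp
    show "ent (C * adj C) i j = ent (idn n) i j"
    proof (cases "i < n \<and> j < n")
      case True
      then have "i \<in> p ` {..<n}" "j \<in> p ` {..<n}" using bij_betw_imp_surj_on[OF p] by simp_all
      then obtain a b where ab: "a < n" "b < n" "i = p a" "j = p b" by blast
      have "ent (C * adj C) (p a) (p b) = ent (adj C * (C * adj C) * C) a b"
        using CxC[OF Cn ab(1,2)] by simp
      also have "adj C * (C * adj C) * C = idn n"
        using CC by (simp add: mult.assoc idn_mult_idn) (simp add: mult.assoc[symmetric] CC idn_mult_idn)
      finally show ?thesis using ab inj pn by (auto simp: ent_idn)
    next
      case False
      then show ?thesis using Cn by (auto simp: ent_idn not_less cornerD)
    qed
  qed
  have *: "diag n (\<lambda>i. of_real (f i)) - S = C * (adj C * (diag n (\<lambda>i. of_real (f i)) - S) * C) * adj C"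
  proof -
    have "C * (adj C * y * C) * adj C = (C * adj C) * y * (C * adj C)" for y by (simp add: mult.assoc)
    then show ?thesis by (simp add: CC' idn_mult_left[of _ n] idn_mult_right[of _ n] S_def)
  qed
  have eq: "diag n (\<lambda>i. of_real (f i)) = (S * adj C) * C - C * (S * adj C)"
  proof -
    have "diag n (\<lambda>i. of_real (f i)) - S = - (C * S * adj C)"
      using * unfolding conj by simp
    then have "diag n (\<lambda>i. of_real (f i)) = S - C * S * adj C" by (metis diff_add_cancel add.commute diff_conv_add_uminus)
    moreover have "S * adj C * C = S" by (simp add: mult.assoc CC idn_mult_right[of _ n] S_def)
    ultimately show ?thesis by (simp add: mult.assoc)
  qed
  have "opn S \<le> M" unfolding S_def using s f(2) by (intro opn_diag_le) auto
  moreover have Cn: "opn C \<le> 1" by (rule opn_unitary_le[OF CC])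
  ultimately have "opn S * opn (adj C) \<le> M * 1" using f(2) by (intro mult_mono) auto
  then have op: "opn (S * adj C) \<le> M" using opn_mult[of S "adj C"] by simp
  have SC: "S * adj C \<in> corner n" using C by (simp add: S_def)
  show thesis by (rule that[OF SC C eq op Cn])
qed

lemma hermitian_commutator:
  assumes h: "h \<in> corner n" "adj h = h" "tr h = 0"
  obtains x v where "x \<in> corner n" "v \<in> corner n" "h = x * v - v * x" "opn x \<le> opn h" "opn v \<le> 1"
proof -
  obtain U D where U: "U \<in> corner n" "D \<in> corner n" "U * adj U = idn n" "adj U * U = idn n"
    "\<And>i j. i \<noteq> j \<Longrightarrow> ent D i j = 0" "adj D = D" "h = U * D * adj U"
    using spectral[OF h(1,2)] by blast
  have u1: "opn U \<le> 1" "opn (adj U) \<le> 1" using opn_unitary_le[OF U(4)] by simp_all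
  define f where "f i = Re (ent D i i)" for i
  have "cnj (ent D i i) = ent D i i" for i using arg_cong[OF U(6), of "\<lambda>x. ent x i i"] by simp
  then have fD: "complex_of_real (f i) = ent D i i" for i
    by (simp add: f_def complex_eq_iff)
  have D: "D = diag n (\<lambda>i. of_real (f i))"
    using U(2,5) by (auto intro!: fmat_eqI simp: ent_diag fD not_less cornerD)
  have "adj U * h * U = (adj U * U) * D * (adj U * U)" by (simp add: U(7) mult.assoc)
  then have Dh: "D = adj U * h * U" using U by (simp add: idn_mult_left[of _ n] idn_mult_right[of _ n])
  have "opn D \<le> opn (adj U * h) * opn U" unfolding Dh by (rule opn_mult)
  also have "\<dots> \<le> opn (adj U * h) * 1" using u1 by (intro mult_left_mono) auto
  also have "\<dots> \<le> opn (adj U) * opn h" using opn_mult[of "adj U" h] by simp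
  also have "\<dots> \<le> 1 * opn h" using u1 by (intro mult_right_mono) auto
  finally have "opn D \<le> opn h" by simp
  then have fb: "\<bar>f i\<bar> \<le> opn h" for i
    using ent_le_opn[of D i i] norm_of_real[of "f i", where 'a = complex] by (simp add: fD)
  have "tr D = tr (h * (U * adj U))" unfolding Dh by (simp add: mult.assoc tr_commute[of "adj U"])
  then have "tr D = 0" using h U by (simp add: idn_mult_right[of _ n])
  then have "complex_of_real (\<Sum>i<n. f i) = 0" using U(2) by (simp add: tr_eq[of _ n] fD)
  then have "(\<Sum>i<n. f i) = 0" by (simp only: of_real_eq_0_iff)
  then obtain x v where xv: "x \<in> corner n" "v \<in> corner n" "D = x * v - v * x" "opn x \<le> opn h" "opn v \<le> 1"
    using diag_commutator[of n f "opn h"] fb D by (metis opn_nonneg)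
  have conj: "opn (U * y * adj U) \<le> opn y" for y
  proof -
    have "opn (U * y * adj U) \<le> opn (U * y) * opn (adj U)" by (rule opn_mult)
    also have "\<dots> \<le> opn (U * y) * 1" using u1 by (intro mult_left_mono) auto
    also have "\<dots> \<le> opn U * opn y" using opn_mult[of U y] by simp
    also have "\<dots> \<le> 1 * opn y" using u1 by (intro mult_right_mono) auto
    finally show ?thesis by simp
  qed
  have mult: "U * y * adj U * (U * z * adj U) = U * (y * z) * adj U" if "y \<in> corner n" for y z
  proof -
    have "U * y * adj U * (U * z * adj U) = U * (y * (adj U * U)) * z * adj U" by (simp add: mult.assoc)
    then show ?thesis using U that by (simp add: idn_mult_right[of _ n] mult.assoc)
  qed
  show thesis
  proof (rule that[of "U * x * adj U" "U * v * adj U"])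
    show "h = U * x * adj U * (U * v * adj U) - U * v * adj U * (U * x * adj U)"
      unfolding mult[OF xv(1)] mult[OF xv(2)] by (simp add: U(7) xv(3) left_diff_distrib right_diff_distrib)
    show "opn (U * x * adj U) \<le> opn h" using conj[of x] xv by simp
    show "opn (U * v * adj U) \<le> 1" using conj[of v] xv by simp
  qed (use U xv in simp_all)
qed

text \<open>Hermitian and antihermitian parts are diagonalized and treated by \<open>diag_commutator\<close>. The bounds do not depend
  on \<open>n\<close>, which makes the lemma applicable to bounded sequences of matrices of growing size.\<close>

lemma traceless_commutators:
  assumes "a \<in> corner n" "tr a = 0"
  obtains x v y w where "x \<in> corner n" "v \<in> corner n" "y \<in> corner n" "w \<in> corner n"
    "a = (x * v - v * x) + (y * w - w * y)"
    "opn x \<le> opn a" "opn v \<le> 1" "opn y \<le> opn a" "opn w \<le> 1"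
proof -
  define h where "h = cscale (1/2) (a + adj a)"
  define k where "k = cscale (- \<i>/2) (a - adj a)"
  have hk: "h \<in> corner n" "k \<in> corner n" "adj h = h" "adj k = k" "tr h = 0" "tr k = 0"
  proof -
    show "h \<in> corner n" "k \<in> corner n" using assms by (simp_all add: h_def k_def)
    show "adj h = h" by (simp add: h_def add.commute)
    show "adj k = k" by (rule fmat_eqI) (simp add: k_def algebra_simps)
    show "tr h = 0" "tr k = 0" using assms by (simp_all add: h_def k_def)
  qed
  have "opn h \<le> opn a" "opn k \<le> opn a"
    using opn_triangle[of a "adj a"] opn_diff[of a "adj a"] by (simp_all add: h_def k_def norm_divide)
  moreover obtain x v where xv: "x \<in> corner n" "v \<in> corner n" "h = x * v - v * x" "opn x \<le> opn h" "opn v \<le> 1"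
    using hermitian_commutator[of h n] hk by metis
  moreover obtain y w where yw: "y \<in> corner n" "w \<in> corner n" "k = y * w - w * y" "opn y \<le> opn k" "opn w \<le> 1"
    using hermitian_commutator[of k n] hk by metis
  moreover have "a = h + cscale \<i> k"
    by (intro fmat_eqI) (simp add: h_def k_def field_simps)
  then have "a = (x * v - v * x) + (cscale \<i> y * w - w * cscale \<i> y)"
    by (simp add: xv(3) yw(3) cscale_mult_left cscale_mult_right cscale_simps)
  ultimately show thesis using that[of x v "cscale \<i> y" w] by simp
qed

section \<open>The countable algebra of block sequences\<close>

definition bseq :: "(nat \<Rightarrow> nat) \<Rightarrow> (nat \<Rightarrow> fmat) set" where
  "bseq k = {a. (\<forall>j. a j \<in> corner (k j)) \<and> (\<exists>C. \<forall>j. opn (a j) \<le> C)}"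

lemma bseqI: "(\<And>j. a j \<in> corner (k j)) \<Longrightarrow> (\<And>j. opn (a j) \<le> C) \<Longrightarrow> a \<in> bseq k"
  by (auto simp: bseq_def)

lemma bseq_corner: "a \<in> bseq k \<Longrightarrow> a j \<in> corner (k j)" by (auto simp: bseq_def)

lemma bseq_bound: "a \<in> bseq k \<Longrightarrow> \<exists>C\<ge>0. \<forall>j. opn (a j) \<le> C"
proof -
  assume "a \<in> bseq k"
  then obtain C where C: "\<And>j. opn (a j) \<le> C" by (auto simp: bseq_def)
  have "0 \<le> C" using order_trans[OF opn_nonneg C] .
  with C show ?thesis by blast
qed

lemma bseq_ops:
  assumes "a \<in> bseq k" "b \<in> bseq k"
  shows "(\<lambda>j. a j + b j) \<in> bseq k" "(\<lambda>j. a j - b j) \<in> bseq k" "(\<lambda>j. a j * b j) \<in> bseq k"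
    "(\<lambda>j. adj (a j)) \<in> bseq k" "(\<lambda>j. cscale c (a j)) \<in> bseq k"
proof -
  obtain C where C: "0 \<le> C" "\<And>j. opn (a j) \<le> C" using bseq_bound[OF assms(1)] by auto
  obtain E where E: "0 \<le> E" "\<And>j. opn (b j) \<le> E" using bseq_bound[OF assms(2)] by auto
  note ab = bseq_corner[OF assms(1)] bseq_corner[OF assms(2)]
  show "(\<lambda>j. a j + b j) \<in> bseq k"
    by (rule bseqI[of _ _ "C + E"]) (use ab in \<open>auto intro: order_trans[OF opn_triangle] add_mono C E\<close>)
  show "(\<lambda>j. a j - b j) \<in> bseq k"
    by (rule bseqI[of _ _ "C + E"]) (use ab in \<open>auto intro: order_trans[OF opn_diff] add_mono C E\<close>)
  show "(\<lambda>j. a j * b j) \<in> bseq k"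
    by (rule bseqI[of _ _ "C * E"])
      (use ab order_trans[OF opn_mult mult_mono[OF C(2) E(2) C(1) opn_nonneg]] in auto)
  show "(\<lambda>j. adj (a j)) \<in> bseq k"
    by (rule bseqI[of _ _ C]) (use ab C in auto)
  show "(\<lambda>j. cscale c (a j)) \<in> bseq k"
    by (rule bseqI[of _ _ "cmod c * C"]) (use ab C in \<open>auto intro: mult_left_mono\<close>)
qed

definition block :: "nat \<Rightarrow> fmat \<Rightarrow> nat \<Rightarrow> fmat" where
  "block m x j = (if j = m then x else 0)"

definition ntr :: "(nat \<Rightarrow> nat) \<Rightarrow> (nat \<Rightarrow> fmat) \<Rightarrow> nat \<Rightarrow> complex" where
  "ntr k a j = tr (a j) / of_nat (k j)"

lemma ntr_bound:
  assumes "a j \<in> corner (k j)" "k j > 0"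
  shows "cmod (ntr k a j) \<le> opn (a j)"
  using tr_le_opn[OF assms(1)] assms(2) by (simp add: ntr_def norm_divide field_simps)

definition gauss_rat :: "complex set" where
  "gauss_rat = {Complex (of_rat p) (of_rat q) | p q. True}"

definition commutator_split :: "(nat \<Rightarrow> nat) \<Rightarrow> (nat \<Rightarrow> fmat) \<Rightarrow> (nat \<Rightarrow> fmat) \<Rightarrow> (nat \<Rightarrow> fmat) \<Rightarrow> (nat \<Rightarrow> fmat) \<Rightarrow> (nat \<Rightarrow> fmat) \<Rightarrow> bool" where
  "commutator_split k d x v y w \<longleftrightarrow> (\<forall>j. d j - cscale (ntr k d j) (idn (k j)) =
      (x j * v j - v j * x j) + (y j * w j - w j * y j))"

lemma commutator_split_exists:
  assumes d: "d \<in> bseq k" and k: "\<And>j. k j > 0"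
  shows "\<exists>x\<in>bseq k. \<exists>v\<in>bseq k. \<exists>y\<in>bseq k. \<exists>w\<in>bseq k. commutator_split k d x v y w"
proof -
  obtain C where C: "0 \<le> C" "\<And>j. opn (d j) \<le> C" using bseq_bound[OF d] by auto
  let ?a = "\<lambda>j. d j - cscale (ntr k d j) (idn (k j))"
  have bound: "opn (?a j) \<le> 2 * C" for j
  proof -
    have "opn (?a j) \<le> opn (d j) + cmod (ntr k d j) * opn (idn (k j))"
      using opn_diff[of "d j" "cscale (ntr k d j) (idn (k j))"] by simp
    also have "\<dots> \<le> C + C * 1"
      using C(1) C(2)[of j] ntr_bound[of d j k, OF bseq_corner[OF d] k] opn_idn_le[of "k j"] opn_nonneg[of "idn (k j)"]
      by (intro add_mono mult_mono) linarith+
    finally show ?thesis by simp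
  qed
  have "\<forall>j. \<exists>x v y w. x \<in> corner (k j) \<and> v \<in> corner (k j) \<and> y \<in> corner (k j) \<and> w \<in> corner (k j) \<and>
      ?a j = (x * v - v * x) + (y * w - w * y) \<and>
      opn x \<le> 2 * C \<and> opn v \<le> 1 \<and> opn y \<le> 2 * C \<and> opn w \<le> 1"
  proof
    fix j
    have "?a j \<in> corner (k j)" using bseq_corner[OF d] by simp
    moreover have "tr (?a j) = 0" using k[of j] by (simp add: ntr_def)
    ultimately obtain x v y w where "x \<in> corner (k j)" "v \<in> corner (k j)" "y \<in> corner (k j)" "w \<in> corner (k j)"
      "?a j = (x * v - v * x) + (y * w - w * y)" "opn x \<le> opn (?a j)" "opn v \<le> 1" "opn y \<le> opn (?a j)" "opn w \<le> 1"
      by (rule traceless_commutators)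
    then show "\<exists>x v y w. x \<in> corner (k j) \<and> v \<in> corner (k j) \<and> y \<in> corner (k j) \<and> w \<in> corner (k j) \<and>
      ?a j = (x * v - v * x) + (y * w - w * y) \<and>
      opn x \<le> 2 * C \<and> opn v \<le> 1 \<and> opn y \<le> 2 * C \<and> opn w \<le> 1"
      using order_trans[OF _ bound[of j]] by blast
  qed
  then obtain x v y w where *: "\<And>j. x j \<in> corner (k j) \<and> v j \<in> corner (k j) \<and> y j \<in> corner (k j) \<and> w j \<in> corner (k j) \<and>
      ?a j = (x j * v j - v j * x j) + (y j * w j - w j * y j) \<and>
      opn (x j) \<le> 2 * C \<and> opn (v j) \<le> 1 \<and> opn (y j) \<le> 2 * C \<and> opn (w j) \<le> 1"
    unfolding choice_iff by blast
  show ?thesis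
    by (rule bexI[of _ x], rule bexI[of _ v], rule bexI[of _ y], rule bexI[of _ w])
      (use * in \<open>auto simp: commutator_split_def intro!: bseqI\<close>)
qed

text \<open>The growth of the sizes serves the spectral gap: blocks below \<open>i\<close> are tiny compared with \<open>k i\<close>, and the
  corner that omits one row and column is almost everything. The block of size one makes every
  dimension a sum of block sizes. The condition \<open>D_comm\<close> forces tracial functionals to factor through the
  normalized traces, \<open>D_conv\<close> makes these converge, and \<open>D_proj\<close> excludes finite-dimensional representations that vanish on
  the blocks.\<close>

locale tower =
  fixes k :: "nat \<Rightarrow> nat" and D :: "(nat \<Rightarrow> fmat) set"
  assumes k_0: "k 0 = 1"
    and k_growth: "i < j \<Longrightarrow> 1000000 * k i \<le> k j"
    and D_countable: "countable D"
    and D_bseq: "D \<subseteq> bseq k"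
    and D_one: "(\<lambda>j. idn (k j)) \<in> D"
    and D_add: "d \<in> D \<Longrightarrow> e \<in> D \<Longrightarrow> (\<lambda>j. d j + e j) \<in> D"
    and D_mult: "d \<in> D \<Longrightarrow> e \<in> D \<Longrightarrow> (\<lambda>j. d j * e j) \<in> D"
    and D_adj: "d \<in> D \<Longrightarrow> (\<lambda>j. adj (d j)) \<in> D"
    and D_cscale: "d \<in> D \<Longrightarrow> c \<in> gauss_rat \<Longrightarrow> (\<lambda>j. cscale c (d j)) \<in> D"
    and D_block: "a < k m \<Longrightarrow> b < k m \<Longrightarrow> block m (munit a b) \<in> D"
    and D_expander: "(\<lambda>j. clock (k j)) \<in> D" "(\<lambda>j. chirp (k j)) \<in> D" "(\<lambda>j. fourier (k j)) \<in> D"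
    and D_proj: "\<exists>q\<in>D. (\<forall>j. adj (q j) = q j \<and> q j * q j = q j) \<and>
        ntr k q \<longlonglongrightarrow> of_real (1 / Suc r)"
    and D_comm: "d \<in> D \<Longrightarrow> \<exists>x\<in>D. \<exists>v\<in>D. \<exists>y\<in>D. \<exists>w\<in>D. commutator_split k d x v y w"
    and D_conv: "d \<in> D \<Longrightarrow> convergent (ntr k d)"

text \<open>Names for the elements of the countable algebra: terms over countably many generators, with four
  unary operations \<open>Com 0\<close>, ..., \<open>Com 3\<close> that choose the matrices of a commutator decomposition.\<close>

datatype gterm = Gen nat | Add gterm gterm | Mul gterm gterm | Adj gterm | Scal rat rat gterm
  | Com nat gterm

instance gterm :: countable by countable_datatype

primrec geval :: "(nat \<Rightarrow> nat \<Rightarrow> fmat) \<Rightarrow> (nat \<Rightarrow> (nat \<Rightarrow> fmat) \<Rightarrow> nat \<Rightarrow> fmat) \<Rightarrow> gterm \<Rightarrow> nat \<Rightarrow> fmat" where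
  "geval g X (Gen n) = g n"
| "geval g X (Add s t) = (\<lambda>j. geval g X s j + geval g X t j)"
| "geval g X (Mul s t) = (\<lambda>j. geval g X s j * geval g X t j)"
| "geval g X (Adj s) = (\<lambda>j. adj (geval g X s j))"
| "geval g X (Scal p q s) = (\<lambda>j. cscale (Complex (of_rat p) (of_rat q)) (geval g X s j))"
| "geval g X (Com i s) = X i (geval g X s)"

lemma closed_countable_family:
  assumes k: "\<And>j. k j > 0" and G: "countable G" "G \<subseteq> bseq k" "G \<noteq> {}"
  obtains D where "countable D" "G \<subseteq> D" "D \<subseteq> bseq k"
    "\<And>d e. d \<in> D \<Longrightarrow> e \<in> D \<Longrightarrow> (\<lambda>j. d j + e j) \<in> D"
    "\<And>d e. d \<in> D \<Longrightarrow> e \<in> D \<Longrightarrow> (\<lambda>j. d j * e j) \<in> D"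
    "\<And>d. d \<in> D \<Longrightarrow> (\<lambda>j. adj (d j)) \<in> D"
    "\<And>d c. d \<in> D \<Longrightarrow> c \<in> gauss_rat \<Longrightarrow> (\<lambda>j. cscale c (d j)) \<in> D"
    "\<And>d. d \<in> D \<Longrightarrow> \<exists>x\<in>D. \<exists>v\<in>D. \<exists>y\<in>D. \<exists>w\<in>D. commutator_split k d x v y w"
proof -
  obtain g :: "nat \<Rightarrow> nat \<Rightarrow> fmat" where g: "range g = G"
    using G range_from_nat_into by metis
  have "\<forall>d\<in>bseq k. \<exists>F. (\<forall>i. F i \<in> bseq k) \<and> commutator_split k d (F 0) (F 1) (F 2) (F (3::nat))"
  proof
    fix d assume "d \<in> bseq k"
    then obtain x v y w where c: "x \<in> bseq k" "v \<in> bseq k" "y \<in> bseq k" "w \<in> bseq k"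
      "commutator_split k d x v y w"
      using commutator_split_exists[of d k, OF _ k] by blast
    then show "\<exists>F. (\<forall>i. F i \<in> bseq k) \<and> commutator_split k d (F 0) (F 1) (F 2) (F (3::nat))"
      by (intro exI[of _ "\<lambda>i. if i = 0 then x else if i = 1 then v else if i = 2 then y else w"]) simp
  qed
  from bchoice[OF this] obtain F where F: "\<forall>d\<in>bseq k. (\<forall>i. F d i \<in> bseq k) \<and>
      commutator_split k d (F d 0) (F d 1) (F d 2) (F d (3::nat))" by blast
  define X where "X i d = F d i" for i d
  define D where "D = range (geval g X)"
  have DI: "geval g X t \<in> D" for t by (auto simp: D_def)
  have DB: "geval g X t \<in> bseq k" for t
  proof (induction t)
    case (Gen n)
    then show ?case using G g by auto
  next
    case (Com i s)
    then show ?case using F by (simp add: X_def)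
  qed (simp_all add: bseq_ops)
  show thesis
  proof (rule that[of D])
    show "countable D" by (simp add: D_def)
    show "G \<subseteq> D" using DI[of "Gen _"] g by auto
    show "D \<subseteq> bseq k" using DB by (auto simp: D_def)
    fix d assume "d \<in> D"
    then obtain s where s: "d = geval g X s" by (auto simp: D_def)
    show "(\<lambda>j. adj (d j)) \<in> D" using DI[of "Adj s"] s by simp
    show "(\<lambda>j. cscale c (d j)) \<in> D" if "c \<in> gauss_rat" for c
      using that DI[of "Scal _ _ s"] s by (auto simp: gauss_rat_def)
    have "commutator_split k d (geval g X (Com 0 s)) (geval g X (Com 1 s)) (geval g X (Com 2 s)) (geval g X (Com 3 s))"
      using F DB[of s] by (simp add: X_def s)
    then show "\<exists>x\<in>D. \<exists>v\<in>D. \<exists>y\<in>D. \<exists>w\<in>D. commutator_split k d x v y w"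
      using DI by blast
    fix e assume "e \<in> D"
    then obtain t where t: "e = geval g X t" by (auto simp: D_def)
    show "(\<lambda>j. d j + e j) \<in> D" "(\<lambda>j. d j * e j) \<in> D"
      using DI[of "Add s t"] DI[of "Mul s t"] s t by simp_all
  qed
qed

text \<open>Cantor's diagonal argument.\<close>

lemma common_convergent_subsequence:
  fixes F :: "'a \<Rightarrow> nat \<Rightarrow> complex"
  assumes S: "countable S" and b: "\<And>s. s \<in> S \<Longrightarrow> bounded (range (F s))"
  obtains r :: "nat \<Rightarrow> nat" where "strict_mono r" "\<And>s. s \<in> S \<Longrightarrow> convergent (F s \<circ> r)"
proof (cases "S = {}")
  case True
  then show thesis using that[of id] by (simp add: strict_mono_def)
next
  case False
  then obtain f :: "nat \<Rightarrow> 'a" where f: "range f = S" using S range_from_nat_into by metis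
  interpret subseqs "\<lambda>n s. convergent (F (f n) \<circ> s)"
  proof
    fix n and s :: "nat \<Rightarrow> nat"
    have "bounded (range (F (f n) \<circ> s))"
      by (rule bounded_subset[OF b[of "f n"]]) (use f in auto)
    then obtain l r where "strict_mono r" "((F (f n) \<circ> s) \<circ> r) \<longlonglongrightarrow> l"
      using bounded_imp_convergent_subsequence by metis
    then show "\<exists>r'. strict_mono r' \<and> convergent (F (f n) \<circ> (s \<circ> r'))"
      by (auto simp: convergent_def o_assoc)
  qed
  have *: "convergent (F (f n) \<circ> (diagseq \<circ> (+) (Suc n)))" for n
  proof (rule diagseq_holds)
    fix r s :: "nat \<Rightarrow> nat" and n
    assume "strict_mono r" "convergent (F (f n) \<circ> s)"
    then show "convergent (F (f n) \<circ> (s \<circ> r))"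
      using convergent_subseq_convergent[of "F (f n) \<circ> s" r] by (simp add: o_assoc)
  qed
  show thesis
  proof (rule that[OF subseq_diagseq])
    fix s assume "s \<in> S"
    then obtain n where n: "s = f n" using f by auto
    have "(\<lambda>i. (F s \<circ> diagseq) (i + Suc n)) = F (f n) \<circ> (diagseq \<circ> (+) (Suc n))"
      by (auto simp: n add.commute)
    then have "convergent (\<lambda>i. (F s \<circ> diagseq) (i + Suc n))" using *[of n] by simp
    then show "convergent (F s \<circ> diagseq)" by (simp only: convergent_ignore_initial_segment)
  qed
qed

lemma proportion_limit:
  assumes "filterlim k at_top sequentially"
  shows "(\<lambda>j. complex_of_real (real (k j div Suc r) / real (k j))) \<longlonglongrightarrow> of_real (1 / Suc r)"
proof -
  have rk: "filterlim (\<lambda>j. real (k j)) at_top sequentially"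
    using assms filterlim_compose filterlim_real_sequentially by blast
  have "(\<lambda>j. real (k j div Suc r) / real (k j)) \<longlonglongrightarrow> 1 / Suc r"
  proof (rule real_tendsto_sandwich)
    have "((\<lambda>j. 1 / real (Suc r) - 1 / real (k j)) \<longlonglongrightarrow> 1 / Suc r - 0)"
      using rk by (intro tendsto_intros) (simp add: tendsto_inverse_0_at_top divide_inverse)
    then show "(\<lambda>j. 1 / real (Suc r) - 1 / real (k j)) \<longlonglongrightarrow> 1 / Suc r" by simp
    have pos: "eventually (\<lambda>j. 0 < k j) sequentially"
      using assms[unfolded filterlim_at_top, rule_format, of 1] by eventually_elim simp
    show "eventually (\<lambda>j. 1 / real (Suc r) - 1 / real (k j) \<le> real (k j div Suc r) / real (k j)) sequentially"
      using pos
    proof eventually_elim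
      case (elim j)
      have "k j \<le> Suc r * (k j div Suc r) + Suc r"
        using dividend_less_div_times[of "Suc r" "k j"] by (simp add: mult.commute)
      then have "real (k j) \<le> real (Suc r * (k j div Suc r) + Suc r)" by (simp only: of_nat_le_iff)
      then have "real (k j) \<le> real (Suc r) * real (k j div Suc r) + real (Suc r)"
        by (simp only: of_nat_add of_nat_mult)
      then have "1 / real (Suc r) \<le> (real (k j div Suc r) + 1) / real (k j)"
        using elim by (simp add: le_divide_eq divide_le_eq ring_distribs mult.commute)
      then show ?case by (simp add: add_divide_distrib)
    qed
    show "eventually (\<lambda>j. real (k j div Suc r) / real (k j) \<le> 1 / Suc r) sequentially"
      using pos
    proof eventually_elim
      case (elim j)
      have "real (k j div Suc r * Suc r) \<le> real (k j)"
        by (simp only: of_nat_le_iff div_times_less_eq_dividend)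
      then have "real (k j div Suc r) * real (Suc r) \<le> real (k j)" by (simp only: of_nat_mult)
      then show ?case using elim by (simp add: field_simps)
    qed
  qed simp
  then show ?thesis by (intro tendsto_of_real)
qed

text \<open>The countable algebra is generated first, over the sizes \<open>10 ^ (6 j)\<close>; then blocks are dropped until the
  normalized traces converge. All closure conditions survive the passage to a subsequence of blocks.
  Block zero is kept because the size one is needed.\<close>

theorem tower_exists: "\<exists>k D. tower k D"
proof -
  define K :: "nat \<Rightarrow> nat" where "K j = 1000000 ^ j" for j
  have Kpos: "K j > 0" for j by (simp add: K_def)
  define G where "G = {\<lambda>j. idn (K j), \<lambda>j. clock (K j), \<lambda>j. chirp (K j), \<lambda>j. fourier (K j)} \<union>
    range (\<lambda>r j. idn (K j div Suc r)) \<union> range (\<lambda>(m, a, b). if a < K m \<and> b < K m then block m (munit a b) else (\<lambda>j. 0))"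
  have G: "countable G" by (simp add: G_def)
  have mu: "opn (munit a b) \<le> 1" for a b using opn_le_norm[of "munit a b"] by simp
  then have GB: "G \<subseteq> bseq K"
  proof -
    have ex: "g \<in> bseq K" if "\<And>j. g j \<in> expander (K j)" for g
      using expander_corner[OF that] opn_expander[OF Kpos that] by (intro bseqI)
    have "(\<lambda>j. clock (K j)) \<in> bseq K" "(\<lambda>j. chirp (K j)) \<in> bseq K" "(\<lambda>j. fourier (K j)) \<in> bseq K"
      by (rule ex, simp add: expander_def)+
    moreover have "(\<lambda>j. idn (K j)) \<in> bseq K" "(\<lambda>j. idn (K j div Suc r)) \<in> bseq K" for r
      by (rule bseqI[of _ _ 1]; simp add: opn_idn_le div_le_dividend)+
    moreover have "block m (munit a b) \<in> bseq K" if "a < K m" "b < K m" for m a b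
      using that by (intro bseqI[of _ _ 1]) (auto simp: block_def mu)
    moreover have "(\<lambda>j. 0) \<in> bseq K" by (rule bseqI[of _ _ 0]) auto
    ultimately show ?thesis by (auto simp: G_def)
  qed
  obtain D where D: "countable D" "G \<subseteq> D" "D \<subseteq> bseq K"
    "\<And>d e. d \<in> D \<Longrightarrow> e \<in> D \<Longrightarrow> (\<lambda>j. d j + e j) \<in> D"
    "\<And>d e. d \<in> D \<Longrightarrow> e \<in> D \<Longrightarrow> (\<lambda>j. d j * e j) \<in> D"
    "\<And>d. d \<in> D \<Longrightarrow> (\<lambda>j. adj (d j)) \<in> D"
    "\<And>d c. d \<in> D \<Longrightarrow> c \<in> gauss_rat \<Longrightarrow> (\<lambda>j. cscale c (d j)) \<in> D"
    "\<And>d. d \<in> D \<Longrightarrow> \<exists>x\<in>D. \<exists>v\<in>D. \<exists>y\<in>D. \<exists>w\<in>D. commutator_split K d x v y w"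
    using closed_countable_family[of K G, OF Kpos G GB] by (auto simp: G_def)
  have "bounded (range (\<lambda>i. ntr K d (Suc i)))" if "d \<in> D" for d
  proof -
    have dB: "d \<in> bseq K" using D(3) that by blast
    obtain C where C: "\<And>j. opn (d j) \<le> C" using bseq_bound[OF dB] by auto
    have "cmod (ntr K d (Suc i)) \<le> C" for i
      by (rule order_trans[OF ntr_bound[of d "Suc i" K, OF bseq_corner[OF dB] Kpos] C])
    then show ?thesis by (auto simp: bounded_iff)
  qed
  then obtain r :: "nat \<Rightarrow> nat" where r: "strict_mono r"
    "\<And>d. d \<in> D \<Longrightarrow> convergent ((\<lambda>i. ntr K d (Suc i)) \<circ> r)"
    by (rule common_convergent_subsequence[OF D(1), of "\<lambda>d i. ntr K d (Suc i)"]) blast+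
  \<comment> \<open>The subsequence starts with the block of size one.\<close>
  define \<rho> where "\<rho> j = (case j of 0 \<Rightarrow> 0 | Suc i \<Rightarrow> Suc (r i))" for j
  have \<rho>: "strict_mono \<rho>"
    unfolding strict_mono_Suc_iff by (auto simp: \<rho>_def strict_monoD[OF r(1)] split: nat.split)
  define k where "k = K \<circ> \<rho>"
  define E where "E = (\<lambda>d. d \<circ> \<rho>) ` D"
  have EI: "d \<in> D \<Longrightarrow> d \<circ> \<rho> \<in> E" for d by (auto simp: E_def)
  have kpos: "k j > 0" for j by (simp add: k_def Kpos)
  have klim: "filterlim k at_top sequentially"
  proof -
    have "filterlim K at_top sequentially"
      unfolding K_def by (rule filterlim_subseq) (simp add: strict_mono_Suc_iff)
    then show ?thesis unfolding k_def o_def by (rule filterlim_compose) (rule filterlim_subseq[OF \<rho>])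
  qed
  have DG: "g \<in> G \<Longrightarrow> g \<in> D" for g using D(2) by auto
  have "tower k E"
  proof
    show "k 0 = 1" by (simp add: k_def \<rho>_def K_def)
    show "1000000 * k i \<le> k j" if "i < j" for i j
    proof -
      have "Suc (\<rho> i) \<le> \<rho> j" using strict_monoD[OF \<rho> that] by simp
      then have "K (Suc (\<rho> i)) \<le> K (\<rho> j)" unfolding K_def by (rule power_increasing) simp
      then show ?thesis by (simp add: k_def K_def)
    qed
    show "countable E" using D(1) by (simp add: E_def)
    show "E \<subseteq> bseq k"
    proof
      fix e assume "e \<in> E"
      then obtain d where d: "d \<in> bseq K" "e = d \<circ> \<rho>" using D(3) by (auto simp: E_def)
      obtain C where "\<And>j. opn (d j) \<le> C" using bseq_bound[OF d(1)] by auto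
      then show "e \<in> bseq k"
        using bseq_corner[OF d(1)] by (intro bseqI[of _ _ C]) (simp_all add: d(2) k_def)
    qed
    show "(\<lambda>j. idn (k j)) \<in> E" "(\<lambda>j. clock (k j)) \<in> E" "(\<lambda>j. chirp (k j)) \<in> E" "(\<lambda>j. fourier (k j)) \<in> E"
      using EI[OF DG, of "\<lambda>j. idn (K j)"] EI[OF DG, of "\<lambda>j. clock (K j)"] EI[OF DG, of "\<lambda>j. chirp (K j)"]
        EI[OF DG, of "\<lambda>j. fourier (K j)"] by (auto simp: G_def k_def o_def)
    show "block m (munit a b) \<in> E" if "a < k m" "b < k m" for a b m
    proof -
      have "(\<lambda>(m, a, b). if a < K m \<and> b < K m then block m (munit a b) else (\<lambda>j. 0)) (\<rho> m, a, b) \<in> G"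
        unfolding G_def by (rule UnI2) (rule rangeI)
      then have "block (\<rho> m) (munit a b) \<in> G" using that by (simp add: k_def)
      from EI[OF DG[OF this]] have "block (\<rho> m) (munit a b) \<circ> \<rho> \<in> E" .
      moreover have "block (\<rho> m) (munit a b) \<circ> \<rho> = block m (munit a b)"
        using strict_mono_eq[OF \<rho>] by (auto simp: block_def)
      ultimately show ?thesis by simp
    qed
    show "\<exists>q\<in>E. (\<forall>j. adj (q j) = q j \<and> q j * q j = q j) \<and> ntr k q \<longlonglongrightarrow> of_real (1 / Suc r)" for r
    proof (rule bexI)
      show "(\<lambda>j. idn (K j div Suc r)) \<circ> \<rho> \<in> E" by (rule EI, rule DG) (auto simp: G_def)
      have "ntr k ((\<lambda>j. idn (K j div Suc r)) \<circ> \<rho>) = (\<lambda>j. complex_of_real (real (k j div Suc r) / real (k j)))"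
        by (auto simp: ntr_def k_def)
      then show "(\<forall>j. adj (((\<lambda>j. idn (K j div Suc r)) \<circ> \<rho>) j) = ((\<lambda>j. idn (K j div Suc r)) \<circ> \<rho>) j \<and>
          ((\<lambda>j. idn (K j div Suc r)) \<circ> \<rho>) j * ((\<lambda>j. idn (K j div Suc r)) \<circ> \<rho>) j = ((\<lambda>j. idn (K j div Suc r)) \<circ> \<rho>) j) \<and>
        ntr k ((\<lambda>j. idn (K j div Suc r)) \<circ> \<rho>) \<longlonglongrightarrow> of_real (1 / Suc r)"
        using proportion_limit[OF klim] by (simp add: idn_mult_idn)
    qed
    fix d assume "d \<in> E"
    then obtain d' where d': "d' \<in> D" "d = d' \<circ> \<rho>" by (auto simp: E_def)
    show "(\<lambda>j. adj (d j)) \<in> E" using EI[OF D(6)[OF d'(1)]] by (simp add: d' o_def)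
    show "(\<lambda>j. cscale c (d j)) \<in> E" if "c \<in> gauss_rat" for c
      using EI[OF D(7)[OF d'(1) that]] by (simp add: d' o_def)
    obtain x v y w where xvyw: "x \<in> D" "v \<in> D" "y \<in> D" "w \<in> D" "commutator_split K d' x v y w"
      using D(8)[OF d'(1)] by blast
    have "commutator_split k d (x \<circ> \<rho>) (v \<circ> \<rho>) (y \<circ> \<rho>) (w \<circ> \<rho>)"
      using xvyw(5) by (simp add: commutator_split_def d' k_def ntr_def)
    then show "\<exists>x\<in>E. \<exists>v\<in>E. \<exists>y\<in>E. \<exists>w\<in>E. commutator_split k d x v y w"
      using EI xvyw by blast
    have "convergent (\<lambda>i. ntr k d (i + 1))"
      using r(2)[OF d'(1)] by (simp add: o_def d' ntr_def k_def \<rho>_def)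
    then show "convergent (ntr k d)" by (simp only: convergent_ignore_initial_segment)
    fix e assume "e \<in> E"
    then obtain e' where e': "e' \<in> D" "e = e' \<circ> \<rho>" by (auto simp: E_def)
    show "(\<lambda>j. d j + e j) \<in> E" "(\<lambda>j. d j * e j) \<in> E"
      using EI[OF D(4)[OF d'(1) e'(1)]] EI[OF D(5)[OF d'(1) e'(1)]] by (simp_all add: d' e' o_def)
  qed
  then show ?thesis by blast
qed

section \<open>The norm closure\<close>

lemma opn_le_entries:
  assumes "y \<in> corner n"
  shows "opn y \<le> (\<Sum>a<n. \<Sum>b<n. cmod (ent y a b))"
proof -
  have "opn y = opn (\<Sum>a<n. \<Sum>b<n. cscale (ent y a b) (munit a b))"
    using corner_expand[OF assms] by simp
  also have "\<dots> \<le> (\<Sum>a<n. opn (\<Sum>b<n. cscale (ent y a b) (munit a b)))" by (rule opn_sum)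
  also have "\<dots> \<le> (\<Sum>a<n. \<Sum>b<n. opn (cscale (ent y a b) (munit a b)))" by (intro sum_mono opn_sum)
  also have "\<dots> \<le> (\<Sum>a<n. \<Sum>b<n. cmod (ent y a b))"
  proof (intro sum_mono)
    fix a b
    have "opn (munit a b) \<le> 1" using opn_le_norm[of "munit a b"] by simp
    then show "opn (cscale (ent y a b) (munit a b)) \<le> cmod (ent y a b)"
      by (simp add: mult_left_le)
  qed
  finally show ?thesis .
qed

lemma opn_triangle3: "opn (x - z) \<le> opn (x - y) + opn (y - z)"
  using opn_triangle[of "x - y" "y - z"] by simp

lemma gauss_rat_dense:
  assumes "e > 0" shows "\<exists>q\<in>gauss_rat. cmod (c - q) \<le> e"
proof -
  obtain p where p: "Re c - e/2 < of_rat p" "of_rat p < Re c" using of_rat_dense[of "Re c - e/2" "Re c"] assms by auto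
  obtain q where q: "Im c - e/2 < of_rat q" "of_rat q < Im c" using of_rat_dense[of "Im c - e/2" "Im c"] assms by auto
  have "cmod (c - Complex (of_rat p) (of_rat q)) \<le> e"
    using cmod_le[of "c - Complex (of_rat p) (of_rat q)"] p q by simp
  then show ?thesis by (auto simp: gauss_rat_def)
qed

context tower
begin

lemma k_pos: "k j > 0"
  using k_0 k_growth[of 0 j] by (cases "j = 0") auto

lemma k_nonzero: "k j \<noteq> 0" using k_pos[of j] by simp

definition alg :: "(nat \<Rightarrow> fmat) set" where
  "alg = {a \<in> bseq k. \<forall>e>0. \<exists>d\<in>D. \<forall>j. opn (a j - d j) \<le> e}"

lemma alg_bseq: "a \<in> alg \<Longrightarrow> a \<in> bseq k" by (simp add: alg_def)
lemma alg_corner: "a \<in> alg \<Longrightarrow> a j \<in> corner (k j)" by (simp add: alg_bseq bseq_corner)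
lemma alg_bound: "a \<in> alg \<Longrightarrow> \<exists>C\<ge>0. \<forall>j. opn (a j) \<le> C" by (rule bseq_bound[OF alg_bseq])

lemma alg_approx: "a \<in> alg \<Longrightarrow> e > 0 \<Longrightarrow> \<exists>d\<in>D. \<forall>j. opn (a j - d j) \<le> e"
  by (simp add: alg_def)

lemma D_alg: "d \<in> D \<Longrightarrow> d \<in> alg"
  using D_bseq by (force simp: alg_def)

lemma alg_closed:
  assumes "a \<in> bseq k" "\<And>e. e > 0 \<Longrightarrow> \<exists>b\<in>alg. \<forall>j. opn (a j - b j) \<le> e"
  shows "a \<in> alg"
  unfolding alg_def
proof (intro CollectI conjI allI impI)
  fix e :: real assume "e > 0"
  then obtain b where b: "b \<in> alg" "\<And>j. opn (a j - b j) \<le> e/2" using assms(2)[of "e/2"] by auto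
  obtain d where d: "d \<in> D" "\<And>j. opn (b j - d j) \<le> e/2" using alg_approx[OF b(1), of "e/2"] \<open>e > 0\<close> by auto
  have "opn (a j - d j) \<le> e" for j using opn_triangle3[of "a j" "d j" "b j"] b(2)[of j] d(2)[of j] by linarith
  then show "\<exists>d\<in>D. \<forall>j. opn (a j - d j) \<le> e" using d(1) by blast
qed (rule assms(1))

lemma alg_add:
  assumes "a \<in> alg" "b \<in> alg" shows "(\<lambda>j. a j + b j) \<in> alg"
proof (rule alg_closed)
  show "(\<lambda>j. a j + b j) \<in> bseq k" using assms by (intro bseq_ops alg_bseq)
  fix e :: real assume "e > 0"
  then obtain c d where c: "c \<in> D" "\<And>j. opn (a j - c j) \<le> e/2" and d: "d \<in> D" "\<And>j. opn (b j - d j) \<le> e/2"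
    using alg_approx[OF assms(1), of "e/2"] alg_approx[OF assms(2), of "e/2"] by auto
  have "opn (a j + b j - (c j + d j)) \<le> e" for j
    using opn_triangle[of "a j - c j" "b j - d j"] c(2)[of j] d(2)[of j] by (simp add: algebra_simps)
  then show "\<exists>x\<in>alg. \<forall>j. opn (a j + b j - x j) \<le> e"
    using D_alg[OF D_add[OF c(1) d(1)]] by (intro bexI[of _ "\<lambda>j. c j + d j"]) auto
qed

lemma alg_adj:
  assumes "a \<in> alg" shows "(\<lambda>j. adj (a j)) \<in> alg"
proof (rule alg_closed)
  show "(\<lambda>j. adj (a j)) \<in> bseq k" using bseq_ops(4)[OF alg_bseq alg_bseq] assms by blast
  fix e :: real assume "e > 0"
  then obtain d where d: "d \<in> D" "\<And>j. opn (a j - d j) \<le> e" using alg_approx[OF assms] by auto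
  have "opn (adj (a j) - adj (d j)) \<le> e" for j
    using d(2)[of j] opn_adj[of "a j - d j"] by simp
  then show "\<exists>x\<in>alg. \<forall>j. opn (adj (a j) - x j) \<le> e"
    using D_alg[OF D_adj[OF d(1)]] by (intro bexI[of _ "\<lambda>j. adj (d j)"]) auto
qed

lemma scale_bound: "e > 0 \<Longrightarrow> C \<ge> 0 \<Longrightarrow> x \<le> C \<Longrightarrow> y \<le> e / (2 * (C + 1)) \<Longrightarrow> 0 \<le> y \<Longrightarrow> x * y \<le> (e/2 :: real)"
proof -
  assume a: "e > 0" "C \<ge> 0" "x \<le> C" "y \<le> e / (2 * (C + 1))" "0 \<le> y"
  have "x * y \<le> (C + 1) * (e / (2 * (C + 1)))" using a by (intro mult_mono) auto
  also have "\<dots> = e/2"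
  proof -
    have "c * (e / (2 * c)) = e/2" if "c > 0" for c :: real using that by simp
    from this[of "C + 1"] show ?thesis using a(2) by linarith
  qed
  finally show ?thesis .
qed

lemma alg_cscale:
  assumes "a \<in> alg" shows "(\<lambda>j. cscale c (a j)) \<in> alg"
proof (rule alg_closed)
  show "(\<lambda>j. cscale c (a j)) \<in> bseq k" using bseq_ops(5)[OF alg_bseq alg_bseq] assms by blast
  fix e :: real assume e: "e > 0"
  obtain C where C: "C \<ge> 0" "\<And>j. opn (a j) \<le> C" using alg_bound[OF assms] by auto
  obtain q where q: "q \<in> gauss_rat" "cmod (c - q) \<le> e / (2 * (C + 1))"
    using gauss_rat_dense[of "e / (2 * (C + 1))" c] e C by auto
  obtain d where d: "d \<in> D" "\<And>j. opn (a j - d j) \<le> e / (2 * (cmod q + 1))"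
    using alg_approx[OF assms, of "e / (2 * (cmod q + 1))"] e by (auto simp: add_nonneg_pos)
  have "opn (cscale c (a j) - cscale q (d j)) \<le> e" for j
  proof -
    have "cscale c (a j) - cscale q (d j) = cscale (c - q) (a j) + cscale q (a j - d j)" by (simp add: cscale_simps)
    then have "opn (cscale c (a j) - cscale q (d j)) \<le> opn (a j) * cmod (c - q) + cmod q * opn (a j - d j)"
      using opn_triangle[of "cscale (c - q) (a j)" "cscale q (a j - d j)"] by (simp add: mult.commute)
    also have "\<dots> \<le> e/2 + e/2"
      using e by (intro add_mono scale_bound[OF e C(1)] scale_bound[OF e, of "cmod q"]) (use C q d in auto)
    finally show ?thesis by simp
  qed
  then show "\<exists>x\<in>alg. \<forall>j. opn (cscale c (a j) - x j) \<le> e"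
    using D_alg[OF D_cscale[OF d(1) q(1)]] by (intro bexI[of _ "\<lambda>j. cscale q (d j)"]) auto
qed

lemma alg_mult:
  assumes "a \<in> alg" "b \<in> alg" shows "(\<lambda>j. a j * b j) \<in> alg"
proof (rule alg_closed)
  show "(\<lambda>j. a j * b j) \<in> bseq k" using assms by (intro bseq_ops alg_bseq)
  fix e :: real assume e: "e > 0"
  obtain C where C: "C \<ge> 0" "\<And>j. opn (b j) \<le> C" using alg_bound[OF assms(2)] by auto
  obtain c where c: "c \<in> D" "\<And>j. opn (a j - c j) \<le> e / (2 * (C + 1))"
    using alg_approx[OF assms(1), of "e / (2 * (C + 1))"] e C by auto
  obtain E where E: "E \<ge> 0" "\<And>j. opn (c j) \<le> E" using alg_bound[OF D_alg[OF c(1)]] by auto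
  obtain d where d: "d \<in> D" "\<And>j. opn (b j - d j) \<le> e / (2 * (E + 1))"
    using alg_approx[OF assms(2), of "e / (2 * (E + 1))"] e E by auto
  have "opn (a j * b j - c j * d j) \<le> e" for j
  proof -
    have "a j * b j - c j * d j = (a j - c j) * b j + c j * (b j - d j)" by (simp add: algebra_simps)
    then have "opn (a j * b j - c j * d j) \<le> opn (b j) * opn (a j - c j) + opn (c j) * opn (b j - d j)"
      using opn_triangle[of "(a j - c j) * b j" "c j * (b j - d j)"] opn_mult[of "a j - c j" "b j"]
        opn_mult[of "c j" "b j - d j"] by (simp add: mult.commute)
    also have "\<dots> \<le> e/2 + e/2"
      using e by (intro add_mono scale_bound[OF e C(1)] scale_bound[OF e E(1)]) (use C E c d in auto)
    finally show ?thesis by simp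
  qed
  then show "\<exists>x\<in>alg. \<forall>j. opn (a j * b j - x j) \<le> e"
    using D_alg[OF D_mult[OF c(1) d(1)]] by (intro bexI[of _ "\<lambda>j. c j * d j"]) auto
qed

lemma alg_one: "(\<lambda>j. idn (k j)) \<in> alg" by (rule D_alg[OF D_one])

lemma alg_zero: "(\<lambda>j. 0) \<in> alg"
  using alg_cscale[OF alg_one, of 0] by (simp add: cscale_simps)

lemma alg_diff: "a \<in> alg \<Longrightarrow> b \<in> alg \<Longrightarrow> (\<lambda>j. a j - b j) \<in> alg"
  using alg_add[of a "\<lambda>j. cscale (-1) (b j)"] alg_cscale[of b "-1"] by (simp add: cscale_simps)

lemma alg_sum: "(\<And>i. i \<in> I \<Longrightarrow> f i \<in> alg) \<Longrightarrow> (\<lambda>j. \<Sum>i\<in>I. f i j) \<in> alg"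
  by (induction I rule: infinite_finite_induct) (auto intro: alg_zero alg_add)

lemma alg_block:
  assumes "x \<in> corner (k m)" shows "block m x \<in> alg"
proof -
  have *: "(\<lambda>j. cscale (ent x a b) (block m (munit a b) j)) \<in> alg" if "a < k m" "b < k m" for a b
    by (rule alg_cscale, rule D_alg, rule D_block) (use that in auto)
  have "(\<lambda>j. \<Sum>a<k m. \<Sum>b<k m. cscale (ent x a b) (block m (munit a b) j)) \<in> alg"
    by (rule alg_sum, rule alg_sum) (use * in auto)
  also have "(\<lambda>j. \<Sum>a<k m. \<Sum>b<k m. cscale (ent x a b) (block m (munit a b) j)) = block m x"
    using corner_expand[OF assms] by (auto simp: block_def cscale_simps)
  finally show ?thesis .
qed

definition head :: "nat \<Rightarrow> (nat \<Rightarrow> fmat) \<Rightarrow> nat \<Rightarrow> fmat" where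
  "head N a j = (if j < N then a j else 0)"

lemma head_sum: "head N a j = (\<Sum>m<N. block m (a m) j)"
  by (auto simp: head_def block_def)

lemma alg_head: "(\<And>j. a j \<in> corner (k j)) \<Longrightarrow> head N a \<in> alg"
  unfolding head_sum[abs_def] by (intro alg_sum alg_block)

lemma alg_complete:
  fixes X :: "nat \<Rightarrow> nat \<Rightarrow> fmat"
  assumes X: "\<And>n. X n \<in> alg"
    and cauchy: "\<And>e. e > 0 \<Longrightarrow> \<exists>N. \<forall>m\<ge>N. \<forall>n\<ge>N. \<forall>j. opn (X m j - X n j) \<le> e"
  shows "\<exists>x\<in>alg. \<forall>e>0. \<exists>N. \<forall>n\<ge>N. \<forall>j. opn (X n j - x j) \<le> e"
proof -
  define x where "x j = trunc (k j) (\<lambda>a b. lim (\<lambda>n. ent (X n j) a b))" for j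
  have conv: "(\<lambda>n. ent (X n j) a b) \<longlonglongrightarrow> ent (x j) a b" for j a b
  proof (cases "a < k j \<and> b < k j")
    case True
    have "Cauchy (\<lambda>n. ent (X n j) a b)"
    proof (rule CauchyI)
      fix e :: real assume "e > 0"
      then obtain N where N: "\<And>m n. m \<ge> N \<Longrightarrow> n \<ge> N \<Longrightarrow> opn (X m j - X n j) \<le> e/2"
        using cauchy[of "e/2"] by auto
      have "cmod (ent (X m j) a b - ent (X n j) a b) < e" if "m \<ge> N" "n \<ge> N" for m n
        using ent_le_opn[of "X m j - X n j" a b] N[OF that] \<open>e > 0\<close> by simp
      then show "\<exists>M. \<forall>m\<ge>M. \<forall>n\<ge>M. norm (ent (X m j) a b - ent (X n j) a b) < e" by blast
    qed
    then show ?thesis using True by (simp add: x_def ent_trunc Cauchy_convergent_iff convergent_LIMSEQ_iff)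
  next
    case False
    then have "ent (X n j) a b = 0" for n
      by (intro cornerD[OF alg_corner[OF X]]) (auto simp: not_less)
    then show ?thesis using False by (auto simp: x_def ent_trunc)
  qed
  have pw: "(\<lambda>n. opn (X n j - x j)) \<longlonglongrightarrow> 0" for j
  proof (rule tendsto_sandwich[of "\<lambda>_. 0" _ _ "\<lambda>n. \<Sum>a<k j. \<Sum>b<k j. cmod (ent (X n j) a b - ent (x j) a b)"])
    have "opn (X n j - x j) \<le> (\<Sum>a<k j. \<Sum>b<k j. cmod (ent (X n j - x j) a b))" for n
      by (rule opn_le_entries) (simp add: alg_corner[OF X] x_def)
    then show "\<forall>\<^sub>F n in sequentially. opn (X n j - x j) \<le> (\<Sum>a<k j. \<Sum>b<k j. cmod (ent (X n j) a b - ent (x j) a b))"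
      by simp
    have "(\<lambda>n. \<Sum>a<k j. \<Sum>b<k j. cmod (ent (X n j) a b - ent (x j) a b)) \<longlonglongrightarrow> (\<Sum>a<k j. \<Sum>b<k j. 0)"
      by (intro tendsto_sum) (use conv in \<open>simp add: LIM_zero_iff tendsto_norm_zero\<close>)
    then show "(\<lambda>n. \<Sum>a<k j. \<Sum>b<k j. cmod (ent (X n j) a b - ent (x j) a b)) \<longlonglongrightarrow> 0" by simp
  qed simp_all
  have lim: "\<exists>N. \<forall>n\<ge>N. \<forall>j. opn (X n j - x j) \<le> e" if e: "e > 0" for e :: real
  proof -
    obtain N where N: "\<And>m n j. m \<ge> N \<Longrightarrow> n \<ge> N \<Longrightarrow> opn (X m j - X n j) \<le> e"
      using cauchy[OF e] by auto
    have "opn (X n j - x j) \<le> e" if n: "n \<ge> N" for n j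
    proof (rule field_le_epsilon)
      fix \<delta> :: real assume "\<delta> > 0"
      then obtain M where M: "\<And>m. m \<ge> M \<Longrightarrow> opn (X m j - x j) < \<delta>"
        using LIMSEQ_D[OF pw[of j], of \<delta>] by auto
      show "opn (X n j - x j) \<le> e + \<delta>"
        using opn_triangle3[of "X n j" "x j" "X (max M N) j"] M[of "max M N"] N[of n "max M N" j] n by simp
    qed
    then show ?thesis by blast
  qed
  have xb: "x \<in> bseq k"
  proof -
    obtain n where n: "\<And>j. opn (X n j - x j) \<le> 1" using lim[of 1] by auto
    obtain C where C: "\<And>j. opn (X n j) \<le> C" using alg_bound[OF X] by blast
    show ?thesis
    proof (rule bseqI)
      show "opn (x j) \<le> 1 + C" for j
        using opn_triangle3[of "x j" 0 "X n j"] n[of j] C[of j] by (simp add: opn_minus_commute)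
    qed (simp add: x_def)
  qed
  have "x \<in> alg"
  proof (rule alg_closed[OF xb])
    fix e :: real assume "e > 0"
    then obtain n where n: "\<And>j. opn (X n j - x j) \<le> e" using lim by blast
    have "opn (x j - X n j) \<le> e" for j by (subst opn_minus_commute) (rule n)
    then show "\<exists>b\<in>alg. \<forall>j. opn (x j - b j) \<le> e" using X[of n] by blast
  qed
  then show ?thesis using lim by blast
qed

text \<open>The square root of \<open>1 - h\<close> is \<open>1 - y\<close> with \<open>y = (h + y\<^sup>2) / 2\<close>, and the fixed point is found by iteration in
  the norm closure. The bound \<open>3/4\<close> keeps the iterates below \<open>1/2\<close>, where the map is a contraction with factor
  \<open>1/2\<close>.\<close>

lemma alg_sqrt:
  assumes h: "h \<in> alg" "\<And>j. adj (h j) = h j" "\<And>j. opn (h j) \<le> 3/4"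
  shows "\<exists>y\<in>alg. \<forall>j. adj (y j) * y j = idn (k j) - h j"
proof -
  define z where "z = rec_nat (\<lambda>j. 0) (\<lambda>_ (y :: nat \<Rightarrow> fmat) j. cscale (1/2) (h j + y j * y j))"
  have z0: "z 0 j = 0" and zS: "z (Suc n) j = cscale (1/2) (h j + z n j * z n j)" for n j
    by (simp_all add: z_def)
  have zalg: "z n \<in> alg" for n
  proof (induction n)
    case (Suc n)
    have "z (Suc n) = (\<lambda>j. cscale (1/2) (h j + z n j * z n j))" using zS by blast
    then show ?case by (simp add: alg_cscale alg_add alg_mult h Suc)
  qed (simp add: z_def alg_zero)
  have zadj: "adj (z n j) = z n j" for n j
    by (induction n) (simp_all add: z0 zS h)
  have zb: "opn (z n j) \<le> 1/2" for n j
  proof (induction n)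
    case (Suc n)
    have "opn (z n j) * opn (z n j) \<le> 1/2 * (1/2)" using Suc by (intro mult_mono) auto
    then have "opn (h j + z n j * z n j) \<le> 1"
      using opn_triangle[of "h j" "z n j * z n j"] opn_mult[of "z n j" "z n j"] h(3)[of j] by simp
    then show ?case by (simp add: zS norm_divide)
  qed (simp add: z0)
  have sq: "opn (x * x - y * y) \<le> opn (x - y)" if "opn x \<le> 1/2" "opn y \<le> 1/2" for x y
  proof -
    have "x * x - y * y = x * (x - y) + (x - y) * y" by (simp add: algebra_simps)
    then have "opn (x * x - y * y) \<le> opn x * opn (x - y) + opn (x - y) * opn y"
      using opn_triangle[of "x * (x - y)" "(x - y) * y"] opn_mult[of x "x - y"] opn_mult[of "x - y" y] by simp
    also have "\<dots> \<le> 1/2 * opn (x - y) + opn (x - y) * (1/2)"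
      using that by (intro add_mono mult_mono) auto
    finally show ?thesis by simp
  qed
  have step: "opn (z (Suc n) j - z n j) \<le> (1/2) ^ n" for n j
  proof (induction n)
    case 0
    then show ?case using zb[of 1 j] by (simp add: z0)
  next
    case (Suc n)
    have "z (Suc (Suc n)) j - z (Suc n) j = cscale (1/2) (z (Suc n) j * z (Suc n) j - z n j * z n j)"
      by (simp only: zS[of "Suc n"] zS[of n] cscale_simps(2)[symmetric]) simp
    then have "opn (z (Suc (Suc n)) j - z (Suc n) j) = 1/2 * opn (z (Suc n) j * z (Suc n) j - z n j * z n j)"
      by (simp add: norm_divide)
    also have "\<dots> \<le> 1/2 * opn (z (Suc n) j - z n j)" using sq[OF zb zb] by simp
    finally show ?case using Suc by simp
  qed
  have dist: "opn (z (n + p) j - z n j) \<le> 2 * (1/2) ^ n - 2 * (1/2) ^ (n + p)" for n p j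
  proof (induction p)
    case (Suc p)
    then show ?case using opn_triangle3[of "z (n + Suc p) j" "z n j" "z (n + p) j"] step[of "n + p" j] by simp
  qed simp
  have dist': "opn (z m j - z n j) \<le> 2 * (1/2) ^ N" if "m \<ge> N" "n \<ge> N" for m n N j
  proof -
    have *: "opn (z q j - z p j) \<le> 2 * (1/2) ^ N" if "N \<le> p" "p \<le> q" for p q
    proof -
      have "(1/2 :: real) ^ p \<le> (1/2) ^ N" using that by (intro power_decreasing) auto
      moreover have "0 \<le> (1/2 :: real) ^ q" by simp
      moreover have "opn (z q j - z p j) \<le> 2 * (1/2) ^ p - 2 * (1/2) ^ q"
        using dist[of p "q - p" j] that by simp
      ultimately show ?thesis by linarith
    qed
    show ?thesis using *[of n m] *[of m n] that by (cases "n \<le> m") (auto simp: opn_minus_commute)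
  qed
  have "\<exists>x\<in>alg. \<forall>e>0. \<exists>N. \<forall>n\<ge>N. \<forall>j. opn (z n j - x j) \<le> e"
  proof (rule alg_complete[OF zalg])
    fix e :: real assume "e > 0"
    then obtain N where "(1/2 :: real) ^ N < e/2" using real_arch_pow_inv[of "e/2" "1/2"] by fastforce
    then have "opn (z m j - z n j) \<le> e" if "m \<ge> N" "n \<ge> N" for m n j using dist'[OF that, of j] by linarith
    then show "\<exists>N. \<forall>m\<ge>N. \<forall>n\<ge>N. \<forall>j. opn (z m j - z n j) \<le> e" by blast
  qed
  then obtain x where x: "x \<in> alg" "\<And>e. e > 0 \<Longrightarrow> \<exists>N. \<forall>n\<ge>N. \<forall>j. opn (z n j - x j) \<le> e" by blast
  have small: "w = 0" if "\<And>e. e > 0 \<Longrightarrow> opn w \<le> e" for w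
    using that[of "opn w / 2"] opn_nonneg[of w] by (cases "opn w = 0") auto
  have xadj: "adj (x j) = x j" for j
  proof -
    have "opn (adj (x j) - x j) \<le> e" if e: "e > 0" for e
    proof -
      obtain n where n: "opn (z n j - x j) \<le> e/2" using x(2)[of "e/2"] e by fastforce
      have "opn (adj (x j) - z n j) = opn (adj (x j - z n j))" by (simp add: zadj)
      then have "opn (adj (x j) - z n j) \<le> e/2" using n by (metis opn_adj opn_minus_commute)
      then show ?thesis using n opn_triangle3[of "adj (x j)" "x j" "z n j"] by simp
    qed
    then show ?thesis using small[of "adj (x j) - x j"] by simp
  qed
  have xb: "opn (x j) \<le> 1/2" for j
  proof (rule field_le_epsilon)
    fix e :: real assume "e > 0"
    then obtain n where n: "opn (z n j - x j) \<le> e" using x(2) by blast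
    then show "opn (x j) \<le> 1/2 + e" using zb[of n j] opn_triangle3[of "x j" 0 "z n j"] by (simp add: opn_minus_commute)
  qed
  have fixpt: "x j = cscale (1/2) (h j + x j * x j)" for j
  proof -
    have "opn (x j - cscale (1/2) (h j + x j * x j)) \<le> e" if e: "e > 0" for e
    proof -
      have "\<exists>N. \<forall>n\<ge>N. \<forall>j. opn (z n j - x j) \<le> e/2" using x(2)[of "e/2"] e by simp
      then obtain n where n: "\<And>m. m \<ge> n \<Longrightarrow> opn (z m j - x j) \<le> e/2" by blast
      have "z (Suc n) j - cscale (1/2) (h j + x j * x j) = cscale (1/2) (z n j * z n j - x j * x j)"
        by (simp add: zS cscale_simps)
      then have "opn (z (Suc n) j - cscale (1/2) (h j + x j * x j)) = 1/2 * opn (z n j * z n j - x j * x j)"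
        by (simp add: norm_divide)
      also have "\<dots> \<le> 1/2 * opn (z n j - x j)" using sq[OF zb xb] by simp
      finally have "opn (z (Suc n) j - cscale (1/2) (h j + x j * x j)) \<le> e/2" using n[of n] e by simp
      then show ?thesis
        using opn_triangle3[of "x j" "cscale (1/2) (h j + x j * x j)" "z (Suc n) j"] n[of "Suc n"]
        by (simp add: opn_minus_commute)
    qed
    then show ?thesis using small[of "x j - cscale (1/2) (h j + x j * x j)"] by simp
  qed
  show ?thesis
  proof (rule bexI)
    show "(\<lambda>j. idn (k j) - x j) \<in> alg" by (rule alg_diff[OF alg_one x(1)])
    show "\<forall>j. adj (idn (k j) - x j) * (idn (k j) - x j) = idn (k j) - h j"
    proof
      fix j
      have c: "x j \<in> corner (k j)" by (rule alg_corner[OF x(1)])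
      have "cscale 2 (x j) = h j + x j * x j" by (subst fixpt) (simp add: cscale_simps)
      moreover have "cscale 2 (x j) = x j + x j" using cscale_simps(3)[of 1 1 "x j"] by (simp add: cscale_simps(6))
      ultimately have "h j + x j * x j = x j + x j" by simp
      then have "x j * x j = x j + x j - h j" by (simp add: algebra_simps)
      then show "adj (idn (k j) - x j) * (idn (k j) - x j) = idn (k j) - h j"
        by (simp add: xadj left_diff_distrib right_diff_distrib idn_mult_idn idn_mult_left[OF c] idn_mult_right[OF c])
    qed
  qed
qed

end

section \<open>Tracial functionals on the closure\<close>

lemma greatest_slow_index:
  fixes S :: "nat \<Rightarrow> nat"
  assumes "S 0 = 1"
  obtains J :: "nat \<Rightarrow> nat" where "\<And>n. n \<ge> 1 \<Longrightarrow> Suc (J n) * S (J n) \<le> n" "filterlim J at_top sequentially"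
proof -
  define J where "J n = Max {j. j \<le> n \<and> Suc j * S j \<le> n}" for n
  have fin: "finite {j. j \<le> n \<and> Suc j * S j \<le> n}" for n
    by (rule finite_subset[of _ "{..n}"]) auto
  have "J n \<in> {j. j \<le> n \<and> Suc j * S j \<le> n}" if "n \<ge> 1" for n
    unfolding J_def by (rule Max_in[OF fin]) (use that assms in \<open>auto intro!: exI[of _ 0]\<close>)
  then have 1: "Suc (J n) * S (J n) \<le> n" if "n \<ge> 1" for n using that by blast
  have "filterlim J at_top sequentially"
    unfolding filterlim_at_top eventually_sequentially
  proof
    fix Z
    show "\<exists>N. \<forall>n\<ge>N. Z \<le> J n"
    proof (intro exI allI impI)
      fix n assume "Z + Suc Z * S Z \<le> n"
      then have "Z \<in> {j. j \<le> n \<and> Suc j * S j \<le> n}" by simp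
      then show "Z \<le> J n" unfolding J_def by (rule Max_ge[OF fin])
    qed
  qed
  with 1 show thesis by (rule that)
qed

text \<open>Multiplicities \<open>m n j\<close> whose proportions \<open>m n j * k j / n\<close> approach the weights. Only blocks up to a slowly growing index \<open>J n\<close> are
  used, so that the rounding errors, at most \<open>k j\<close> each, are negligible against \<open>n\<close>. The mass that the
  weights miss is put on the last of these blocks, where \<open>x\<close> is close to its limit \<open>L\<close>. Block zero has
  size one and absorbs all rounding errors, so the dimension is exactly \<open>n\<close>.\<close>

lemma weight_rounding:
  fixes w :: "nat \<Rightarrow> real" and k :: "nat \<Rightarrow> nat"
  assumes k: "\<And>j. k j > 0" "k 0 = 1" and w: "\<And>j. w j \<ge> 0" "\<And>N. (\<Sum>j<N. w j) \<le> 1"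
  obtains J :: "nat \<Rightarrow> nat" and m :: "nat \<Rightarrow> nat \<Rightarrow> nat" where
    "\<And>n. n \<ge> 1 \<Longrightarrow> (\<Sum>j\<le>J n. m n j * k j) = n"
    "\<And>(x :: nat \<Rightarrow> complex) C L l. (\<And>j. cmod (x j) \<le> C) \<Longrightarrow> x \<longlonglongrightarrow> L \<Longrightarrow>
       (\<lambda>N. \<Sum>j<N. w j * (x j - L)) \<longlonglongrightarrow> l - L \<Longrightarrow>
       (\<lambda>n. (\<Sum>j\<le>J n. of_nat (m n j * k j) * x j) / of_nat n) \<longlonglongrightarrow> l"
proof -
  obtain J :: "nat \<Rightarrow> nat" where J: "\<And>n. n \<ge> 1 \<Longrightarrow> Suc (J n) * (\<Sum>j\<le>J n. k j) \<le> n"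
    and Jlim: "filterlim J at_top sequentially"
    by (rule greatest_slow_index[of "\<lambda>J. \<Sum>j\<le>J. k j"]) (use k in auto)
  \<comment> \<open>The weights truncated at \<open>n\<close>, with the missing mass on the last index.\<close>
  define v where "v n j = (if j < n then w j else 1 - (\<Sum>i<n. w i))" for n j
  have v0: "v n j \<ge> 0" for n j using w by (simp add: v_def)
  have vsum: "(\<Sum>j\<le>n. v n j) = 1" for n
    by (simp add: lessThan_Suc_atMost[symmetric] v_def)
  define r where "r n j = nat \<lfloor>v (J n) j * n / k j\<rfloor>" for n j
  \<comment> \<open>Block zero, of size one, fills the gap left by rounding down.\<close>
  define m where "m n j = (if j = 0 then n - (\<Sum>i\<in>{1..J n}. r n i * k i) else r n j)" for n j
  have rk: "real (r n j * k j) \<le> v (J n) j * n" "v (J n) j * n \<le> real (r n j * k j) + k j" for n j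
  proof -
    have "real (r n j) \<le> v (J n) j * n / k j" "v (J n) j * n / k j \<le> real (r n j) + 1"
      using v0[of "J n" j] by (auto simp: r_def of_nat_nat)
    then show "real (r n j * k j) \<le> v (J n) j * n" "v (J n) j * n \<le> real (r n j * k j) + k j"
      using k(1)[of j] by (simp_all add: le_divide_eq divide_le_eq algebra_simps)
  qed
  have split: "(\<Sum>j\<le>N. f j) = f 0 + (\<Sum>j\<in>{1..N}. f j)" for f :: "nat \<Rightarrow> 'c::comm_monoid_add" and N
    by (simp add: atMost_atLeast0 sum.atLeast_Suc_atMost)
  have le: "(\<Sum>j\<in>{1..J n}. r n j * k j) \<le> n" for n
  proof -
    have "real (\<Sum>j\<in>{1..J n}. r n j * k j) \<le> (\<Sum>j\<in>{1..J n}. v (J n) j * n)"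
      using rk by (simp add: sum_mono del: of_nat_mult)
    also have "\<dots> \<le> (\<Sum>j\<le>J n. v (J n) j * n)" by (intro sum_mono2) (use v0 in auto)
    also have "\<dots> = n" using vsum[of "J n"] by (simp add: sum_distrib_right[symmetric])
    finally show ?thesis by (simp only: of_nat_le_iff)
  qed
  show thesis
  proof (rule that[of m J])
    fix n :: nat assume "n \<ge> 1"
    have "(\<Sum>j\<in>{1..J n}. m n j * k j) = (\<Sum>j\<in>{1..J n}. r n j * k j)"
      by (rule sum.cong) (auto simp: m_def)
    then show "(\<Sum>j\<le>J n. m n j * k j) = n" using le[of n] k(2) by (simp add: split) (simp add: m_def)
  next
    fix x :: "nat \<Rightarrow> complex" and C L l
    assume x: "\<And>j. cmod (x j) \<le> C" "x \<longlonglongrightarrow> L" and l: "(\<lambda>N. \<Sum>j<N. w j * (x j - L)) \<longlonglongrightarrow> l - L"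
    define V where "V N = (\<Sum>j\<le>N. v N j * x j)" for N
    have C0: "0 \<le> C" using order_trans[OF norm_ge_zero x(1)] .
    have Vlim: "V \<longlonglongrightarrow> l"
    proof -
      have V: "V N = L + ((\<Sum>j<N. w j * (x j - L)) + of_real (1 - (\<Sum>i<N. w i)) * (x N - L))" for N
        by (simp add: V_def lessThan_Suc_atMost[symmetric] v_def algebra_simps sum_subtractf sum_distrib_left)
      have "(\<lambda>N. of_real (1 - (\<Sum>i<N. w i)) * (x N - L)) \<longlonglongrightarrow> 0"
      proof (rule Lim_null_comparison)
        have "cmod (of_real (1 - (\<Sum>i<N. w i)) * (x N - L)) \<le> 1 * cmod (x N - L)" for N
          unfolding norm_mult norm_of_real
          using w(2)[of N] sum_nonneg[of "{..<N}" w] w(1) by (intro mult_right_mono) auto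
        then show "\<forall>\<^sub>F N in sequentially. cmod (of_real (1 - (\<Sum>i<N. w i)) * (x N - L)) \<le> cmod (x N - L)" by simp
        show "(\<lambda>N. cmod (x N - L)) \<longlonglongrightarrow> 0" using x(2) by (simp add: LIM_zero_iff tendsto_norm_zero)
      qed
      then have "(\<lambda>N. L + ((\<Sum>j<N. w j * (x j - L)) + of_real (1 - (\<Sum>i<N. w i)) * (x N - L))) \<longlonglongrightarrow> L + (l - L + 0)"
        by (intro tendsto_intros l)
      then show ?thesis by (simp add: V[abs_def])
    qed
    have VJ: "(\<lambda>n. V (J n)) \<longlonglongrightarrow> l" by (rule filterlim_compose[OF Vlim Jlim])
    have "(\<lambda>n. (\<Sum>j\<le>J n. of_nat (m n j * k j) * x j) / of_nat n - V (J n)) \<longlonglongrightarrow> 0"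
    proof (rule Lim_null_comparison)
      have err: "cmod ((\<Sum>j\<le>J n. of_nat (m n j * k j) * x j) / of_nat n - V (J n)) \<le> 2 * C / Suc (J n)" if n: "n \<ge> 1" for n
      proof -
        let ?d = "\<lambda>j. v (J n) j * n - real (r n j * k j)"
        have d: "\<bar>?d j\<bar> \<le> k j" for j using rk[of n j] by simp
        have h: "a * y + T = M * y + (T - R * y)" if "a = M - R" for a y T M R :: complex
          unfolding that by (simp add: algebra_simps)
        have h': "M * U = M * y + S" if "U = a * y + T" "a = 1 - R" "S = M * T - M * R * y" for a y T M R S U :: complex
          unfolding that by (simp add: algebra_simps)
        have m0: "of_nat (m n 0 * k 0) = (of_nat n - (\<Sum>j\<in>{1..J n}. of_nat (r n j * k j)) :: complex)"
          using le[of n] k(2) by (simp add: m_def of_nat_diff of_nat_sum)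
        have mr: "(\<Sum>j\<in>{1..J n}. of_nat (m n j * k j) * x j) = (\<Sum>j\<in>{1..J n}. of_nat (r n j * k j) * x j)"
          by (rule sum.cong) (auto simp: m_def)
        have rx: "(\<Sum>j\<in>{1..J n}. of_nat (r n j * k j) * (x j - x 0)) =
            (\<Sum>j\<in>{1..J n}. of_nat (r n j * k j) * x j) - (\<Sum>j\<in>{1..J n}. of_nat (r n j * k j)) * x 0"
          by (simp only: right_diff_distrib sum_subtractf sum_distrib_right)
        have 1: "(\<Sum>j\<le>J n. of_nat (m n j * k j) * x j) =
            of_nat n * x 0 + (\<Sum>j\<in>{1..J n}. of_nat (r n j * k j) * (x j - x 0))"
          unfolding split mr rx by (rule h[OF m0])
        have "v (J n) 0 = 1 - (\<Sum>j\<in>{1..J n}. v (J n) j)" using vsum[of "J n"] by (simp add: split)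
        then have v1: "complex_of_real (v (J n) 0) = 1 - (\<Sum>j\<in>{1..J n}. of_real (v (J n) j))" by simp
        have VJ1: "V (J n) = of_real (v (J n) 0) * x 0 + (\<Sum>j\<in>{1..J n}. of_real (v (J n) j) * x j)"
          by (simp only: V_def split)
        have 2: "of_nat n * V (J n) = of_nat n * x 0 + (\<Sum>j\<in>{1..J n}. of_real (v (J n) j * n) * (x j - x 0))"
          by (rule h'[OF VJ1 v1]) (simp add: algebra_simps sum_subtractf sum_distrib_left sum_distrib_right)
        have "(\<Sum>j\<le>J n. of_nat (m n j * k j) * x j) - of_nat n * V (J n) =
            (\<Sum>j\<in>{1..J n}. - of_real (?d j) * (x j - x 0))"
          unfolding 1 2 by (simp add: sum_subtractf[symmetric] algebra_simps)
        also have "cmod \<dots> \<le> (\<Sum>j\<in>{1..J n}. k j * (2 * C))"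
        proof (rule order_trans[OF norm_sum], rule sum_mono)
          fix j
          have "cmod (x j - x 0) \<le> 2 * C" using norm_triangle_ineq4[of "x j" "x 0"] x(1)[of j] x(1)[of 0] by simp
          then show "cmod (- of_real (?d j) * (x j - x 0)) \<le> k j * (2 * C)"
            unfolding norm_mult norm_minus_cancel norm_of_real using d[of j] by (intro mult_mono) auto
        qed
        also have "\<dots> = 2 * C * real (\<Sum>j\<in>{1..J n}. k j)" by (simp add: sum_distrib_right[symmetric])
        also have "\<dots> \<le> 2 * C * real (\<Sum>j\<le>J n. k j)"
          using C0 by (intro mult_left_mono of_nat_mono sum_mono2) auto
        finally have 3: "cmod ((\<Sum>j\<le>J n. of_nat (m n j * k j) * x j) - of_nat n * V (J n)) \<le> 2 * C * real (\<Sum>j\<le>J n. k j)" .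
        have "real (Suc (J n)) * real (\<Sum>j\<le>J n. k j) \<le> real n"
          using J[OF n] by (simp only: of_nat_mult[symmetric] of_nat_le_iff)
        then have 4: "real (\<Sum>j\<le>J n. k j) / n \<le> 1 / Suc (J n)" using n by (simp add: field_simps)
        have "(\<Sum>j\<le>J n. of_nat (m n j * k j) * x j) / of_nat n - V (J n) =
            ((\<Sum>j\<le>J n. of_nat (m n j * k j) * x j) - of_nat n * V (J n)) / of_nat n"
          using n by (simp add: diff_divide_distrib)
        then have "cmod ((\<Sum>j\<le>J n. of_nat (m n j * k j) * x j) / of_nat n - V (J n)) \<le> 2 * C * (real (\<Sum>j\<le>J n. k j) / n)"
          using 3 n by (simp add: norm_divide divide_right_mono)
        also have "\<dots> \<le> 2 * C * (1 / Suc (J n))" using 4 C0 by (intro mult_left_mono) auto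
        finally show ?thesis by simp
      qed
      then show "\<forall>\<^sub>F n in sequentially. cmod ((\<Sum>j\<le>J n. of_nat (m n j * k j) * x j) / of_nat n - V (J n)) \<le> 2 * C / Suc (J n)"
        unfolding eventually_sequentially by blast
      have "(\<lambda>N. 2 * C * inverse (real (Suc N))) \<longlonglongrightarrow> 2 * C * 0"
        by (intro tendsto_intros LIMSEQ_inverse_real_of_nat)
      then have "(\<lambda>N. 2 * C / Suc N) \<longlonglongrightarrow> 0" by (simp add: divide_inverse)
      then show "(\<lambda>n. 2 * C / Suc (J n)) \<longlonglongrightarrow> 0" by (rule filterlim_compose[OF _ Jlim])
    qed
    from tendsto_add[OF this VJ] show "(\<lambda>n. (\<Sum>j\<le>J n. of_nat (m n j * k j) * x j) / of_nat n) \<longlonglongrightarrow> l"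
      by simp
  qed
qed

text \<open>Places \<open>x\<close> below and to the right of the corner of size \<open>n\<close>, so that \<open>x + shift n y\<close> is a direct sum for \<open>x\<close> in
  \<open>corner n\<close>.\<close>

definition shift :: "nat \<Rightarrow> fmat \<Rightarrow> fmat" where
  "shift n x = trunc (n + fsize x) (\<lambda>i j. if n \<le> i \<and> n \<le> j then ent x (i - n) (j - n) else 0)"

lemma ent_shift: "ent (shift n x) i j = (if n \<le> i \<and> n \<le> j then ent x (i - n) (j - n) else 0)"
  by (auto simp: shift_def ent_trunc not_less intro!: ent_outside)

lemma shift_corner: "x \<in> corner m \<Longrightarrow> shift n x \<in> corner (n + m)"
  by (rule cornerI) (auto simp: ent_shift intro!: cornerD)

lemma sum_shift_range: "(\<Sum>l<n + m. if n \<le> l then f (l - n) else 0) = (\<Sum>l<m. f l)"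
  for f :: "nat \<Rightarrow> 'c::comm_monoid_add"
proof -
  have "(\<Sum>l<n + m. if n \<le> l then f (l - n) else 0) = (\<Sum>l\<in>{n..<n + m}. f (l - n))"
    by (rule sum.mono_neutral_cong_right) auto
  also have "\<dots> = (\<Sum>l<m. f l)"
    by (rule sum.reindex_bij_witness[of _ "\<lambda>l. l + n" "\<lambda>l. l - n"]) auto
  finally show ?thesis .
qed

lemma shift_hom:
  "shift n (x + y) = shift n x + shift n y" "shift n (cscale c x) = cscale c (shift n x)"
  "shift n (adj x) = adj (shift n x)" "shift n (x * y) = shift n x * shift n y"
  "tr (shift n x) = tr x"
proof -
  show "shift n (x + y) = shift n x + shift n y" "shift n (cscale c x) = cscale c (shift n x)"
    "shift n (adj x) = adj (shift n x)" by (auto intro!: fmat_eqI simp: ent_shift)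
  obtain m where m: "x \<in> corner m" "y \<in> corner m" using ex_corner2 by blast
  show "shift n (x * y) = shift n x * shift n y"
  proof (rule fmat_eqI)
    fix i j
    have "ent (shift n x * shift n y) i j = (\<Sum>l<n + m. ent (shift n x) i l * ent (shift n y) l j)"
      by (rule ent_mult) (simp add: shift_corner m)
    also have "\<dots> = (\<Sum>l<n + m. if n \<le> l then (if n \<le> i \<and> n \<le> j then ent x (i - n) (l - n) * ent y (l - n) (j - n) else 0) else 0)"
      by (rule sum.cong) (auto simp: ent_shift)
    also have "\<dots> = (\<Sum>l<m. if n \<le> i \<and> n \<le> j then ent x (i - n) l * ent y l (j - n) else 0)"
      by (rule sum_shift_range)
    also have "\<dots> = ent (shift n (x * y)) i j" using m by (auto simp: ent_shift ent_mult[of _ m])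
    finally show "ent (shift n (x * y)) i j = ent (shift n x * shift n y) i j" by simp
  qed
  have "tr (shift n x) = (\<Sum>l<n + m. if n \<le> l then ent x (l - n) (l - n) else 0)"
    unfolding tr_eq[OF shift_corner[OF m(1)]] by (rule sum.cong) (auto simp: ent_shift)
  then show "tr (shift n x) = tr x"
    using sum_shift_range[where n = n and m = m and f = "\<lambda>l. ent x l l"] tr_eq[OF m(1)] by simp
qed

lemma corner_shift_orthogonal:
  assumes "x \<in> corner n" shows "x * shift n y = 0" "shift n y * x = 0"
proof -
  show "x * shift n y = 0" by (rule fmat_eqI) (use assms in \<open>simp add: ent_mult[of _ n] ent_shift\<close>)
  show "shift n y * x = 0" by (rule fmat_eqI) (use assms in \<open>simp add: ent_mult[of _ n] ent_shift\<close>)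
qed

context tower
begin

definition hom :: "nat \<Rightarrow> ((nat \<Rightarrow> fmat) \<Rightarrow> fmat) \<Rightarrow> bool" where
  "hom n f \<longleftrightarrow> f (\<lambda>j. idn (k j)) = idn n \<and> (\<forall>a\<in>alg. f a \<in> corner n) \<and>
    (\<forall>a\<in>alg. \<forall>b\<in>alg. f (\<lambda>j. a j + b j) = f a + f b) \<and>
    (\<forall>a\<in>alg. \<forall>b\<in>alg. f (\<lambda>j. a j * b j) = f a * f b) \<and>
    (\<forall>c. \<forall>a\<in>alg. f (\<lambda>j. cscale c (a j)) = cscale c (f a)) \<and>
    (\<forall>a\<in>alg. f (\<lambda>j. adj (a j)) = adj (f a))"

lemma hom_direct_sum:
  assumes "hom n f" "hom m g"
  shows "hom (n + m) (\<lambda>a. f a + shift n (g a))"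
proof -
  note F = assms[unfolded hom_def]
  have one: "idn n + shift n (idn m) = idn (n + m)"
    by (rule fmat_eqI) (auto simp: ent_idn ent_shift)
  have mul: "(f a + shift n (g a)) * (f b + shift n (g b)) = f a * f b + shift n (g a * g b)"
    if "a \<in> alg" "b \<in> alg" for a b
    using F that by (simp add: distrib_left distrib_right corner_shift_orthogonal shift_hom)
  show ?thesis
    unfolding hom_def
    using F by (auto simp: one mul shift_hom cscale_simps shift_corner corner_mono[of _ n])
qed

lemma hom_coordinate: "hom (k j) (\<lambda>a. a j)"
  by (simp add: hom_def alg_corner)

lemma hom_zero: "hom 0 (\<lambda>a. 0)"
proof -
  have "idn 0 = 0" by (rule fmat_eqI) (simp add: ent_idn)
  then show ?thesis by (simp add: hom_def cscale_simps)
qed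

lemma hom_multiple: "\<exists>h. hom (m * k j) h \<and> (\<forall>a\<in>alg. tr (h a) = of_nat m * tr (a j))"
proof (induction m)
  case 0
  then show ?case using hom_zero by auto
next
  case (Suc m)
  then obtain h where h: "hom (m * k j) h" "\<And>a. a \<in> alg \<Longrightarrow> tr (h a) = of_nat m * tr (a j)" by blast
  from hom_direct_sum[OF hom_coordinate[of j] h(1)] show ?case
    by (intro exI[of _ "\<lambda>a. a j + shift (k j) (h a)"]) (auto simp: h shift_hom algebra_simps)
qed

lemma hom_combination:
  "\<exists>h. hom (\<Sum>j\<le>J. m j * k j) h \<and> (\<forall>a\<in>alg. tr (h a) = (\<Sum>j\<le>J. of_nat (m j) * tr (a j)))"
proof (induction J)
  case 0
  then show ?case using hom_multiple[of "m 0" 0] by simp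
next
  case (Suc J)
  then obtain h where h: "hom (\<Sum>j\<le>J. m j * k j) h" "\<And>a. a \<in> alg \<Longrightarrow> tr (h a) = (\<Sum>j\<le>J. of_nat (m j) * tr (a j))" by blast
  obtain g where g: "hom (m (Suc J) * k (Suc J)) g" "\<And>a. a \<in> alg \<Longrightarrow> tr (g a) = of_nat (m (Suc J)) * tr (a (Suc J))"
    using hom_multiple by blast
  from hom_direct_sum[OF h(1) g(1)] show ?case
    by (intro exI[of _ "\<lambda>a. h a + shift (\<Sum>j\<le>J. m j * k j) (g a)"]) (auto simp: h g shift_hom)
qed

lemma block_mult: "(\<lambda>i. block j x i * block j y i) = block j (x * y)" by (auto simp: block_def)

definition tracial :: "((nat \<Rightarrow> fmat) \<Rightarrow> complex) \<Rightarrow> bool" where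
  "tracial \<phi> \<longleftrightarrow>
    (\<forall>a\<in>alg. \<forall>b\<in>alg. \<phi> (\<lambda>j. a j + b j) = \<phi> a + \<phi> b) \<and>
    (\<forall>c. \<forall>a\<in>alg. \<phi> (\<lambda>j. cscale c (a j)) = c * \<phi> a) \<and>
    (\<forall>a\<in>alg. 0 \<le> \<phi> (\<lambda>j. adj (a j) * a j)) \<and>
    \<phi> (\<lambda>j. idn (k j)) = 1 \<and>
    (\<forall>a\<in>alg. \<forall>b\<in>alg. \<phi> (\<lambda>j. a j * b j) = \<phi> (\<lambda>j. b j * a j))"

context
  fixes \<phi> assumes \<phi>: "tracial \<phi>"
begin

lemma phi_add: "a \<in> alg \<Longrightarrow> b \<in> alg \<Longrightarrow> \<phi> (\<lambda>j. a j + b j) = \<phi> a + \<phi> b"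
  and phi_cscale: "a \<in> alg \<Longrightarrow> \<phi> (\<lambda>j. cscale c (a j)) = c * \<phi> a"
  and phi_pos: "a \<in> alg \<Longrightarrow> 0 \<le> \<phi> (\<lambda>j. adj (a j) * a j)"
  and phi_one: "\<phi> (\<lambda>j. idn (k j)) = 1"
  and phi_commute: "a \<in> alg \<Longrightarrow> b \<in> alg \<Longrightarrow> \<phi> (\<lambda>j. a j * b j) = \<phi> (\<lambda>j. b j * a j)"
  using \<phi> unfolding tracial_def by blast+

lemma phi_zero: "\<phi> (\<lambda>j. 0) = 0"
  using phi_cscale[OF alg_one, of 0] by (simp add: cscale_simps)

lemma phi_diff:
  assumes "a \<in> alg" "b \<in> alg" shows "\<phi> (\<lambda>j. a j - b j) = \<phi> a - \<phi> b"
  using phi_add[OF assms(1) alg_cscale[OF assms(2), of "-1"]] phi_cscale[OF assms(2), of "-1"]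
  by (simp add: cscale_simps)

lemma phi_sum: "(\<And>i. i \<in> I \<Longrightarrow> f i \<in> alg) \<Longrightarrow> \<phi> (\<lambda>j. \<Sum>i\<in>I. f i j) = (\<Sum>i\<in>I. \<phi> (f i))"
proof (induction I rule: infinite_finite_induct)
  case (insert x F)
  then show ?case using phi_add[of "f x" "\<lambda>j. \<Sum>i\<in>F. f i j"] by (simp add: alg_sum)
qed (simp_all add: phi_zero)

lemma phi_hermitian_bound:
  assumes h: "h \<in> alg" "\<And>j. adj (h j) = h j" "\<And>j. opn (h j) \<le> 3/4"
  shows "cmod (\<phi> h) \<le> 1"
proof -
  have le: "0 \<le> 1 - \<phi> g" if g: "g \<in> alg" "\<And>j. adj (g j) = g j" "\<And>j. opn (g j) \<le> 3/4" for g
  proof -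
    obtain y where y: "y \<in> alg" "\<And>j. adj (y j) * y j = idn (k j) - g j" using alg_sqrt[OF g] by auto
    show ?thesis using phi_pos[OF y(1)] phi_diff[OF alg_one g(1)] phi_one by (simp add: y(2))
  qed
  have "0 \<le> 1 - \<phi> (\<lambda>j. cscale (-1) (h j))"
    by (rule le) (use h in \<open>simp_all add: alg_cscale\<close>)
  then have "0 \<le> 1 + \<phi> h" using phi_cscale[OF h(1), of "-1"] by simp
  with le[OF h] show ?thesis by (auto simp: less_eq_complex_def cmod_def)
qed

text \<open>Positivity bounds a trace on hermitian elements because \<open>1 - h\<close> and \<open>1 + h\<close> are of the form \<open>y* y\<close> for small \<open>h\<close>.
  The factor 3 collects the losses from the smallness of \<open>h\<close> and from splitting into hermitian and antihermitian
  parts.\<close>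

lemma phi_bound:
  assumes a: "a \<in> alg" "\<And>j. opn (a j) \<le> C"
  shows "cmod (\<phi> a) \<le> 3 * C"
proof (cases "C > 0")
  case False
  then have "opn (a j) = 0" for j using a(2)[of j] opn_nonneg[of "a j"] by linarith
  then have "a = (\<lambda>j. 0)" by auto
  moreover have "0 \<le> C" using order_trans[OF opn_nonneg a(2)] .
  ultimately show ?thesis by (simp add: phi_zero)
next
  case True
  have herm: "cmod (\<phi> h) \<le> 4/3 * C" if h: "h \<in> alg" "\<And>j. adj (h j) = h j" "\<And>j. opn (h j) \<le> C" for h
  proof -
    have "cmod (\<phi> (\<lambda>j. cscale (of_real (3 / (4 * C))) (h j))) \<le> 1"
    proof (rule phi_hermitian_bound)
      fix j
      have "3 / (4 * C) * opn (h j) \<le> 3 / (4 * C) * C" using True h by (intro mult_left_mono) auto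
      then show "opn (cscale (of_real (3 / (4 * C))) (h j)) \<le> 3/4" using True by (simp add: norm_divide norm_mult)
    qed (use h in \<open>simp_all add: alg_cscale\<close>)
    then show ?thesis using True by (simp add: phi_cscale[OF h(1)] norm_mult norm_divide field_simps)
  qed
  let ?h = "\<lambda>j. cscale (1/2) (a j + adj (a j))" and ?k = "\<lambda>j. cscale (- \<i>/2) (a j - adj (a j))"
  have hk: "?h \<in> alg" "?k \<in> alg"
    by (simp_all add: alg_cscale alg_add alg_diff alg_adj a)
  have "cmod (\<phi> ?h) \<le> 4/3 * C"
  proof (rule herm[OF hk(1)])
    fix j
    show "adj (cscale (1/2) (a j + adj (a j))) = cscale (1/2) (a j + adj (a j))" by (simp add: add.commute)
    show "opn (cscale (1/2) (a j + adj (a j))) \<le> C"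
      using opn_triangle[of "a j" "adj (a j)"] a(2)[of j] by (simp add: norm_divide)
  qed
  moreover have "cmod (\<phi> ?k) \<le> 4/3 * C"
  proof (rule herm[OF hk(2)])
    fix j
    show "adj (cscale (- \<i>/2) (a j - adj (a j))) = cscale (- \<i>/2) (a j - adj (a j))"
      by (rule fmat_eqI) (simp add: algebra_simps)
    show "opn (cscale (- \<i>/2) (a j - adj (a j))) \<le> C"
      using opn_diff[of "a j" "adj (a j)"] a(2)[of j] by (simp add: norm_divide)
  qed
  moreover have "a = (\<lambda>j. ?h j + cscale \<i> (?k j))"
    by (intro ext fmat_eqI) (simp add: field_simps)
  then have "\<phi> a = \<phi> ?h + \<i> * \<phi> ?k"
    using phi_add[OF hk(1) alg_cscale[OF hk(2)], of \<i>] phi_cscale[OF hk(2), of \<i>] by simp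
  then have "cmod (\<phi> a) \<le> cmod (\<phi> ?h) + cmod (\<phi> ?k)"
    using norm_triangle_ineq[of "\<phi> ?h" "\<i> * \<phi> ?k"] by (simp add: norm_mult)
  ultimately show ?thesis using True by simp
qed

definition weight :: "nat \<Rightarrow> real" where "weight j = Re (\<phi> (block j (idn (k j))))"

lemma phi_block_commute:
  "x \<in> corner (k j) \<Longrightarrow> y \<in> corner (k j) \<Longrightarrow> \<phi> (block j (x * y)) = \<phi> (block j (y * x))"
  using phi_commute[of "block j x" "block j y"] by (simp add: alg_block block_mult)

lemma phi_block_projection:
  assumes "x \<in> corner (k j)" "adj x = x" "x * x = x" shows "0 \<le> \<phi> (block j x)"
proof -
  have "(\<lambda>i. adj (block j x i) * block j x i) = block j x" using assms by (auto simp: block_def)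
  then show ?thesis using phi_pos[OF alg_block[OF assms(1)]] by simp
qed

lemma weight_nonneg: "0 \<le> weight j"
  and phi_block_one: "\<phi> (block j (idn (k j))) = of_real (weight j)"
  using phi_block_projection[of "idn (k j)" j]
  by (auto simp: weight_def idn_mult_idn less_eq_complex_def complex_eq_iff)

text \<open>The trace on a full matrix algebra is unique up to a factor.\<close>

lemma phi_block:
  assumes x: "x \<in> corner (k j)"
  shows "\<phi> (block j x) = of_real (weight j) * (tr x / of_nat (k j))"
proof -
  have off: "\<phi> (block j (munit a b)) = 0" if "a \<noteq> b" "a < k j" "b < k j" for a b
  proof -
    have "\<phi> (block j (munit a a * munit a b)) = \<phi> (block j (munit a b * munit a a))"
      by (rule phi_block_commute) (use that in auto)
    moreover have "block j 0 = (\<lambda>j. 0)" by (auto simp: block_def)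
    ultimately show ?thesis using that by (simp add: munit_mult phi_zero)
  qed
  define c where "c = \<phi> (block j (munit 0 0))"
  have dia: "\<phi> (block j (munit a a)) = c" if "a < k j" for a
    using phi_block_commute[of "munit a 0" j "munit 0 a"] that k_pos[of j] by (simp add: munit_mult c_def)
  have gen: "\<phi> (block j y) = tr y * c" if y: "y \<in> corner (k j)" for y
  proof -
    have "\<phi> (block j y) = \<phi> (\<lambda>i. \<Sum>a<k j. \<Sum>b<k j. cscale (ent y a b) (block j (munit a b) i))"
      using corner_expand[OF y] by (intro arg_cong[of _ _ \<phi>]) (auto simp: block_def cscale_simps)
    also have "\<dots> = (\<Sum>a<k j. \<phi> (\<lambda>i. \<Sum>b<k j. cscale (ent y a b) (block j (munit a b) i)))"
      by (rule phi_sum) (auto intro!: alg_sum alg_cscale alg_block)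
    also have "\<dots> = (\<Sum>a<k j. \<Sum>b<k j. \<phi> (\<lambda>i. cscale (ent y a b) (block j (munit a b) i)))"
      by (intro sum.cong refl phi_sum) (auto intro!: alg_cscale alg_block)
    also have "\<dots> = (\<Sum>a<k j. \<Sum>b<k j. if b = a then ent y a a * c else 0)"
      by (intro sum.cong refl) (auto simp: phi_cscale alg_block off dia)
    also have "\<dots> = tr y * c" using y by (simp add: tr_eq[of _ "k j"] sum_distrib_right)
    finally show ?thesis .
  qed
  have "of_real (weight j) = of_nat (k j) * c" using gen[of "idn (k j)"] phi_block_one by simp
  then show ?thesis using gen[OF x] k_pos[of j] by (simp add: field_simps)
qed

lemma phi_head:
  assumes "\<And>j. a j \<in> corner (k j)"
  shows "\<phi> (head N a) = (\<Sum>j<N. of_real (weight j) * ntr k a j)"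
proof -
  have "\<phi> (head N a) = (\<Sum>m<N. \<phi> (block m (a m)))"
    unfolding head_sum[abs_def] by (rule phi_sum) (simp add: alg_block assms)
  then show ?thesis by (simp add: phi_block assms ntr_def)
qed

lemma weight_sum: "(\<Sum>j<N. weight j) \<le> 1"
proof -
  let ?one = "\<lambda>j. idn (k j)"
  let ?t = "\<lambda>j. ?one j - head N ?one j"
  have h: "head N ?one \<in> alg" by (rule alg_head) simp
  have "?t = (\<lambda>j. adj (?t j) * ?t j)" by (auto simp: head_def idn_mult_idn)
  then have "0 \<le> \<phi> ?t" using phi_pos[OF alg_diff[OF alg_one h]] by simp
  also have "\<phi> ?t = 1 - (\<Sum>j<N. of_real (weight j) * ntr k ?one j)"
    using phi_diff[OF alg_one h] phi_one phi_head[of ?one] by simp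
  also have "\<dots> = of_real (1 - (\<Sum>j<N. weight j))"
    by (simp add: ntr_def k_nonzero)
  finally show ?thesis by (simp add: less_eq_complex_def)
qed

text \<open>Modulo commutators \<open>d\<close> is the sequence of scalars \<open>tr(d j)\<close>. Subtracting the constant \<open>L\<close> leaves scalars that
  tend to zero, and such a sequence is the norm limit of its initial segments, on which the
  functional is given by the weights.\<close>

lemma phi_formula:
  assumes d: "d \<in> D" and L: "ntr k d \<longlonglongrightarrow> L"
  shows "(\<lambda>N. \<Sum>j<N. of_real (weight j) * (ntr k d j - L)) \<longlonglongrightarrow> \<phi> d - L"
proof -
  let ?one = "\<lambda>j. idn (k j)"
  let ?c = "\<lambda>j. cscale (ntr k d j) (idn (k j))" and ?t = "\<lambda>j. cscale (ntr k d j - L) (idn (k j))"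
  have dA: "d \<in> alg" by (rule D_alg[OF d])
  obtain x v y w where xv: "x \<in> alg" "v \<in> alg" "y \<in> alg" "w \<in> alg" and split: "commutator_split k d x v y w"
    using D_comm[OF d] D_alg by blast
  let ?z = "\<lambda>j. (x j * v j - v j * x j) + (y j * w j - w j * y j)"
  note comm = alg_diff[OF alg_mult[OF xv(1,2)] alg_mult[OF xv(2,1)]] alg_diff[OF alg_mult[OF xv(3,4)] alg_mult[OF xv(4,3)]]
  have zA: "?z \<in> alg" by (rule alg_add[OF comm])
  have "\<phi> ?z = 0"
    using phi_add[OF comm] phi_diff[OF alg_mult[OF xv(1,2)] alg_mult[OF xv(2,1)]]
      phi_diff[OF alg_mult[OF xv(3,4)] alg_mult[OF xv(4,3)]] phi_commute[OF xv(1,2)] phi_commute[OF xv(3,4)] by simp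
  have t: "?t = (\<lambda>j. (d j - ?z j) - cscale L (idn (k j)))"
    using split by (auto simp: commutator_split_def cscale_simps algebra_simps)
  have tA: "?t \<in> alg"
    unfolding t by (rule alg_diff[OF alg_diff[OF dA zA] alg_cscale[OF alg_one]])
  have phit: "\<phi> ?t = \<phi> d - L"
    unfolding t using phi_diff[OF alg_diff[OF dA zA] alg_cscale[OF alg_one]] phi_diff[OF dA zA] \<open>\<phi> ?z = 0\<close>
      phi_cscale[OF alg_one] phi_one by simp
  have hA: "head N ?t \<in> alg" for N by (rule alg_head) simp
  have ph: "\<phi> (head N ?t) = (\<Sum>j<N. of_real (weight j) * (ntr k d j - L))" for N
    using phi_head[of ?t N] by (simp add: ntr_def k_nonzero)
  have "(\<lambda>N. \<phi> (head N ?t)) \<longlonglongrightarrow> \<phi> ?t"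
  proof (rule LIMSEQ_I)
    fix e :: real assume "e > 0"
    then obtain N0 where N0: "\<And>j. j \<ge> N0 \<Longrightarrow> cmod (ntr k d j - L) < e/4"
      using LIMSEQ_D[OF L, of "e/4"] by auto
    have "norm (\<phi> (head N ?t) - \<phi> ?t) < e" if N: "N \<ge> N0" for N
    proof -
      have "cmod (\<phi> (\<lambda>j. head N ?t j - ?t j)) \<le> 3 * (e/4)"
      proof (rule phi_bound[OF alg_diff[OF hA tA]])
        fix j
        have "cmod (ntr k d j - L) * opn (idn (k j)) \<le> e/4 * 1" if "N \<le> j"
          using N0[of j] N that opn_idn_le \<open>e > 0\<close> by (intro mult_mono) auto
        then show "opn (head N ?t j - ?t j) \<le> e/4" using \<open>e > 0\<close> by (auto simp: head_def)
      qed
      then show ?thesis using phi_diff[OF hA tA] \<open>e > 0\<close> by simp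
    qed
    then show "\<exists>N0. \<forall>N\<ge>N0. norm (\<phi> (head N ?t) - \<phi> ?t) < e" by blast
  qed
  then show ?thesis by (simp only: ph phit)
qed

end

text \<open>The functional and the traces of the approximating representations are given by the same formula on
  \<open>D\<close>, up to the rounding handled by \<open>weight_rounding\<close>. Uniform boundedness extends the convergence to the
  closure.\<close>

theorem tracial_approximation:
  assumes \<phi>: "tracial \<phi>"
  shows "\<exists>\<rho>. (\<forall>n\<ge>1. hom n (\<rho> n)) \<and> (\<forall>a\<in>alg. (\<lambda>n. tr (\<rho> n a) / of_nat n) \<longlonglongrightarrow> \<phi> a)"
proof (rule weight_rounding[of k "weight \<phi>", OF k_pos k_0 weight_nonneg[OF \<phi>] weight_sum[OF \<phi>]])
  fix J :: "nat \<Rightarrow> nat" and m :: "nat \<Rightarrow> nat \<Rightarrow> nat"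
  assume Jm: "\<And>n. n \<ge> 1 \<Longrightarrow> (\<Sum>j\<le>J n. m n j * k j) = n"
    and lim: "\<And>(x :: nat \<Rightarrow> complex) C L l. (\<And>j. cmod (x j) \<le> C) \<Longrightarrow> x \<longlonglongrightarrow> L \<Longrightarrow>
       (\<lambda>N. \<Sum>j<N. weight \<phi> j * (x j - L)) \<longlonglongrightarrow> l - L \<Longrightarrow>
       (\<lambda>n. (\<Sum>j\<le>J n. of_nat (m n j * k j) * x j) / of_nat n) \<longlonglongrightarrow> l"
  have "\<forall>n. \<exists>h. hom (\<Sum>j\<le>J n. m n j * k j) h \<and> (\<forall>a\<in>alg. tr (h a) = (\<Sum>j\<le>J n. of_nat (m n j) * tr (a j)))"
    using hom_combination by blast
  from choice[OF this] obtain \<rho> where \<rho>: "\<And>n. hom (\<Sum>j\<le>J n. m n j * k j) (\<rho> n)"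
    "\<And>n a. a \<in> alg \<Longrightarrow> tr (\<rho> n a) = (\<Sum>j\<le>J n. of_nat (m n j) * tr (a j))" by blast
  have tr: "tr (\<rho> n a) = (\<Sum>j\<le>J n. of_nat (m n j * k j) * ntr k a j)" if "a \<in> alg" for n a
    by (simp add: \<rho>(2)[OF that] ntr_def k_nonzero)
  have small: "cmod (tr (\<rho> n a) / of_nat n) \<le> C" if a: "a \<in> alg" "\<And>j. opn (a j) \<le> C" and n: "n \<ge> 1" for a n C
  proof -
    have "cmod (tr (\<rho> n a)) \<le> (\<Sum>j\<le>J n. real (m n j * k j) * C)"
      unfolding tr[OF a(1)]
    proof (rule order_trans[OF norm_sum], rule sum_mono)
      fix j
      have "cmod (ntr k a j) \<le> C" using ntr_bound[of a j k, OF alg_corner[OF a(1)] k_pos] a(2)[of j] by simp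
      then show "cmod (of_nat (m n j * k j) * ntr k a j) \<le> real (m n j * k j) * C"
        unfolding norm_mult norm_of_nat by (rule mult_left_mono) simp
    qed
    also have "\<dots> = real (\<Sum>j\<le>J n. m n j * k j) * C" by (simp add: sum_distrib_right)
    also have "\<dots> = n * C" by (simp only: Jm[OF n])
    finally show ?thesis using n by (simp add: norm_divide divide_le_eq mult.commute)
  qed
  have onD: "(\<lambda>n. tr (\<rho> n d) / of_nat n) \<longlonglongrightarrow> \<phi> d" if d: "d \<in> D" for d
  proof -
    obtain C where C: "\<And>j. opn (d j) \<le> C" using alg_bound[OF D_alg[OF d]] by auto
    obtain L where L: "ntr k d \<longlonglongrightarrow> L" using D_conv[OF d] by (auto simp: convergent_def)
    have "cmod (ntr k d j) \<le> C" for j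
      using ntr_bound[of d j k, OF alg_corner[OF D_alg[OF d]] k_pos] C[of j] by simp
    from lim[OF this L phi_formula[OF \<phi> d L]] show ?thesis by (simp only: tr[OF D_alg[OF d]])
  qed
  have "(\<lambda>n. tr (\<rho> n a) / of_nat n) \<longlonglongrightarrow> \<phi> a" if a: "a \<in> alg" for a
  proof (rule LIMSEQ_I)
    fix e :: real assume e: "e > 0"
    obtain d where d: "d \<in> D" "\<And>j. opn (a j - d j) \<le> e/8" using alg_approx[OF a, of "e/8"] e by auto
    have adA: "(\<lambda>j. a j - d j) \<in> alg" by (rule alg_diff[OF a D_alg[OF d(1)]])
    obtain N where N: "\<And>n. n \<ge> N \<Longrightarrow> cmod (tr (\<rho> n d) / of_nat n - \<phi> d) < e/4"
      using LIMSEQ_D[OF onD[OF d(1)], of "e/4"] e by auto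
    have "norm (tr (\<rho> n a) / of_nat n - \<phi> a) < e" if n: "n \<ge> max N 1" for n
    proof -
      have "tr (\<rho> n (\<lambda>j. a j - d j)) = tr (\<rho> n a) - tr (\<rho> n d)"
        by (simp add: \<rho>(2) adA a D_alg[OF d(1)] right_diff_distrib sum_subtractf)
      then have "tr (\<rho> n a) / of_nat n - \<phi> a =
          tr (\<rho> n (\<lambda>j. a j - d j)) / of_nat n + (tr (\<rho> n d) / of_nat n - \<phi> d) - \<phi> (\<lambda>j. a j - d j)"
        using phi_diff[OF \<phi> a D_alg[OF d(1)]] by (simp add: diff_divide_distrib)
      also have "cmod \<dots> \<le> cmod (tr (\<rho> n (\<lambda>j. a j - d j)) / of_nat n) + cmod (tr (\<rho> n d) / of_nat n - \<phi> d)
          + cmod (\<phi> (\<lambda>j. a j - d j))"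
        by (rule order_trans[OF norm_triangle_ineq4]) (simp add: norm_triangle_ineq)
      also have "\<dots> < e/8 + e/4 + 3 * (e/8) + e/8"
        using small[OF adA d(2), of n] N[of n] phi_bound[OF \<phi> adA d(2)] n e by simp
      finally show ?thesis using e by simp
    qed
    then show "\<exists>N. \<forall>n\<ge>N. norm (tr (\<rho> n a) / of_nat n - \<phi> a) < e" by blast
  qed
  moreover have "hom n (\<rho> n)" if "n \<ge> 1" for n using \<rho>(1)[of n] by (simp only: Jm[OF that])
  ultimately show ?thesis by blast
qed

end

section \<open>Compressions are far from representations\<close>

lemma opn_projection_le:
  assumes "adj q = q" "q * q = q" shows "opn q \<le> 1"
proof (cases "opn q = 0")
  case False
  have "(opn q)\<^sup>2 = opn (adj q * q)" by (rule opn_cstar[symmetric])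
  also have "adj q * q = q" by (simp only: assms)
  finally show ?thesis using False by (simp add: power2_eq_square)
qed simp

context tower
begin

context
  fixes n \<theta> assumes hom: "hom n \<theta>" and n: "n \<ge> 1"
begin

lemma th_one: "\<theta> (\<lambda>j. idn (k j)) = idn n"
  and th_corner: "a \<in> alg \<Longrightarrow> \<theta> a \<in> corner n"
  and th_add: "a \<in> alg \<Longrightarrow> b \<in> alg \<Longrightarrow> \<theta> (\<lambda>j. a j + b j) = \<theta> a + \<theta> b"
  and th_mult: "a \<in> alg \<Longrightarrow> b \<in> alg \<Longrightarrow> \<theta> (\<lambda>j. a j * b j) = \<theta> a * \<theta> b"
  and th_cscale: "a \<in> alg \<Longrightarrow> \<theta> (\<lambda>j. cscale c (a j)) = cscale c (\<theta> a)"
  and th_adj: "a \<in> alg \<Longrightarrow> \<theta> (\<lambda>j. adj (a j)) = adj (\<theta> a)"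
  using hom unfolding hom_def by blast+

lemma th_zero: "\<theta> (\<lambda>j. 0) = 0"
  using th_cscale[OF alg_one, of 0] by (simp add: cscale_simps)

lemma th_diff:
  assumes "a \<in> alg" "b \<in> alg" shows "\<theta> (\<lambda>j. a j - b j) = \<theta> a - \<theta> b"
  using th_add[OF assms(1) alg_cscale[OF assms(2), of "-1"]] th_cscale[OF assms(2), of "-1"]
  by (simp add: cscale_simps)

lemma th_sum: "(\<And>i. i \<in> I \<Longrightarrow> f i \<in> alg) \<Longrightarrow> \<theta> (\<lambda>j. \<Sum>i\<in>I. f i j) = (\<Sum>i\<in>I. \<theta> (f i))"
proof (induction I rule: infinite_finite_induct)
  case (insert x F)
  then show ?case using th_add[of "f x" "\<lambda>j. \<Sum>i\<in>F. f i j"] by (simp add: alg_sum)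
qed (simp_all add: th_zero)

definition mu :: "nat \<Rightarrow> nat \<Rightarrow> nat \<Rightarrow> fmat" where "mu j a b = \<theta> (block j (munit a b))"

lemma block_munit_alg [simp]: "a < k j \<Longrightarrow> b < k j \<Longrightarrow> block j (munit a b) \<in> alg"
  by (rule alg_block) simp

lemma mu_corner: "a < k j \<Longrightarrow> b < k j \<Longrightarrow> mu j a b \<in> corner n"
  by (simp add: mu_def th_corner)

lemma mu_adj: "a < k j \<Longrightarrow> b < k j \<Longrightarrow> adj (mu j a b) = mu j b a"
proof -
  assume ab: "a < k j" "b < k j"
  have "(\<lambda>i. adj (block j (munit a b) i)) = block j (munit b a)" by (auto simp: block_def)
  then show ?thesis using th_adj[of "block j (munit a b)"] ab by (simp add: mu_def)
qed

lemma mu_mult: "a < k j \<Longrightarrow> b < k j \<Longrightarrow> c < k j \<Longrightarrow> d < k j \<Longrightarrow>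
  mu j a b * mu j c d = (if b = c then mu j a d else 0)"
proof -
  assume ab: "a < k j" "b < k j" "c < k j" "d < k j"
  have "mu j a b * mu j c d = \<theta> (block j (munit a b * munit c d))"
    using th_mult[of "block j (munit a b)" "block j (munit c d)"] ab by (simp add: mu_def block_mult)
  moreover have "block j 0 = (\<lambda>j. 0)" by (auto simp: block_def)
  ultimately show ?thesis by (simp add: munit_mult th_zero mu_def)
qed

lemma th_block_expand:
  assumes "x \<in> corner (k j)"
  shows "\<theta> (block j x) = (\<Sum>a<k j. \<Sum>b<k j. cscale (ent x a b) (mu j a b))"
proof -
  have "\<theta> (block j x) = \<theta> (\<lambda>i. \<Sum>a<k j. \<Sum>b<k j. cscale (ent x a b) (block j (munit a b) i))"
    using corner_expand[OF assms] by (intro arg_cong[of _ _ \<theta>]) (auto simp: block_def cscale_simps)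
  also have "\<dots> = (\<Sum>a<k j. \<theta> (\<lambda>i. \<Sum>b<k j. cscale (ent x a b) (block j (munit a b) i)))"
    by (rule th_sum) (auto intro!: alg_sum alg_cscale alg_block)
  also have "\<dots> = (\<Sum>a<k j. \<Sum>b<k j. \<theta> (\<lambda>i. cscale (ent x a b) (block j (munit a b) i)))"
    by (intro sum.cong refl th_sum) (auto intro!: alg_cscale alg_block)
  finally show ?thesis by (simp add: th_cscale mu_def)
qed

lemma th_block_one: "\<theta> (block j (idn (k j))) = (\<Sum>a<k j. mu j a a)"
proof -
  have "block j (idn (k j)) = (\<lambda>i. \<Sum>a<k j. block j (munit a a) i)"
    using idn_expand[of "k j"] by (auto simp: block_def)
  then show ?thesis using th_sum[of "{..<k j}" "\<lambda>a. block j (munit a a)"] by (simp add: mu_def)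
qed

lemma th_projection:
  assumes "q \<in> alg" "\<And>j. adj (q j) = q j" "\<And>j. q j * q j = q j"
  shows "adj (\<theta> q) = \<theta> q" "\<theta> q * \<theta> q = \<theta> q"
  using th_adj[OF assms(1), symmetric] th_mult[OF assms(1,1), symmetric] by (simp_all only: assms(2,3))

text \<open>The block of size \<open>k j\<close> is simple, so if it is not killed all its \<open>k j\<close> diagonal matrix units go to nonzero
  orthogonal projections, for which the corner of size \<open>n\<close> has no room.\<close>

lemma th_block_zero:
  assumes "n < k j" shows "\<theta> (block j (idn (k j))) = 0"
proof (rule ccontr)
  let ?E = "\<theta> (block j (idn (k j)))"
  assume E: "?E \<noteq> 0"
  have EA: "block j (idn (k j)) \<in> alg" by (simp add: alg_block)
  have Ep: "adj ?E = ?E" "?E * ?E = ?E"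
    by (rule th_projection[OF EA]; simp add: block_def idn_mult_idn)+
  have "\<not> (\<forall>a<k j. mu j a a = 0)" using E unfolding th_block_one by (auto intro: sum.neutral)
  then obtain a where a: "a < k j" "mu j a a \<noteq> 0" by blast
  have "1 \<le> Re (tr (mu j b b))" if b: "b < k j" for b
  proof -
    have p: "adj (mu j b b) = mu j b b" "mu j b b * mu j b b = mu j b b"
      using b by (simp_all add: mu_adj mu_mult)
    have "mu j a a = mu j a b * mu j b b * mu j b a" using a b by (simp add: mu_mult)
    then have "mu j b b \<noteq> 0" using a by auto
    then have "1 \<le> norm (mu j b b)" using projection_tr(2)[OF p] by blast
    then show ?thesis using projection_tr(1)[OF p] by (simp add: one_le_power)
  qed
  then have "real (\<Sum>b<k j. 1) \<le> (\<Sum>b<k j. Re (tr (mu j b b)))"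
    unfolding of_nat_sum by (intro sum_mono) auto
  then have "real (k j) \<le> Re (tr ?E)" by (simp add: th_block_one Re_sum)
  moreover have "Re (tr ?E) \<le> n"
  proof -
    have c: "?E \<in> corner n" by (rule th_corner[OF EA])
    have "adj (idn n - ?E) = idn n - ?E" "(idn n - ?E) * (idn n - ?E) = idn n - ?E"
      by (simp_all add: Ep left_diff_distrib right_diff_distrib idn_mult_idn idn_mult_left[OF c] idn_mult_right[OF c])
    from projection_tr(1)[OF this] have "0 \<le> Re (tr (idn n - ?E))" by simp
    then show ?thesis by simp
  qed
  ultimately show False using assms by simp
qed

lemma th_tracial: "tracial (\<lambda>a. tr (\<theta> a) / of_nat n)"
  unfolding tracial_def
proof (intro conjI ballI allI)
  fix a b c assume a: "a \<in> alg"
  show "tr (\<theta> (\<lambda>j. cscale c (a j))) / of_nat n = c * (tr (\<theta> a) / of_nat n)" by (simp add: th_cscale a)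
  have "tr (\<theta> (\<lambda>j. adj (a j) * a j)) = of_real ((norm (\<theta> a))\<^sup>2)"
    by (simp add: th_mult th_adj a alg_adj tr_adj_self_norm)
  then show "0 \<le> tr (\<theta> (\<lambda>j. adj (a j) * a j)) / of_nat n"
    by (simp add: less_eq_complex_def Re_divide_of_nat Im_divide_of_nat)
  assume b: "b \<in> alg"
  show "tr (\<theta> (\<lambda>j. a j + b j)) / of_nat n = tr (\<theta> a) / of_nat n + tr (\<theta> b) / of_nat n"
    by (simp add: th_add a b add_divide_distrib)
  show "tr (\<theta> (\<lambda>j. a j * b j)) / of_nat n = tr (\<theta> (\<lambda>j. b j * a j)) / of_nat n"
    by (simp add: th_mult a b tr_commute[of "\<theta> a"])
qed (use n in \<open>simp add: th_one\<close>)

text \<open>Let \<open>P\<close> be the complement of the images of the blocks below \<open>i\<close>. By \<open>phi_formula\<close> for the trace of the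
  representation, the part under \<open>P\<close> of the image of the projection \<open>q\<close> has trace \<open>tr P / (n + 1)\<close>, which is less than one. A projection
  of trace less than one vanishes, hence so does \<open>P\<close>.\<close>

lemma th_blocks_exhaust:
  assumes i: "\<And>j. j \<ge> i \<Longrightarrow> n < k j"
  shows "(\<Sum>j<i. \<theta> (block j (idn (k j)))) = idn n"
proof -
  let ?one = "\<lambda>j. idn (k j)"
  define \<phi> where "\<phi> a = tr (\<theta> a) / of_nat n" for a
  have tracial: "tracial \<phi>" unfolding \<phi>_def by (rule th_tracial)
  have hoA: "head i ?one \<in> alg" by (rule alg_head) simp
  define P where "P = idn n - \<theta> (head i ?one)"
  obtain q where q: "q \<in> D" "\<And>j. adj (q j) = q j" "\<And>j. q j * q j = q j"
    and L: "ntr k q \<longlonglongrightarrow> of_real (1 / Suc n)"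
    using D_proj[of n] by auto
  have qA: "q \<in> alg" by (rule D_alg[OF q(1)])
  have hqA: "head i q \<in> alg" by (rule alg_head) (rule alg_corner[OF qA])
  have w0: "weight \<phi> j = 0" if "i \<le> j" for j
    using th_block_zero[OF i[OF that]] by (simp add: weight_def[OF tracial] \<phi>_def)
  have wi: "(\<Sum>j<N. of_real (weight \<phi> j) * c j) = (\<Sum>j<i. of_real (weight \<phi> j) * c j :: complex)" if "N \<ge> i" for N c
    by (rule sum.mono_neutral_right) (use that w0 in auto)
  let ?L = "complex_of_real (1 / Suc n)"
  have "(\<lambda>N. \<Sum>j<N. of_real (weight \<phi> j) * (ntr k q j - ?L)) \<longlonglongrightarrow> (\<Sum>j<i. of_real (weight \<phi> j) * (ntr k q j - ?L))"
  proof (rule tendsto_eventually)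
    show "\<forall>\<^sub>F N in sequentially. (\<Sum>j<N. of_real (weight \<phi> j) * (ntr k q j - ?L)) = (\<Sum>j<i. of_real (weight \<phi> j) * (ntr k q j - ?L))"
      unfolding eventually_sequentially by (intro exI[of _ i] allI impI wi)
  qed
  from LIMSEQ_unique[OF phi_formula[OF tracial q(1) L] this]
  have "\<phi> q - ?L = (\<Sum>j<i. of_real (weight \<phi> j) * (ntr k q j - ?L))" .
  also have "\<dots> = (\<Sum>j<i. of_real (weight \<phi> j) * ntr k q j) - ?L * (\<Sum>j<i. of_real (weight \<phi> j) * ntr k ?one j)"
    by (simp add: ntr_def k_nonzero right_diff_distrib sum_subtractf sum_distrib_left mult.commute)
  also have "\<dots> = \<phi> (head i q) - ?L * \<phi> (head i ?one)"
    using phi_head[OF tracial, of q i] phi_head[OF tracial, of ?one i] alg_corner[OF qA] by simp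
  finally have "\<phi> q - \<phi> (head i q) = ?L * (1 - \<phi> (head i ?one))" by (simp add: algebra_simps)
  moreover have "\<phi> ?one = 1" using phi_one[OF tracial] .
  ultimately have tq0: "tr (\<theta> q) / of_nat n - tr (\<theta> (head i q)) / of_nat n = ?L * (1 - tr (\<theta> (head i ?one)) / of_nat n)"
    by (simp add: \<phi>_def)
  have clear: "a - b = l * (m - c)" if "a / m - b / m = l * (1 - c / m)" "m \<noteq> 0" for a b c l m :: complex
  proof -
    have "a - b = m * (a / m - b / m)" using that(2) by (simp add: right_diff_distrib)
    also have "\<dots> = l * (m * (1 - c / m))" by (simp only: that(1) mult.left_commute)
    also have "m * (1 - c / m) = m - c" using that(2) by (simp add: right_diff_distrib)
    finally show ?thesis .
  qed
  have tq: "tr (\<theta> q - \<theta> (head i q)) = ?L * tr P"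
    unfolding P_def tr_simps tr_idn by (rule clear[OF tq0]) (use n in simp)
  let ?q' = "\<lambda>j. q j - head i q j"
  have q'A: "?q' \<in> alg" by (rule alg_diff[OF qA hqA])
  have qp: "adj (\<theta> ?q') = \<theta> ?q'" "\<theta> ?q' * \<theta> ?q' = \<theta> ?q'"
    by (rule th_projection[OF q'A]; simp add: head_def q)+
  have PA: "(\<lambda>j. idn (k j) - head i ?one j) \<in> alg" by (rule alg_diff[OF alg_one hoA])
  have P: "P = \<theta> (\<lambda>j. idn (k j) - head i ?one j)" by (simp add: P_def th_diff alg_one hoA th_one)
  have Pp: "adj P = P" "P * P = P"
    unfolding P by (rule th_projection[OF PA]; simp add: head_def idn_mult_idn)+
  have "adj (idn n - P) = idn n - P" "(idn n - P) * (idn n - P) = idn n - P"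
    using th_corner[OF PA] by (simp_all add: Pp left_diff_distrib right_diff_distrib idn_mult_idn
      idn_mult_left[of P n] idn_mult_right[of P n] P[symmetric])
  from projection_tr(1)[OF this] have "0 \<le> Re (tr (idn n - P))" by simp
  then have "Re (tr P) \<le> n" by simp
  then have Pn: "(norm P)\<^sup>2 \<le> n" using projection_tr(1)[OF Pp] by simp
  have "complex_of_real ((norm (\<theta> ?q'))\<^sup>2) = of_real ((norm P)\<^sup>2 / Suc n)"
    using tq projection_tr(1)[OF qp] projection_tr(1)[OF Pp] by (simp add: th_diff qA hqA)
  then have nq: "(norm (\<theta> ?q'))\<^sup>2 = (norm P)\<^sup>2 / Suc n" by (simp only: of_real_eq_iff)
  have "norm (\<theta> ?q') < 1"
  proof (rule power2_less_imp_less)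
    have "(norm P)\<^sup>2 / Suc n < 1" using Pn by simp
    then show "(norm (\<theta> ?q'))\<^sup>2 < 1\<^sup>2" using nq by simp
  qed simp
  then have "\<theta> ?q' = 0" using projection_tr(2)[OF qp] by linarith
  then have "P = 0" using nq by simp
  moreover have "\<theta> (head i ?one) = (\<Sum>j<i. \<theta> (block j (idn (k j))))"
    unfolding head_sum[abs_def] by (rule th_sum) (simp add: alg_block)
  ultimately show ?thesis by (simp add: P_def)
qed

definition commuting_projection :: "fmat \<Rightarrow> nat \<Rightarrow> bool" where
  "commuting_projection Q T \<longleftrightarrow> Q \<in> corner n \<and> adj Q = Q \<and> Q * Q = Q \<and> tr Q = of_nat T \<and>
     (\<forall>a\<in>alg. Q * \<theta> a = \<theta> a * Q)"

lemma mu_left: "x \<in> alg \<Longrightarrow> a < k j \<Longrightarrow> b < k j \<Longrightarrow> \<theta> x * mu j b a = (\<Sum>c<k j. cscale (ent (x j) c b) (mu j c a))"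
proof -
  assume x: "x \<in> alg" and ab: "a < k j" "b < k j"
  have "(\<lambda>i. x i * block j (munit b a) i) = block j (x j * munit b a)" by (auto simp: block_def)
  then have "\<theta> x * mu j b a = \<theta> (block j (x j * munit b a))"
    using th_mult[OF x block_munit_alg[OF ab(2,1)]] by (simp add: mu_def)
  also have "\<dots> = (\<Sum>c<k j. \<Sum>d<k j. cscale (ent (x j * munit b a) c d) (mu j c d))"
    by (rule th_block_expand) (simp add: alg_corner x ab)
  also have "\<dots> = (\<Sum>c<k j. \<Sum>d<k j. if d = a then cscale (ent (x j) c b) (mu j c a) else 0)"
    by (intro sum.cong refl) (auto simp: ent_mult_munit cscale_simps)
  finally show ?thesis using ab by simp
qed

lemma mu_right: "x \<in> alg \<Longrightarrow> a < k j \<Longrightarrow> b < k j \<Longrightarrow> mu j a b * \<theta> x = (\<Sum>c<k j. cscale (ent (x j) b c) (mu j a c))"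
proof -
  assume x: "x \<in> alg" and ab: "a < k j" "b < k j"
  have "mu j a b * \<theta> x = adj (\<theta> (\<lambda>j. adj (x j)) * mu j b a)" by (simp add: th_adj x mu_adj ab)
  also have "\<dots> = (\<Sum>c<k j. cscale (ent (x j) b c) (mu j a c))"
    by (simp add: mu_left alg_adj x ab mu_adj)
  finally show ?thesis .
qed

text \<open>The image of some block \<open>j\<close> meets the complement of \<open>Q\<close>. A rank-one projection below the image of one
  diagonal matrix unit of this block and orthogonal to \<open>Q\<close>, moved around by the other matrix units, spans a
  subrepresentation of dimension \<open>k j\<close> orthogonal to \<open>Q\<close>.\<close>

lemma commuting_projection_step:
  assumes Q: "commuting_projection Q T" and T: "T < n" and ex: "(\<Sum>j<i. \<theta> (block j (idn (k j)))) = idn n"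
  shows "\<exists>Q' j. j < i \<and> commuting_projection Q' (T + k j)"
proof -
  have Qd: "Q \<in> corner n" "adj Q = Q" "Q * Q = Q" "tr Q = of_nat T" and Qth: "\<And>a. a \<in> alg \<Longrightarrow> Q * \<theta> a = \<theta> a * Q"
    using Q unfolding commuting_projection_def by blast+
  define R where "R = idn n - Q"
  have Rc: "R \<in> corner n" using Qd by (simp add: R_def)
  have R: "adj R = R" "R * R = R" "Q * R = 0" "R * Q = 0"
    using Qd by (simp_all add: R_def left_diff_distrib right_diff_distrib idn_mult_idn idn_mult_left[of _ n] idn_mult_right[of _ n])
  have "tr R = of_nat (n - T)" using Qd T by (simp add: R_def of_nat_diff)
  then have "R \<noteq> 0" using T by (metis diff_is_0_eq not_le of_nat_eq_0_iff tr_simps(4))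
  have Rsum: "R = (\<Sum>j<i. \<Sum>a<k j. mu j a a * R)"
    using arg_cong[OF ex, of "\<lambda>x. x * R"] Rc by (simp add: th_block_one sum_distrib_right idn_mult_left[of _ n])
  have "\<exists>j<i. \<exists>a<k j. mu j a a * R \<noteq> 0"
  proof (rule ccontr)
    assume "\<not> ?thesis"
    then have "(\<Sum>j<i. \<Sum>a<k j. mu j a a * R) = 0" by (intro sum.neutral ballI) auto
    with Rsum \<open>R \<noteq> 0\<close> show False by simp
  qed
  then obtain j a where j: "j < i" and a: "a < k j" and ne: "mu j a a * R \<noteq> 0" by blast
  let ?f = "mu j a a"
  define G where "G = ?f * R"
  have fQ: "mu j b c * Q = Q * mu j b c" if "b < k j" "c < k j" for b c
    unfolding mu_def by (rule Qth[symmetric]) (use that in simp)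
  have fR: "mu j b c * R = R * mu j b c" if "b < k j" "c < k j" for b c
    using fQ[OF that] mu_corner[OF that] by (simp add: R_def left_diff_distrib right_diff_distrib idn_mult_left[of _ n] idn_mult_right[of _ n])
  have ff: "?f * ?f = ?f" "adj ?f = ?f" using a by (simp_all add: mu_mult mu_adj)
  have Gc: "G \<in> corner n" using Rc a by (simp add: G_def mu_corner)
  have G: "adj G = G" "?f * G = G" "G * ?f = G" "R * G = G"
  proof -
    show "adj G = G" using fR[OF a a] by (simp add: G_def ff R)
    show "?f * G = G" by (simp add: G_def mult.assoc[symmetric] ff)
    have "G * ?f = ?f * (R * ?f)" by (simp add: G_def mult.assoc)
    also have "\<dots> = ?f * ?f * R" by (simp add: fR[OF a a, symmetric] mult.assoc)
    finally show "G * ?f = G" by (simp add: ff G_def)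
    have "R * G = R * ?f * R" by (simp add: G_def mult.assoc)
    also have "\<dots> = ?f * (R * R)" by (simp add: fR[OF a a, symmetric] mult.assoc)
    finally show "R * G = G" by (simp add: R G_def)
  qed
  have GG: "G * G = G"
  proof -
    have "G * G = ?f * (R * G)" by (simp add: G_def mult.assoc)
    then show ?thesis by (simp add: G)
  qed
  have "tr G \<noteq> 0" using projection_tr[OF G(1) GG] ne by (auto simp: G_def)
  then have "\<not> (\<forall>c<n. ent G c c = 0)" unfolding tr_eq[OF Gc] by (auto intro: sum.neutral)
  then obtain c where c: "ent G c c \<noteq> 0" by blast
  define l where "l = ent G c c"
  have l: "l \<noteq> 0" "cnj l = l" using c arg_cong[OF G(1), of "\<lambda>x. ent x c c"] by (simp_all add: l_def)
  let ?e = "munit c c"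
  have cn: "c < n" using c cornerD[OF Gc, of c c] by (auto simp: not_le[symmetric])
  have eGe: "?e * G * ?e = cscale l ?e"
    by (rule fmat_eqI) (simp add: ent_mult_munit ent_munit_mult ent_munit l_def)
  \<comment> \<open>The rank-one projection onto the image under \<open>G\<close> of a basis vector that \<open>G\<close> does not kill.\<close>
  define N where "N = cscale (1 / l) (G * ?e * G)"
  have N: "adj N = N" "?f * N = N" "N * ?f = N" "R * N = N" "N * N = N" "N \<in> corner n"
  proof -
    show "adj N = N" using l by (simp add: N_def G mult.assoc)
    show "?f * N = N" "R * N = N" by (simp_all add: N_def cscale_mult_right mult.assoc[symmetric] G)
    show "N * ?f = N" by (simp add: N_def cscale_mult_left mult.assoc G)
    have "G * ?e * G * (G * ?e * G) = G * (?e * (G * G) * ?e) * G" by (simp add: mult.assoc)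
    also have "\<dots> = cscale l (G * ?e * G)" by (simp add: GG eGe cscale_mult_left cscale_mult_right)
    finally show "N * N = N" using l by (simp add: N_def cscale_mult_left cscale_mult_right cscale_simps)
    show "N \<in> corner n" using Gc cn by (simp add: N_def)
  qed
  have "tr (?e * G) = l"
  proof -
    have "tr (?e * G) = tr (?e * ?e * G)" by (simp add: munit_mult)
    also have "\<dots> = tr (?e * G * ?e)" by (simp add: mult.assoc tr_commute[of ?e])
    finally show ?thesis by (simp add: eGe tr_munit)
  qed
  then have trN: "tr N = 1"
    using l tr_commute[of G "?e * G"] by (simp add: N_def mult.assoc GG)
  \<comment> \<open>The projection onto the subrepresentation generated by the range of \<open>N\<close>.\<close>
  define Q1 where "Q1 = (\<Sum>b<k j. mu j b a * N * mu j a b)"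
  have aQ1: "adj Q1 = Q1" unfolding Q1_def adj_sum
    by (rule sum.cong) (use a in \<open>simp_all add: mu_adj N mult.assoc\<close>)
  have QQ11: "Q1 * Q1 = Q1"
  proof -
    have "Q1 * Q1 = (\<Sum>b<k j. \<Sum>c<k j. mu j b a * N * mu j a b * (mu j c a * N * mu j a c))"
      by (simp add: Q1_def sum_product)
    also have "\<dots> = (\<Sum>b<k j. \<Sum>c<k j. if c = b then mu j b a * N * mu j a b else 0)"
    proof (intro sum.cong refl)
      fix b c assume bc: "b \<in> {..<k j}" "c \<in> {..<k j}"
      have "mu j b a * N * mu j a b * (mu j c a * N * mu j a c) = mu j b a * (N * (mu j a b * mu j c a) * N) * mu j a c"
        by (simp add: mult.assoc)
      also have "\<dots> = (if c = b then mu j b a * N * mu j a b else 0)"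
        using bc a by (auto simp: mu_mult N)
      finally show "mu j b a * N * mu j a b * (mu j c a * N * mu j a c) = (if c = b then mu j b a * N * mu j a b else 0)" .
    qed
    finally show ?thesis by (simp add: Q1_def)
  qed
  have QQ1: "Q * Q1 = 0"
  proof -
    have "Q * (mu j b a * N * mu j a b) = 0" if b: "b < k j" for b
    proof -
      have "Q * (mu j b a * N * mu j a b) = (Q * mu j b a) * (R * N) * mu j a b" by (simp add: N mult.assoc)
      also have "Q * mu j b a = mu j b a * Q" by (rule fQ[OF b a, symmetric])
      also have "mu j b a * Q * (R * N) * mu j a b = mu j b a * (Q * R) * N * mu j a b" by (simp only: mult.assoc)
      finally show ?thesis by (simp add: R)
    qed
    then show ?thesis by (simp add: Q1_def sum_distrib_left)
  qed
  have "adj (Q * Q1) = 0" by (simp only: QQ1 adj_simps)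
  then have Q1Q: "Q1 * Q = 0" by (simp only: adj_mult aQ1 Qd)
  have trQ1: "tr Q1 = of_nat (k j)"
  proof -
    have "tr (mu j b a * N * mu j a b) = 1" if b: "b < k j" for b
    proof -
      have "tr (mu j b a * N * mu j a b) = tr (N * (mu j a b * mu j b a))"
        using tr_commute[of "mu j b a" "N * mu j a b"] by (simp add: mult.assoc)
      then show ?thesis using a b by (simp add: mu_mult N trN)
    qed
    then show ?thesis by (simp add: Q1_def)
  qed
  have cQ1: "Q1 * \<theta> x = \<theta> x * Q1" if x: "x \<in> alg" for x
  proof -
    let ?g = "\<lambda>b c. cscale (ent (x j) b c) (mu j b a * N * mu j a c)"
    have left: "mu j b a * N * mu j a b * \<theta> x = (\<Sum>c<k j. ?g b c)" if "b < k j" for b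
    proof -
      have "mu j b a * N * mu j a b * \<theta> x = mu j b a * N * (mu j a b * \<theta> x)" by (simp only: mult.assoc)
      then show ?thesis using a that by (simp only: mu_right[OF x]) (simp add: sum_distrib_left cscale_mult_right)
    qed
    have right: "\<theta> x * (mu j c a * N * mu j a c) = (\<Sum>b<k j. ?g b c)" if "c < k j" for c
    proof -
      have "\<theta> x * (mu j c a * N * mu j a c) = (\<theta> x * mu j c a) * N * mu j a c" by (simp only: mult.assoc)
      then show ?thesis using a that by (simp only: mu_left[OF x]) (simp add: sum_distrib_right cscale_mult_left)
    qed
    have 1: "Q1 * \<theta> x = (\<Sum>b<k j. \<Sum>c<k j. ?g b c)"
      unfolding Q1_def sum_distrib_right by (rule sum.cong) (simp_all add: left)
    have 2: "\<theta> x * Q1 = (\<Sum>c<k j. \<Sum>b<k j. ?g b c)"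
      unfolding Q1_def sum_distrib_left by (rule sum.cong) (simp_all add: right)
    show ?thesis unfolding 1 2 by (rule sum.swap)
  qed
  have Q1c: "Q1 \<in> corner n" unfolding Q1_def using a by (intro sum_corner mult_corner) (auto simp: mu_corner N)
  have "commuting_projection (Q + Q1) (T + k j)"
    unfolding commuting_projection_def
  proof (intro conjI ballI)
    show "Q + Q1 \<in> corner n" using Qd(1) Q1c by (rule add_corner)
    show "adj (Q + Q1) = Q + Q1" by (simp only: adj_simps aQ1 Qd(2))
    show "(Q + Q1) * (Q + Q1) = Q + Q1" by (simp add: distrib_left distrib_right Qd(3) QQ11 QQ1 Q1Q)
    show "tr (Q + Q1) = of_nat (T + k j)" by (simp add: Qd(4) trQ1)
    show "(Q + Q1) * \<theta> x = \<theta> x * (Q + Q1)" if "x \<in> alg" for x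
      by (simp only: distrib_left distrib_right Qth[OF that] cQ1[OF that])
  qed
  then show ?thesis using j by blast
qed

text \<open>Subrepresentations are added one at a time, and each step raises the rank by at most \<open>K\<close>.\<close>

lemma commuting_projection_exists:
  assumes ex: "(\<Sum>j<i. \<theta> (block j (idn (k j)))) = idn n" and K: "\<And>j. j < i \<Longrightarrow> k j \<le> K" and t: "t \<le> n"
  shows "\<exists>Q T. commuting_projection Q T \<and> t \<le> T \<and> T \<le> t + K"
  using t
proof (induction t)
  case 0
  have "commuting_projection 0 0" by (simp add: commuting_projection_def)
  then show ?case by blast
next
  case (Suc t)
  then obtain Q T where Q: "commuting_projection Q T" "t \<le> T" "T \<le> t + K" by auto
  show ?case
  proof (cases "T = t")
    case True
    obtain Q' j where Q': "j < i" "commuting_projection Q' (T + k j)"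
      using commuting_projection_step[OF Q(1) _ ex] True Suc.prems by auto
    have "Suc t \<le> T + k j" "T + k j \<le> Suc t + K" using True k_pos[of j] K[OF Q'(1)] by auto
    then show ?thesis using Q'(2) by blast
  next
    case False
    then show ?thesis using Q by (intro exI[of _ Q] exI[of _ T]) auto
  qed
qed

end

text \<open>A projection \<open>Q\<close> of rank \<open>T\<close> between about \<open>n / 4\<close> and \<open>n / 2\<close> commutes with the representation. Its traceless part \<open>a\<close> in size \<open>k i\<close> has
  norm of order \<open>sqrt n\<close>, while its commutators with the three unitaries are bounded by twice the distance
  to the representation plus a constant for the row and the column that the compression
  drops. The numerical constants are chosen so that this violates \<open>expander_gap\<close>.\<close>

theorem compression_far_from_hom:
  assumes i: "i \<ge> 1" and n: "Suc n = k i" and hom: "hom n \<theta>"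
    and close: "\<And>g. g \<in> {clock, chirp, fourier} \<Longrightarrow> norm (idn n * g (k i) * idn n - \<theta> (\<lambda>j. g (k j))) \<le> sqrt n / 100"
  shows False
proof -
  have nbig: "n \<ge> 999999" using k_growth[of 0 i] k_0 i n by simp
  then have n1: "n \<ge> 1" by simp
  have big: "n < k j" if "i \<le> j" for j
    using k_growth[of i j] n that by (cases "i = j") auto
  have ex: "(\<Sum>j<i. \<theta> (block j (idn (k j)))) = idn n" by (rule th_blocks_exhaust[OF hom n1 big])
  have K: "k j \<le> n div 4" if "j < i" for j using k_growth[OF that] n by linarith
  obtain Q T where Q: "commuting_projection n \<theta> Q T" "n div 4 \<le> T" "T \<le> n div 4 + n div 4"
    using commuting_projection_exists[OF hom n1 ex K, of "n div 4"] by auto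
  have Qd: "Q \<in> corner n" "adj Q = Q" "Q * Q = Q" "tr Q = of_nat T" and Qth: "\<And>a. a \<in> alg \<Longrightarrow> Q * \<theta> a = \<theta> a * Q"
    using Q(1) unfolding commuting_projection_def[OF hom n1] by blast+
  define c where "c = real T / k i"
  \<comment> \<open>The constant \<open>c\<close> is the normalized trace of \<open>Q\<close> in size \<open>k i\<close>, one more than the size of the corner.\<close>
  define a where "a = Q - cscale (of_real c) (idn (k i))"
  have Qk: "Q \<in> corner (k i)" using Qd n by (auto intro: corner_mono)
  have ak: "a \<in> corner (k i)" using Qk by (simp add: a_def)
  have tra: "tr a = 0" using Qd k_pos[of i] by (simp add: a_def c_def)
  have qi: "Q * idn (k i) = Q" "idn (k i) * Q = Q" "idn (k i) * idn (k i) = idn (k i)"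
    by (simp_all add: idn_mult_left[OF Qk] idn_mult_right[OF Qk] idn_mult_idn)
  have "adj a = Q - cscale (of_real c) (idn (k i))" by (simp only: a_def adj_simps Qd(2) complex_cnj_complex_of_real)
  then have "adj a * a = Q - cscale (of_real c) Q - (cscale (of_real c) Q - cscale (of_real c) (cscale (of_real c) (idn (k i))))"
    by (simp only: a_def left_diff_distrib right_diff_distrib cscale_mult_left cscale_mult_right qi Qd(3) cscale_simps(2))
  then have "tr (adj a * a) = of_real (T - 2 * c * T + c * c * k i)"
    by (simp only: tr_simps Qd(4) tr_idn) simp
  then have "(norm a)\<^sup>2 = T - 2 * c * T + c * c * k i" by (simp only: norm_sq_tr Re_complex_of_real)
  also have "\<dots> = T - c * T" using k_pos[of i] by (simp add: c_def)
  finally have na: "(norm a)\<^sup>2 = T - c * T" .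
  have "c \<le> 1/2" using Q(3) n by (simp add: c_def divide_le_eq)
  then have "c * T \<le> 1/2 * T" by (intro mult_right_mono) auto
  then have na': "(norm a)\<^sup>2 \<ge> T / 2" using na by simp
  have "n \<le> 4 * T + 3" using Q(2) by linarith
  then have "real n \<le> real (4 * T + 3)" by (simp only: of_nat_le_iff)
  then have T: "real T \<ge> (real n - 3) / 4" by simp
  have "a \<noteq> 0" using na' T nbig by auto
  have "\<exists>g0\<in>expander (k i). \<not> norm (g0 * a - a * g0) \<le> norm a / 13"
  proof (rule ccontr)
    assume "\<not> ?thesis"
    then have "a = 0" by (intro expander_gap[OF k_pos ak tra]) blast
    with \<open>a \<noteq> 0\<close> show False by simp
  qed
  then obtain g0 where g0: "g0 \<in> expander (k i)" "\<not> norm (g0 * a - a * g0) \<le> norm a / 13" by blast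
  from g0(1) have "\<exists>g\<in>{clock, chirp, fourier}. g0 = g (k i)" by (simp add: expander_def)
  then obtain g where g: "g \<in> {clock, chirp, fourier}" "g0 = g (k i)" by blast
  define x where "x = \<theta> (\<lambda>j. g (k j))"
  have "\<forall>g\<in>{clock, chirp, fourier}. (\<lambda>j. g (k j)) \<in> D"
    using D_expander by (simp only: ball_simps simp_thms)
  then have gA: "(\<lambda>j. g (k j)) \<in> alg" using g(1) D_alg by blast
  have Qx: "Q * x = x * Q" unfolding x_def by (rule Qth[OF gA])
  \<comment> \<open>\<open>Q\<close> commutes with \<open>x\<close>, so only the distance to the compression and the last row and column contribute.\<close>
  let ?p = "idn n" and ?\<Delta> = "idn n * g0 * idn n - x"
  have g0c: "g0 \<in> corner (k i)" by (rule expander_corner[OF g0(1)])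
  have og: "opn g0 \<le> 1" by (rule opn_expander[OF k_pos g0(1)])
  have pe: "idn (k i) = ?p + munit n n" by (rule fmat_eqI) (auto simp: ent_idn ent_munit n[symmetric])
  have pQ: "?p * Q = Q" "Q * ?p = Q" by (rule idn_mult_left[OF Qd(1) order_refl], rule idn_mult_right[OF Qd(1) order_refl])
  have oQ: "opn Q \<le> 1" by (rule opn_projection_le[OF Qd(2,3)])
  have "g0 * a - a * g0 = g0 * Q - Q * g0"
    by (simp add: a_def left_diff_distrib right_diff_distrib cscale_mult_left cscale_mult_right idn_mult_left[OF g0c] idn_mult_right[OF g0c])
  also have "g0 * Q = (?p + munit n n) * g0 * (?p * Q)" using idn_mult_left[OF g0c order_refl] by (simp add: pe pQ)
  also have "Q * g0 = (Q * ?p) * g0 * (?p + munit n n)" using idn_mult_right[OF g0c order_refl] by (simp add: pe pQ mult.assoc)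
  also have "(?p + munit n n) * g0 * (?p * Q) - (Q * ?p) * g0 * (?p + munit n n) =
      (?\<Delta> * Q - Q * ?\<Delta>) + (munit n n * (g0 * Q) - Q * g0 * munit n n)"
    using Qx by (simp add: distrib_left distrib_right left_diff_distrib right_diff_distrib mult.assoc pQ)
      (simp add: mult.assoc[symmetric] pQ)
  finally have "norm (g0 * a - a * g0) \<le> (norm (?\<Delta> * Q) + norm (Q * ?\<Delta>)) + (norm (munit n n * (g0 * Q)) + norm (Q * g0 * munit n n))"
    by (simp only:) (intro order_trans[OF norm_triangle_ineq] add_mono norm_triangle_ineq4)
  also have "\<dots> \<le> (norm ?\<Delta> * 1 + 1 * norm ?\<Delta>) + (1 * 1 + 1 * 1)"
  proof (intro add_mono)
    have gQ: "opn (g0 * Q) \<le> 1" "opn (Q * g0) \<le> 1"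
      using opn_mult[of g0 Q] opn_mult[of Q g0] mult_mono[OF og oQ] mult_mono[OF oQ og] by auto
    show "norm (?\<Delta> * Q) \<le> norm ?\<Delta> * 1"
      by (rule order_trans[OF norm_mult_opn_right]) (intro mult_left_mono oQ, simp)
    show "norm (Q * ?\<Delta>) \<le> 1 * norm ?\<Delta>"
      by (rule order_trans[OF norm_mult_opn]) (intro mult_right_mono oQ, simp)
    show "norm (munit n n * (g0 * Q)) \<le> 1 * 1"
      by (rule order_trans[OF norm_mult_opn_right]) (use gQ in simp)
    show "norm (Q * g0 * munit n n) \<le> 1 * 1"
      by (rule order_trans[OF norm_mult_opn]) (use gQ in simp)
  qed
  also have "\<dots> \<le> 2 * (sqrt n / 100) + 2" using close[OF g(1)] g(2) by (simp add: x_def)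
  finally have up: "norm a / 13 < 2 * (sqrt n / 100) + 2" using g0(2) by simp
  have s: "sqrt n \<ge> 999" by (rule real_le_rsqrt) (use nbig in simp)
  have "norm a < 13 * (23 / 1000) * sqrt n" using up s by simp
  then have "(norm a)\<^sup>2 < (13 * (23 / 1000) * sqrt n)\<^sup>2" by (intro power_strict_mono) auto
  also have "\<dots> = (13 * (23 / 1000))\<^sup>2 * n" by (simp add: power_mult_distrib power_divide)
  finally have "(real n - 3) / 8 < (13 * (23 / 1000))\<^sup>2 * n" using na' T by simp
  then show False using nbig by (simp add: power2_eq_square)
qed

end

section \<open>The operator norm of an ordinary matrix\<close>

lemma vec_l2norm_sum:
  assumes "v \<in> carrier_vec n" shows "vec_l2norm v = sqrt (\<Sum>i<n. (cmod (v $ i))\<^sup>2)"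
proof -
  have "v \<bullet>c v = (\<Sum>i<n. of_real ((cmod (v $ i))\<^sup>2))"
    using assms by (simp add: scalar_prod_def lessThan_atLeast0 complex_norm_square del: of_real_power)
  then show ?thesis by (simp add: vec_l2norm_def del: of_real_power)
qed

lemma norm_colv:
  assumes "v \<in> carrier_vec n" shows "norm (colv n 0 v) = vec_l2norm v"
proof -
  have "(norm (colv n 0 v))\<^sup>2 = (\<Sum>i<n. (cmod (v $ i))\<^sup>2)"
    unfolding norm_sq_sum[OF colv_corner]
  proof (rule sum.cong)
    fix i assume "i \<in> {..<n}"
    then have "(\<Sum>l<n. (cmod (ent (colv n 0 v) i l))\<^sup>2) = (\<Sum>l<n. if l = 0 then (cmod (v $ i))\<^sup>2 else 0)"
      by (intro sum.cong) (auto simp: ent_colv)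
    also have "\<dots> = (cmod (v $ i))\<^sup>2" using \<open>i \<in> {..<n}\<close> by simp
    finally show "(\<Sum>l<n. (cmod (ent (colv n 0 v) i l))\<^sup>2) = (cmod (v $ i))\<^sup>2" .
  qed simp
  then show ?thesis unfolding vec_l2norm_sum[OF assms] by (metis norm_ge_zero real_sqrt_unique)
qed

lemma norm_sq_columns:
  assumes "y \<in> corner m" "0 < m"
  shows "(norm y)\<^sup>2 = (\<Sum>j<m. (norm (y * munit j 0))\<^sup>2)"
proof -
  have "(norm (y * munit j 0))\<^sup>2 = (\<Sum>i<m. (cmod (ent y i j))\<^sup>2)" if "j < m" for j
  proof -
    have c: "y * munit j 0 \<in> corner m" using assms that by auto
    show ?thesis unfolding norm_sq_sum[OF c]
    proof (rule sum.cong)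
      fix i
      have "(\<Sum>l<m. (cmod (ent (y * munit j 0) i l))\<^sup>2) = (\<Sum>l<m. if l = 0 then (cmod (ent y i j))\<^sup>2 else 0)"
        by (intro sum.cong) (auto simp: ent_mult_munit)
      then show "(\<Sum>l<m. (cmod (ent (y * munit j 0) i l))\<^sup>2) = (cmod (ent y i j))\<^sup>2" using assms(2) by simp
    qed simp
  qed
  then have "(\<Sum>j<m. (norm (y * munit j 0))\<^sup>2) = (\<Sum>j<m. \<Sum>i<m. (cmod (ent y i j))\<^sup>2)" by simp
  also have "\<dots> = (norm y)\<^sup>2" unfolding norm_sq_sum[OF assms(1)] by (rule sum.swap)
  finally show ?thesis by simp
qed

lemma ent_idn_mult_row: "ent (idn n * y) a b = (if a < n then ent y a b else 0)"
proof -
  have "ent (idn n * y) a b = (\<Sum>l<n. ent (idn n) a l * ent y l b)"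
    by (rule ent_mult) simp
  also have "\<dots> = (\<Sum>l<n. if l = a then ent y a b else 0)"
    by (rule sum.cong) (auto simp: ent_idn)
  finally have "ent (idn n * y) a b = (\<Sum>l<n. if l = a then ent y a b else 0)" .
  then show ?thesis by simp
qed

text \<open>A vector is a matrix with one column, and the square of the Hilbert-Schmidt norm is the sum over the
  columns, so a bound for the action on vectors also bounds left multiplication on matrices.\<close>

lemma mat_opnorm_opn:
  assumes M: "M \<in> carrier_mat n n" shows "mat_opnorm M = opn (of_mat M)"
proof -
  let ?X = "of_mat M" and ?B = "{v \<in> carrier_vec n. vec_l2norm v \<le> 1}"
  have e: "mat_opnorm M = (SUP v\<in>?B. vec_l2norm (M *\<^sub>v v))" using M by (simp add: mat_opnorm_def)
  have Mv: "vec_l2norm (M *\<^sub>v v) = norm (?X * colv n 0 v)" if "v \<in> carrier_vec n" for v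
  proof -
    have "M *\<^sub>v v \<in> carrier_vec n" using M that by simp
    from norm_colv[OF this] show ?thesis unfolding colv_mult[OF M that] by simp
  qed
  have ub: "vec_l2norm (M *\<^sub>v v) \<le> opn ?X" if "v \<in> ?B" for v
  proof -
    from that have v: "v \<in> carrier_vec n" "norm (colv n 0 v) \<le> 1" by (auto simp: norm_colv)
    have "norm (?X * colv n 0 v) \<le> opn ?X * norm (colv n 0 v)" by (rule norm_mult_opn)
    also have "\<dots> \<le> opn ?X" using v by (intro mult_left_le) auto
    finally show ?thesis by (simp only: Mv[OF v(1)])
  qed
  have bdd: "bdd_above ((\<lambda>v. vec_l2norm (M *\<^sub>v v)) ` ?B)" using ub by (intro bdd_aboveI2)
  have z: "0\<^sub>v n \<in> ?B" by (simp add: vec_l2norm_sum[of _ n])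
  let ?s = "mat_opnorm M"
  have s: "vec_l2norm (M *\<^sub>v v) \<le> ?s" if "v \<in> ?B" for v
    unfolding e by (rule cSUP_upper[OF that bdd])
  have s0: "0 \<le> ?s"
  proof -
    have "0 \<le> norm (?X * colv n 0 (0\<^sub>v n))" by simp
    also have "\<dots> = vec_l2norm (M *\<^sub>v 0\<^sub>v n)" by (rule Mv[symmetric]) simp
    also have "\<dots> \<le> ?s" by (rule s[OF z])
    finally show ?thesis .
  qed
  have col: "norm (?X * colv n 0 v) \<le> ?s * norm (colv n 0 v)" if v: "v \<in> carrier_vec n" for v
  proof (cases "norm (colv n 0 v) = 0")
    case False
    let ?c = "of_real (1 / norm (colv n 0 v)) :: complex"
    have cs: "colv n 0 (?c \<cdot>\<^sub>v v) = cscale ?c (colv n 0 v)"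
      using v by (intro fmat_eqI) (auto simp: ent_colv)
    have w: "?c \<cdot>\<^sub>v v \<in> carrier_vec n" using v by simp
    have "norm (colv n 0 (?c \<cdot>\<^sub>v v)) = 1" using False unfolding cs by (simp add: norm_divide)
    then have "?c \<cdot>\<^sub>v v \<in> ?B" unfolding norm_colv[OF w] using w by (simp only: mem_Collect_eq order_refl simp_thms)
    from s[OF this] have "norm (?X * cscale ?c (colv n 0 v)) \<le> ?s" unfolding Mv[OF w] cs .
    then have "norm (?X * colv n 0 v) / norm (colv n 0 v) \<le> ?s" by (simp add: cscale_mult_right norm_divide)
    then show ?thesis using False by (simp add: divide_le_eq)
  qed simp
  have "opn ?X \<le> ?s"
  proof (rule opn_le)
    fix x :: fmat
    obtain m0 where m0: "x \<in> corner m0" using ex_corner by blast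
    define m where "m = Suc (max m0 n)"
    have m: "x \<in> corner m" "?X \<in> corner m" "0 < m"
      using corner_mono[OF m0, of m] corner_mono[OF of_mat_corner[OF M], of m] by (auto simp: m_def)
    have "(norm (?X * x))\<^sup>2 = (\<Sum>j<m. (norm (?X * x * munit j 0))\<^sup>2)"
      using m by (intro norm_sq_columns) auto
    also have "\<dots> \<le> (\<Sum>j<m. (?s * norm (x * munit j 0))\<^sup>2)"
    proof (intro sum_mono power_mono)
      fix j
      let ?v = "Matrix.vec n (\<lambda>i. ent x i j)"
      have cv: "idn n * (x * munit j 0) = colv n 0 ?v"
      proof (rule fmat_eqI)
        fix a b
        have "ent (idn n * (x * munit j 0)) a b = (if a < n then ent (x * munit j 0) a b else 0)"
          by (simp add: ent_idn_mult_row)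
        then show "ent (idn n * (x * munit j 0)) a b = ent (colv n 0 ?v) a b"
          by (auto simp: ent_colv ent_mult_munit)
      qed
      have "?X * x * munit j 0 = ?X * (idn n * (x * munit j 0))"
        by (simp only: mult.assoc[symmetric] idn_mult_right[OF of_mat_corner[OF M] order_refl])
      then have "norm (?X * x * munit j 0) \<le> ?s * norm (idn n * (x * munit j 0))"
        using col[of ?v] unfolding cv by (simp only: vec_carrier)
      also have "norm (idn n * (x * munit j 0)) \<le> norm (x * munit j 0)"
        using norm_mult_opn[of "idn n" "x * munit j 0"] mult_right_mono[OF opn_idn_le[of n] norm_ge_zero[of "x * munit j 0"]] by linarith
      finally show "norm (?X * x * munit j 0) \<le> ?s * norm (x * munit j 0)" using s0 by (simp add: mult_left_mono mult_right_mono)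
    qed simp
    also have "\<dots> = (?s * norm x)\<^sup>2"
      unfolding power_mult_distrib norm_sq_columns[OF m(1,3)] sum_distrib_left ..
    finally have sq: "(norm (?X * x))\<^sup>2 \<le> (?s * norm x)\<^sup>2" .
    show "norm (?X * x) \<le> ?s * norm x"
      by (rule power2_le_imp_le[OF sq mult_nonneg_nonneg[OF s0 norm_ge_zero]])
  qed
  moreover have "?s \<le> opn ?X" unfolding e by (rule cSUP_least) (use z ub in blast)+
  ultimately show ?thesis by simp
qed

section \<open>Products of matrix algebras\<close>

abbreviation mats :: "nat set \<Rightarrow> (nat \<Rightarrow> nat) \<Rightarrow> (nat \<Rightarrow> complex mat) cstar" where
  "mats I n \<equiv> cstar_product I (\<lambda>i. mat_cstar (n i))"

lemma mats_simps [simp]: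
  "monoid.mult (mats I n) = (\<lambda>a b. \<lambda>i\<in>I. a i * b i)"
  "one (mats I n) = (\<lambda>i\<in>I. 1\<^sub>m (n i))"
  "zero (mats I n) = (\<lambda>i\<in>I. 0\<^sub>m (n i) (n i))"
  "add (mats I n) = (\<lambda>a b. \<lambda>i\<in>I. a i + b i)"
  "module.smult (mats I n) = (\<lambda>c a. \<lambda>i\<in>I. c \<cdot>\<^sub>m a i)"
  "star (mats I n) = (\<lambda>a. \<lambda>i\<in>I. mat_adjoint (a i))"
  "cnorm (mats I n) = (\<lambda>a. SUP i\<in>I. mat_opnorm (a i))"
  by (simp_all add: cstar_product_def mat_cstar_def)

lemma mats_carrier:
  "carrier (mats I n) = {a \<in> \<Pi>\<^sub>E i\<in>I. carrier_mat (n i) (n i). \<exists>K. \<forall>i\<in>I. mat_opnorm (a i) \<le> K}"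
  by (simp add: cstar_product_def mat_cstar_def)

lemma restrict_eqI:
  assumes "x \<in> (\<Pi>\<^sub>E i\<in>I. B i)" "\<And>i. i \<in> I \<Longrightarrow> f i = x i" shows "restrict f I = x"
  using assms by (intro ext) (auto simp: PiE_def extensional_def)

lemma neg_add_mat: "A \<in> carrier_mat m m \<Longrightarrow> (- 1) \<cdot>\<^sub>m A + A = 0\<^sub>m m m" for A :: "complex mat"
  by (rule eq_matI) auto

text \<open>Stated for an arbitrary set \<open>S\<close> of families closed under the operations, so that it covers both the full product of matrix algebras
  and the subalgebra that carries the example.\<close>

lemma ring_mats:
  assumes S: "S \<subseteq> (\<Pi>\<^sub>E i\<in>I. carrier_mat (n i) (n i))"
    and one: "(\<lambda>i\<in>I. 1\<^sub>m (n i)) \<in> S" and zero: "(\<lambda>i\<in>I. 0\<^sub>m (n i) (n i)) \<in> S"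
    and add: "\<And>a b. a \<in> S \<Longrightarrow> b \<in> S \<Longrightarrow> (\<lambda>i\<in>I. a i + b i) \<in> S"
    and mult: "\<And>a b. a \<in> S \<Longrightarrow> b \<in> S \<Longrightarrow> (\<lambda>i\<in>I. a i * b i) \<in> S"
    and smult: "\<And>a. a \<in> S \<Longrightarrow> (\<lambda>i\<in>I. (- 1) \<cdot>\<^sub>m a i) \<in> S"
  shows "ring (mats I n\<lparr>carrier := S\<rparr>)"
proof (rule ringI)
  let ?R = "mats I n\<lparr>carrier := S\<rparr>"
  have e: "x \<in> (\<Pi>\<^sub>E i\<in>I. carrier_mat (n i) (n i))" if "x \<in> S" for x using S that by blast
  have c: "x i \<in> carrier_mat (n i) (n i)" if "x \<in> S" "i \<in> I" for x i using e[OF that(1)] that(2) by (rule PiE_mem)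
  show "abelian_group ?R"
  proof (rule abelian_groupI)
    fix x y z assume "x \<in> carrier ?R" "y \<in> carrier ?R" "z \<in> carrier ?R"
    then have s: "x \<in> S" "y \<in> S" "z \<in> S" by simp_all
    show "x \<oplus>\<^bsub>?R\<^esub> y \<in> carrier ?R" using add[OF s(1,2)] by simp
    show "x \<oplus>\<^bsub>?R\<^esub> y \<oplus>\<^bsub>?R\<^esub> z = x \<oplus>\<^bsub>?R\<^esub> (y \<oplus>\<^bsub>?R\<^esub> z)"
      using c[OF s(1)] c[OF s(2)] c[OF s(3)] by (auto intro!: restrict_ext assoc_add_mat)
    show "x \<oplus>\<^bsub>?R\<^esub> y = y \<oplus>\<^bsub>?R\<^esub> x"
      by (simp, rule restrict_ext, rule comm_add_mat[OF c[OF s(1)] c[OF s(2)]])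
    show "\<zero>\<^bsub>?R\<^esub> \<oplus>\<^bsub>?R\<^esub> x = x"
      using c[OF s(1)] by (auto intro!: restrict_eqI[OF e[OF s(1)]])
    have "(\<lambda>i\<in>I. (- 1) \<cdot>\<^sub>m x i) \<oplus>\<^bsub>?R\<^esub> x = \<zero>\<^bsub>?R\<^esub>"
      using c[OF s(1)] by (auto intro!: restrict_ext neg_add_mat)
    with smult[OF s(1)] show "\<exists>y\<in>carrier ?R. y \<oplus>\<^bsub>?R\<^esub> x = \<zero>\<^bsub>?R\<^esub>" by (intro bexI) simp_all
  next
    show "\<zero>\<^bsub>?R\<^esub> \<in> carrier ?R" using zero by simp
  qed
  show "monoid ?R"
  proof (rule monoidI)
    fix x y z assume "x \<in> carrier ?R" "y \<in> carrier ?R" "z \<in> carrier ?R"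
    then have s: "x \<in> S" "y \<in> S" "z \<in> S" by simp_all
    show "x \<otimes>\<^bsub>?R\<^esub> y \<in> carrier ?R" using mult[OF s(1,2)] by simp
    show "x \<otimes>\<^bsub>?R\<^esub> y \<otimes>\<^bsub>?R\<^esub> z = x \<otimes>\<^bsub>?R\<^esub> (y \<otimes>\<^bsub>?R\<^esub> z)"
      using c[OF s(1)] c[OF s(2)] c[OF s(3)] by (auto intro!: restrict_ext assoc_mult_mat)
    show "\<one>\<^bsub>?R\<^esub> \<otimes>\<^bsub>?R\<^esub> x = x" "x \<otimes>\<^bsub>?R\<^esub> \<one>\<^bsub>?R\<^esub> = x"
      using c[OF s(1)] by (auto intro!: restrict_eqI[OF e[OF s(1)]] left_mult_one_mat right_mult_one_mat)
  next
    show "\<one>\<^bsub>?R\<^esub> \<in> carrier ?R" using one by simp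
  qed
  fix x y z assume "x \<in> carrier ?R" "y \<in> carrier ?R" "z \<in> carrier ?R"
  then have s: "x \<in> S" "y \<in> S" "z \<in> S" by simp_all
  show "(x \<oplus>\<^bsub>?R\<^esub> y) \<otimes>\<^bsub>?R\<^esub> z = x \<otimes>\<^bsub>?R\<^esub> z \<oplus>\<^bsub>?R\<^esub> y \<otimes>\<^bsub>?R\<^esub> z"
    using c[OF s(1)] c[OF s(2)] c[OF s(3)] by (auto intro!: restrict_ext add_mult_distrib_mat)
  show "z \<otimes>\<^bsub>?R\<^esub> (x \<oplus>\<^bsub>?R\<^esub> y) = z \<otimes>\<^bsub>?R\<^esub> x \<oplus>\<^bsub>?R\<^esub> z \<otimes>\<^bsub>?R\<^esub> y"
    using c[OF s(1)] c[OF s(2)] c[OF s(3)] by (auto intro!: restrict_ext mult_add_distrib_mat)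
qed

lemma of_mat_minus:
  assumes R: "ring (mats I n\<lparr>carrier := S\<rparr>)" and S: "S \<subseteq> (\<Pi>\<^sub>E i\<in>I. carrier_mat (n i) (n i))"
    and xy: "x \<in> S" "y \<in> S" and i: "i \<in> I"
  shows "of_mat ((x \<ominus>\<^bsub>mats I n\<lparr>carrier := S\<rparr>\<^esub> y) i) = of_mat (x i) - of_mat (y i)"
proof -
  let ?R = "mats I n\<lparr>carrier := S\<rparr>"
  interpret R: ring ?R by (rule R)
  have xyR: "x \<in> carrier ?R" "y \<in> carrier ?R" using xy by simp_all
  have d: "x \<ominus>\<^bsub>?R\<^esub> y \<in> S" using R.minus_closed[OF xyR] by simp
  have "(x \<ominus>\<^bsub>?R\<^esub> y) \<oplus>\<^bsub>?R\<^esub> y = x"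
    using xyR by (simp only: R.minus_eq R.a_assoc R.l_neg R.r_zero R.a_inv_closed)
  then have "((x \<ominus>\<^bsub>?R\<^esub> y) \<oplus>\<^bsub>?R\<^esub> y) i = x i" by simp
  then have "(x \<ominus>\<^bsub>?R\<^esub> y) i + y i = x i" using i by simp
  moreover have "(x \<ominus>\<^bsub>?R\<^esub> y) i \<in> carrier_mat (n i) (n i)" "y i \<in> carrier_mat (n i) (n i)"
    using d xy(2) S i by blast+
  ultimately have "of_mat ((x \<ominus>\<^bsub>?R\<^esub> y) i) + of_mat (y i) = of_mat (x i)"
    by (metis of_mat_hom(1))
  then show ?thesis by (simp add: algebra_simps)
qed

section \<open>The C*-algebra\<close>

lemma mat_cstar_simps:
  "carrier (mat_cstar n) = carrier_mat n n" "x \<otimes>\<^bsub>mat_cstar n\<^esub> y = x * y" "\<one>\<^bsub>mat_cstar n\<^esub> = 1\<^sub>m n"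
  "\<zero>\<^bsub>mat_cstar n\<^esub> = 0\<^sub>m n n" "x \<oplus>\<^bsub>mat_cstar n\<^esub> y = x + y" "c \<odot>\<^bsub>mat_cstar n\<^esub> x = c \<cdot>\<^sub>m x"
  "star (mat_cstar n) x = mat_adjoint x" "cnorm (mat_cstar n) x = mat_opnorm x"
  by (simp_all add: mat_cstar_def)

lemma norm_trace_to_mat: "x \<in> corner n \<Longrightarrow> norm_trace n (to_mat n x) = tr x / of_nat n"
  by (simp add: norm_trace_def tr_eq[of x n])

context tower
begin

text \<open>The translations between sequences of finitely supported matrices and sequences of matrices that
  carry their dimension; on the algebra they are inverse to each other.\<close>

definition mseq :: "(nat \<Rightarrow> fmat) \<Rightarrow> nat \<Rightarrow> complex mat" where
  "mseq a = (\<lambda>j. to_mat (k j) (a j))"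

definition fseq :: "(nat \<Rightarrow> complex mat) \<Rightarrow> nat \<Rightarrow> fmat" where
  "fseq b = (\<lambda>j. of_mat (b j))"

definition calg :: "(nat \<Rightarrow> complex mat) cstar" where
  "calg = mats UNIV k\<lparr>carrier := {b. (\<forall>j. b j \<in> carrier_mat (k j) (k j)) \<and> fseq b \<in> alg}\<rparr>"

lemma calg_simps:
  "x \<otimes>\<^bsub>calg\<^esub> y = (\<lambda>j. x j * y j)" "\<one>\<^bsub>calg\<^esub> = (\<lambda>j. 1\<^sub>m (k j))" "\<zero>\<^bsub>calg\<^esub> = (\<lambda>j. 0\<^sub>m (k j) (k j))"
  "x \<oplus>\<^bsub>calg\<^esub> y = (\<lambda>j. x j + y j)" "c \<odot>\<^bsub>calg\<^esub> x = (\<lambda>j. c \<cdot>\<^sub>m x j)"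
  "star calg x = (\<lambda>j. mat_adjoint (x j))" "cnorm calg x = (SUP j. mat_opnorm (x j))"
  by (simp_all add: calg_def restrict_UNIV)

lemma calg_carrier: "b \<in> carrier calg \<longleftrightarrow> (\<forall>j. b j \<in> carrier_mat (k j) (k j)) \<and> fseq b \<in> alg"
  by (simp add: calg_def)

lemma calg_mat: "b \<in> carrier calg \<Longrightarrow> b j \<in> carrier_mat (k j) (k j)"
  and calg_fseq: "b \<in> carrier calg \<Longrightarrow> fseq b \<in> alg"
  by (simp_all add: calg_carrier)

lemma fseq_mseq: "a \<in> alg \<Longrightarrow> fseq (mseq a) = a"
  by (rule ext) (simp add: fseq_def mseq_def of_to_mat[OF alg_corner])

lemma mseq_fseq: "b \<in> carrier calg \<Longrightarrow> mseq (fseq b) = b"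
  by (rule ext) (simp add: fseq_def mseq_def to_of_mat[OF calg_mat])

lemma mseq_carrier: "a \<in> alg \<Longrightarrow> mseq a \<in> carrier calg"
  unfolding calg_carrier using fseq_mseq[of a] by (simp add: mseq_def)

lemma fseq_ops:
  assumes x: "x \<in> carrier calg"
  shows "y \<in> carrier calg \<Longrightarrow> fseq (x \<oplus>\<^bsub>calg\<^esub> y) = (\<lambda>j. fseq x j + fseq y j)"
    "y \<in> carrier calg \<Longrightarrow> fseq (x \<otimes>\<^bsub>calg\<^esub> y) = (\<lambda>j. fseq x j * fseq y j)"
    "fseq (c \<odot>\<^bsub>calg\<^esub> x) = (\<lambda>j. cscale c (fseq x j))" "fseq (star calg x) = (\<lambda>j. adj (fseq x j))"
  by (simp_all add: fseq_def calg_simps of_mat_hom(1,2)[OF calg_mat[OF x] calg_mat]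
      of_mat_hom(3,4)[OF calg_mat[OF x] calg_mat[OF x]])

lemma fseq_consts: "fseq \<one>\<^bsub>calg\<^esub> = (\<lambda>j. idn (k j))" "fseq \<zero>\<^bsub>calg\<^esub> = (\<lambda>j. 0)"
proof -
  have z: "0\<^sub>m m m \<in> carrier_mat m m" for m :: nat by simp
  show "fseq \<one>\<^bsub>calg\<^esub> = (\<lambda>j. idn (k j))" "fseq \<zero>\<^bsub>calg\<^esub> = (\<lambda>j. 0)"
    by (simp_all add: fseq_def calg_simps of_mat_hom(5,6)[OF z z])
qed

lemma mseq_ops:
  assumes a: "a \<in> alg" and b: "b \<in> alg"
  shows "mseq (\<lambda>j. a j + b j) = mseq a \<oplus>\<^bsub>calg\<^esub> mseq b" "mseq (\<lambda>j. a j * b j) = mseq a \<otimes>\<^bsub>calg\<^esub> mseq b"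
    "mseq (\<lambda>j. cscale c (a j)) = c \<odot>\<^bsub>calg\<^esub> mseq a" "mseq (\<lambda>j. adj (a j)) = star calg (mseq a)"
    "mseq (\<lambda>j. idn (k j)) = \<one>\<^bsub>calg\<^esub>"
  by (simp_all add: mseq_def calg_simps to_mat_hom[OF alg_corner[OF a] alg_corner[OF b]])

lemma calg_closed:
  assumes x: "x \<in> carrier calg"
  shows "y \<in> carrier calg \<Longrightarrow> x \<oplus>\<^bsub>calg\<^esub> y \<in> carrier calg" "y \<in> carrier calg \<Longrightarrow> x \<otimes>\<^bsub>calg\<^esub> y \<in> carrier calg"
    "c \<odot>\<^bsub>calg\<^esub> x \<in> carrier calg" "star calg x \<in> carrier calg"
proof -
  note xs = calg_fseq[OF x] calg_mat[OF x]
  show "c \<odot>\<^bsub>calg\<^esub> x \<in> carrier calg" "star calg x \<in> carrier calg"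
    unfolding calg_carrier fseq_ops[OF x] using alg_cscale[OF xs(1)] alg_adj[OF xs(1)] xs(2)
    by (auto simp: calg_simps)
  assume y: "y \<in> carrier calg"
  note ys = calg_fseq[OF y] calg_mat[OF y]
  show "x \<oplus>\<^bsub>calg\<^esub> y \<in> carrier calg" "x \<otimes>\<^bsub>calg\<^esub> y \<in> carrier calg"
    unfolding calg_carrier fseq_ops(1,2)[OF x y]
    using alg_add[OF xs(1) ys(1)] alg_mult[OF xs(1) ys(1)] add_carrier_mat[OF ys(2)] mult_carrier_mat[OF xs(2) ys(2)]
    by (auto simp: calg_simps)
qed

lemma calg_consts: "\<one>\<^bsub>calg\<^esub> \<in> carrier calg" "\<zero>\<^bsub>calg\<^esub> \<in> carrier calg"
  unfolding calg_carrier fseq_consts using alg_one alg_zero by (auto simp: calg_simps)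

lemma calg_eqI: "x \<in> carrier calg \<Longrightarrow> y \<in> carrier calg \<Longrightarrow> fseq x = fseq y \<Longrightarrow> x = y"
  by (metis mseq_fseq)

lemma ring_calg: "ring calg"
  unfolding calg_def
proof (rule ring_mats)
  let ?S = "{b. (\<forall>j. b j \<in> carrier_mat (k j) (k j)) \<and> fseq b \<in> alg}"
  have c: "b \<in> ?S \<longleftrightarrow> b \<in> carrier calg" for b by (simp add: calg_carrier)
  show "?S \<subseteq> (\<Pi>\<^sub>E j\<in>UNIV. carrier_mat (k j) (k j))" by (auto simp: PiE_def)
  show "(\<lambda>j\<in>UNIV. 1\<^sub>m (k j)) \<in> ?S" "(\<lambda>j\<in>UNIV. 0\<^sub>m (k j) (k j)) \<in> ?S"
    unfolding c restrict_UNIV using calg_consts by (simp_all add: calg_simps)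
  fix a b assume "a \<in> ?S" "b \<in> ?S"
  then have ab: "a \<in> carrier calg" "b \<in> carrier calg" by (simp_all only: c)
  show "(\<lambda>j\<in>UNIV. a j + b j) \<in> ?S" "(\<lambda>j\<in>UNIV. a j * b j) \<in> ?S" "(\<lambda>j\<in>UNIV. (- 1) \<cdot>\<^sub>m a j) \<in> ?S"
    unfolding c restrict_UNIV using calg_closed(1-2)[OF ab] calg_closed(3)[OF ab(1), of "-1"] by (simp_all add: calg_simps)
qed

lemma fseq_minus:
  assumes "x \<in> carrier calg" "y \<in> carrier calg"
  shows "fseq (x \<ominus>\<^bsub>calg\<^esub> y) j = fseq x j - fseq y j"
proof -
  have "of_mat ((x \<ominus>\<^bsub>calg\<^esub> y) j) = of_mat (x j) - of_mat (y j)"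
    unfolding calg_def
    by (rule of_mat_minus[OF ring_calg[unfolded calg_def]]) (use assms in \<open>auto simp: calg_carrier PiE_def\<close>)
  then show ?thesis by (simp only: fseq_def)
qed

lemma cnorm_opn: "x \<in> carrier calg \<Longrightarrow> cnorm calg x = (SUP j. opn (fseq x j))"
  by (simp add: calg_simps fseq_def mat_opnorm_opn[OF calg_mat])

lemma cnorm_le: "x \<in> carrier calg \<Longrightarrow> (\<And>j. opn (fseq x j) \<le> e) \<Longrightarrow> cnorm calg x \<le> e"
  unfolding cnorm_opn by (rule cSUP_least) auto

lemma opn_le_cnorm:
  assumes "x \<in> carrier calg" shows "opn (fseq x j) \<le> cnorm calg x"
proof -
  obtain C where "\<forall>j. opn (fseq x j) \<le> C" using alg_bound[OF calg_fseq[OF assms]] by blast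
  then have "bdd_above (range (\<lambda>j. opn (fseq x j)))" by (intro bdd_aboveI2) blast
  then show ?thesis unfolding cnorm_opn[OF assms] by (rule cSUP_upper[OF UNIV_I])
qed

lemma calg_cstar: "unital_cstar_algebra calg"
proof (rule unital_cstar_algebra.intro)
  interpret R: ring calg by (rule ring_calg)
  show "ring calg" by (rule ring_calg)
  show "Module.module (class_ring :: complex ring) calg"
  proof (rule Module.moduleI)
    show "cring (class_ring :: complex ring)" by (rule class_cring.cring_axioms)
    show "abelian_group calg" by (rule R.abelian_group_axioms)
  qed (simp_all add: calg_closed, (rule calg_eqI; simp add: calg_closed fseq_ops cscale_simps)+)
  show "unital_cstar_algebra_axioms calg"
  proof (rule unital_cstar_algebra_axioms.intro)
    fix x y c assume x: "x \<in> carrier calg" and y: "y \<in> carrier calg"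
    note [simp] = x y
    note cl = calg_closed fseq_ops
    show "(c \<odot>\<^bsub>calg\<^esub> x) \<otimes>\<^bsub>calg\<^esub> y = c \<odot>\<^bsub>calg\<^esub> (x \<otimes>\<^bsub>calg\<^esub> y)"
      by (rule calg_eqI) (simp_all add: cl cscale_mult_left)
    show "x \<otimes>\<^bsub>calg\<^esub> (c \<odot>\<^bsub>calg\<^esub> y) = c \<odot>\<^bsub>calg\<^esub> (x \<otimes>\<^bsub>calg\<^esub> y)"
      by (rule calg_eqI) (simp_all add: cl cscale_mult_right)
    show "star calg x \<in> carrier calg" by (rule calg_closed(4)[OF x])
    show "star calg (star calg x) = x"
      by (rule calg_eqI) (simp_all add: cl)
    show "star calg (x \<oplus>\<^bsub>calg\<^esub> y) = star calg x \<oplus>\<^bsub>calg\<^esub> star calg y"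
      by (rule calg_eqI) (simp_all add: cl)
    show "star calg (c \<odot>\<^bsub>calg\<^esub> x) = cnj c \<odot>\<^bsub>calg\<^esub> star calg x"
      by (rule calg_eqI) (simp_all add: cl)
    show "star calg (x \<otimes>\<^bsub>calg\<^esub> y) = star calg y \<otimes>\<^bsub>calg\<^esub> star calg x"
      by (rule calg_eqI) (simp_all add: cl adj_mult)
    show n: "0 \<le> cnorm calg x" by (rule order_trans[OF opn_nonneg opn_le_cnorm[OF x]])
    show "cnorm calg (x \<oplus>\<^bsub>calg\<^esub> y) \<le> cnorm calg x + cnorm calg y"
      by (rule cnorm_le) (auto simp: cl intro!: order_trans[OF opn_triangle] add_mono opn_le_cnorm)
    show "cnorm calg (x \<otimes>\<^bsub>calg\<^esub> y) \<le> cnorm calg x * cnorm calg y"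
      by (rule cnorm_le) (auto simp: cl n intro!: order_trans[OF opn_mult] mult_mono opn_le_cnorm)
    show "cnorm calg x = 0 \<longleftrightarrow> x = \<zero>\<^bsub>calg\<^esub>"
    proof
      assume "cnorm calg x = 0"
      then have "opn (fseq x j) = 0" for j using opn_le_cnorm[OF x, of j] opn_nonneg[of "fseq x j"] by linarith
      then show "x = \<zero>\<^bsub>calg\<^esub>" by (intro calg_eqI) (simp_all add: fseq_consts calg_consts fun_eq_iff)
    next
      assume "x = \<zero>\<^bsub>calg\<^esub>"
      then show "cnorm calg x = 0" by (simp add: cnorm_opn calg_consts fseq_consts)
    qed
    have le: "cnorm calg (d \<odot>\<^bsub>calg\<^esub> z) \<le> cmod d * cnorm calg z" if "z \<in> carrier calg" for d z
      by (rule cnorm_le) (auto simp: cl that intro!: mult_left_mono opn_le_cnorm)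
    show "cnorm calg (c \<odot>\<^bsub>calg\<^esub> x) = cmod c * cnorm calg x"
    proof (cases "c = 0")
      case True
      then show ?thesis using le[OF x, of c] order_trans[OF opn_nonneg opn_le_cnorm[OF calg_closed(3)[OF x], of c]] by simp
    next
      case False
      have "x = (1 / c) \<odot>\<^bsub>calg\<^esub> (c \<odot>\<^bsub>calg\<^esub> x)"
        by (rule calg_eqI) (simp_all add: cl False cscale_simps)
      then have "cnorm calg x \<le> cmod (1 / c) * cnorm calg (c \<odot>\<^bsub>calg\<^esub> x)"
        using le[OF calg_closed(3)[OF x], of "1 / c" c] by (simp only:)
      then have "cmod c * cnorm calg x \<le> cnorm calg (c \<odot>\<^bsub>calg\<^esub> x)"
        using False by (simp add: norm_divide field_simps)
      then show ?thesis using le[OF x, of c] by linarith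
    qed
    show "cnorm calg (star calg x \<otimes>\<^bsub>calg\<^esub> x) = (cnorm calg x)\<^sup>2"
    proof (rule antisym)
      have e: "opn (fseq (star calg x \<otimes>\<^bsub>calg\<^esub> x) j) = (opn (fseq x j))\<^sup>2" for j
        by (simp add: cl opn_cstar)
      show "cnorm calg (star calg x \<otimes>\<^bsub>calg\<^esub> x) \<le> (cnorm calg x)\<^sup>2"
        by (rule cnorm_le) (auto simp: e calg_closed intro!: power_mono opn_le_cnorm)
      have "opn (fseq x j) \<le> sqrt (cnorm calg (star calg x \<otimes>\<^bsub>calg\<^esub> x))" for j
        using opn_le_cnorm[of "star calg x \<otimes>\<^bsub>calg\<^esub> x" j] unfolding e
        by (intro real_le_rsqrt) (simp add: calg_closed)
      then have "cnorm calg x \<le> sqrt (cnorm calg (star calg x \<otimes>\<^bsub>calg\<^esub> x))" by (rule cnorm_le[OF x])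
      then show "(cnorm calg x)\<^sup>2 \<le> cnorm calg (star calg x \<otimes>\<^bsub>calg\<^esub> x)"
        using n by (metis real_sqrt_le_iff real_sqrt_unique)
    qed
  next
    fix X :: "nat \<Rightarrow> nat \<Rightarrow> complex mat"
    assume X: "\<And>n. X n \<in> carrier calg"
      and cauchy: "\<forall>e>0. \<exists>N. \<forall>m\<ge>N. \<forall>n\<ge>N. cnorm calg (X m \<ominus>\<^bsub>calg\<^esub> X n) < e"
    have "\<exists>N. \<forall>m\<ge>N. \<forall>n\<ge>N. \<forall>j. opn (fseq (X m) j - fseq (X n) j) \<le> e" if e: "e > 0" for e
    proof -
      obtain N where N: "\<forall>m\<ge>N. \<forall>n\<ge>N. cnorm calg (X m \<ominus>\<^bsub>calg\<^esub> X n) < e" using cauchy e by blast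
      have "opn (fseq (X m) j - fseq (X n) j) \<le> e" if "m \<ge> N" "n \<ge> N" for m n j
        using opn_le_cnorm[OF R.minus_closed[OF X[of m] X[of n]], of j] N that fseq_minus[OF X[of m] X[of n], of j]
        by fastforce
      then show ?thesis by blast
    qed
    with alg_complete[of "\<lambda>n. fseq (X n)", OF calg_fseq[OF X]]
    obtain x where x: "x \<in> alg" "\<forall>e>0. \<exists>N. \<forall>n\<ge>N. \<forall>j. opn (fseq (X n) j - x j) \<le> e" by blast
    have y: "mseq x \<in> carrier calg" by (rule mseq_carrier[OF x(1)])
    have "(\<lambda>n. cnorm calg (X n \<ominus>\<^bsub>calg\<^esub> mseq x)) \<longlonglongrightarrow> 0"
    proof (rule LIMSEQ_I)
      fix r :: real assume "r > 0"
      then obtain N where N: "\<forall>n\<ge>N. \<forall>j. opn (fseq (X n) j - x j) \<le> r / 2" using x(2) half_gt_zero by blast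
      have "norm (cnorm calg (X n \<ominus>\<^bsub>calg\<^esub> mseq x) - 0) < r" if "n \<ge> N" for n
      proof -
        have c: "X n \<ominus>\<^bsub>calg\<^esub> mseq x \<in> carrier calg" by (rule R.minus_closed[OF X y])
        have "cnorm calg (X n \<ominus>\<^bsub>calg\<^esub> mseq x) \<le> r / 2"
          by (rule cnorm_le[OF c]) (use N that in \<open>simp add: fseq_minus[OF X y] fseq_mseq[OF x(1)]\<close>)
        moreover have "0 \<le> cnorm calg (X n \<ominus>\<^bsub>calg\<^esub> mseq x)"
          by (rule order_trans[OF opn_nonneg opn_le_cnorm[OF c]])
        ultimately show ?thesis using \<open>r > 0\<close> by simp
      qed
      then show "\<exists>N. \<forall>n\<ge>N. norm (cnorm calg (X n \<ominus>\<^bsub>calg\<^esub> mseq x) - 0) < r" by blast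
    qed
    with y show "\<exists>x\<in>carrier calg. (\<lambda>n. cnorm calg (X n \<ominus>\<^bsub>calg\<^esub> x)) \<longlonglongrightarrow> 0" by blast
  qed
qed

lemma calg_separable: "separable_cstar calg"
  unfolding separable_cstar_def
proof (intro exI[of _ "mseq ` D"] conjI ballI allI impI)
  interpret R: ring calg by (rule ring_calg)
  show "mseq ` D \<subseteq> carrier calg" using D_alg mseq_carrier by blast
  show "countable (mseq ` D)" using D_countable by (rule countable_image)
  fix x and e :: real assume x: "x \<in> carrier calg" and "e > 0"
  then obtain d where d: "d \<in> D" "\<forall>j. opn (fseq x j - d j) \<le> e / 2"
    using alg_approx[OF calg_fseq[OF x], of "e / 2"] by auto
  have y: "mseq d \<in> carrier calg" by (rule mseq_carrier[OF D_alg[OF d(1)]])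
  have "cnorm calg (x \<ominus>\<^bsub>calg\<^esub> mseq d) \<le> e / 2"
    by (rule cnorm_le[OF R.minus_closed[OF x y]]) (use d in \<open>simp add: fseq_minus[OF x y] fseq_mseq D_alg\<close>)
  then show "\<exists>d\<in>mseq ` D. cnorm calg (x \<ominus>\<^bsub>calg\<^esub> d) < e" using d(1) \<open>e > 0\<close> by force
qed

lemma hom_imp_unital_star_hom:
  assumes h: "hom n f" shows "(\<lambda>b. to_mat n (f (fseq b))) \<in> unital_star_hom calg (mat_cstar n)"
proof -
  have c: "b \<in> carrier calg \<Longrightarrow> f (fseq b) \<in> corner n" for b using h calg_fseq by (simp add: hom_def)
  have o: "f (fseq \<one>\<^bsub>calg\<^esub>) = idn n" using h by (simp add: hom_def fseq_consts)
  have fo: "f (fseq (x \<oplus>\<^bsub>calg\<^esub> y)) = f (fseq x) + f (fseq y)" "f (fseq (x \<otimes>\<^bsub>calg\<^esub> y)) = f (fseq x) * f (fseq y)"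
    "f (fseq (d \<odot>\<^bsub>calg\<^esub> x)) = cscale d (f (fseq x))" "f (fseq (star calg x)) = adj (f (fseq x))"
    if "x \<in> carrier calg" "y \<in> carrier calg" for x y d
    unfolding fseq_ops(1,2)[OF that] fseq_ops(3,4)[OF that(1)]
    using h calg_fseq[OF that(1)] calg_fseq[OF that(2)] by (simp_all add: hom_def)
  show ?thesis
    unfolding unital_star_hom_def star_hom_def
    by (auto simp: mat_cstar_simps fo o to_mat_hom[OF c c] to_mat_hom(5)[OF zero_corner zero_corner])
qed

lemma calg_rfd: "residually_finite_dimensional calg"
  unfolding residually_finite_dimensional_def
proof (intro ballI impI)
  fix x y assume xy: "x \<in> carrier calg" "y \<in> carrier calg" "x \<noteq> y"
  then have "fseq x \<noteq> fseq y" using calg_eqI by blast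
  then obtain j where j: "fseq x j \<noteq> fseq y j" by blast
  have "to_mat (k j) (fseq x j) \<noteq> to_mat (k j) (fseq y j)"
    using j of_to_mat[OF alg_corner[OF calg_fseq[OF xy(1)]]] of_to_mat[OF alg_corner[OF calg_fseq[OF xy(2)]]] by metis
  moreover have "(\<lambda>b. to_mat (k j) (fseq b j)) \<in> star_hom calg (mat_cstar (k j))"
    using hom_imp_unital_star_hom[OF hom_coordinate[of j]] by (simp add: unital_star_hom_def)
  ultimately show "\<exists>n. \<exists>h\<in>star_hom calg (mat_cstar n). h x \<noteq> h y" by (intro exI bexI)
qed

lemma tracial_state_imp_tracial:
  assumes t: "tracial_state calg \<tau>" shows "tracial (\<lambda>a. \<tau> (mseq a))"
  using t unfolding tracial_def tracial_state_def
  by (auto simp: mseq_ops mseq_carrier alg_adj mseq_ops(5)[OF alg_zero alg_zero])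

lemma calg_traces:
  assumes "tracial_state calg \<tau>"
  shows "\<exists>n0\<ge>1. \<exists>\<rho> :: nat \<Rightarrow> (nat \<Rightarrow> complex mat) \<Rightarrow> complex mat.
          (\<forall>n\<ge>n0. \<rho> n \<in> unital_star_hom calg (mat_cstar n)) \<and>
          (\<forall>a\<in>carrier calg. (\<lambda>n. norm_trace n (\<rho> n a)) \<longlonglongrightarrow> \<tau> a)"
proof -
  obtain \<rho> where \<rho>: "\<forall>n\<ge>1. hom n (\<rho> n)" "\<forall>a\<in>alg. (\<lambda>n. tr (\<rho> n a) / of_nat n) \<longlonglongrightarrow> \<tau> (mseq a)"
    using tracial_approximation[OF tracial_state_imp_tracial[OF assms]] by blast
  show ?thesis
  proof (rule exI[of _ 1], intro conjI exI[of _ "\<lambda>n b. to_mat n (\<rho> n (fseq b))"] ballI allI impI)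
    fix n :: nat assume "1 \<le> n"
    then show "(\<lambda>b. to_mat n (\<rho> n (fseq b))) \<in> unital_star_hom calg (mat_cstar n)"
      using \<rho>(1) hom_imp_unital_star_hom by blast
  next
    fix a assume a: "a \<in> carrier calg"
    have "(\<lambda>n. tr (\<rho> n (fseq a)) / of_nat n) \<longlonglongrightarrow> \<tau> a"
      using \<rho>(2) calg_fseq[OF a] mseq_fseq[OF a] by metis
    moreover have "\<forall>\<^sub>F n in sequentially. norm_trace n (to_mat n (\<rho> n (fseq a))) = tr (\<rho> n (fseq a)) / of_nat n"
      using eventually_ge_at_top[of 1]
    proof eventually_elim
      case (elim n)
      then have "\<rho> n (fseq a) \<in> corner n" using \<rho>(1) calg_fseq[OF a] by (simp add: hom_def)
      then show ?case by (rule norm_trace_to_mat)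
    qed
    ultimately show "(\<lambda>n. norm_trace n (to_mat n (\<rho> n (fseq a)))) \<longlonglongrightarrow> \<tau> a"
      by (simp add: tendsto_cong)
  qed simp
qed

end

section \<open>A nontrivial ultrafilter and bounded matrix families\<close>

text \<open>A minimal proper filter below the cofinite filter, by Zorn's lemma. If a set does not belong to it,
  adding the complement gives a proper filter that is at least as fine, hence the same one.\<close>

lemma ultrafilter_below_sequentially:
  obtains \<alpha> :: "nat filter" where "nontrivial_ultrafilter_on {1..} \<alpha>" "\<alpha> \<le> sequentially"
proof -
  let ?A = "{F :: nat filter. F \<noteq> bot \<and> F \<le> sequentially}" and ?P = "\<lambda>F G :: nat filter. G \<le> F"
  have "\<exists>m\<in>?A. \<forall>a\<in>?A. ?P m a \<longrightarrow> a = m"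
  proof (rule predicate_Zorn)
    show "partial_order_on ?A (relation_of ?P ?A)"
      by (rule partial_order_on_relation_ofI) auto
    fix C assume C: "C \<in> Chains (relation_of ?P ?A)"
    have sub: "C \<subseteq> ?A" using C by (auto simp: Chains_def relation_of_def)
    show "\<exists>u\<in>?A. \<forall>a\<in>C. ?P a u"
    proof (cases "C = {}")
      case True
      then show ?thesis by (intro bexI[of _ sequentially]) auto
    next
      case False
      have "\<exists>x\<in>C. x \<le> inf F G" if FG: "F \<in> C" "G \<in> C" for F G
      proof -
        have "F \<le> G \<or> G \<le> F" using C FG by (auto simp: Chains_def relation_of_def)
        then show ?thesis using FG by (metis inf.orderE inf.commute order_refl)
      qed
      then have ev: "eventually Q (Inf C) \<longleftrightarrow> (\<exists>b\<in>C. eventually Q b)" for Q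
        by (intro eventually_Inf_base[OF False])
      have "Inf C \<noteq> bot" using sub ev[of "\<lambda>x. False"] by (auto simp: trivial_limit_def)
      moreover obtain F where "F \<in> C" using False by blast
      then have "Inf C \<le> sequentially" using sub Inf_lower[of F C] by (auto intro: order_trans)
      ultimately show ?thesis by (intro bexI[of _ "Inf C"]) (auto intro: Inf_lower)
    qed
  qed
  then obtain m where m: "m \<noteq> bot" "m \<le> sequentially"
    and max: "\<And>F. F \<noteq> bot \<Longrightarrow> F \<le> sequentially \<Longrightarrow> F \<le> m \<Longrightarrow> F = m" by auto
  have "eventually (\<lambda>i. i \<in> - E) m" if E: "\<not> eventually (\<lambda>i. i \<in> E) m" for E
  proof -
    let ?F = "inf m (principal (- E))"
    have "?F \<noteq> bot" using E by (simp add: trivial_limit_def eventually_inf_principal)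
    moreover have "?F \<le> sequentially" using m(2) by (rule le_infI1)
    ultimately have "?F = m" by (rule max) simp
    moreover have "eventually (\<lambda>i. i \<in> - E) ?F" by (simp add: eventually_inf_principal)
    ultimately show ?thesis by simp
  qed
  note dich = this
  have ge: "eventually (\<lambda>i. i \<in> {n..}) m" for n
    using m(2) by (rule filter_leD) (simp add: eventually_ge_at_top)
  have "eventually (\<lambda>i. i \<in> E) m \<or> eventually (\<lambda>i. i \<in> {1..} - E) m" for E
  proof (cases "eventually (\<lambda>i. i \<in> E) m")
    case False
    show ?thesis using eventually_conj[OF ge[of 1] dich[OF False]] by simp
  qed simp
  then have "ultrafilter_on {1..} m" using m(1) ge[of 1] by (simp add: ultrafilter_on_def)
  moreover have "(\<Inter>n. {Suc n..}) = {}" using Suc_n_not_le_n by blast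
  then have "\<exists>E :: nat \<Rightarrow> nat set. (\<forall>n. E n \<subseteq> {1..} \<and> eventually (\<lambda>i. i \<in> E n) m) \<and> (\<Inter>n. E n) = {}"
    by (intro exI[of _ "\<lambda>n. {Suc n..}"] conjI allI ge) auto
  ultimately have "nontrivial_ultrafilter_on {1..} m" unfolding nontrivial_ultrafilter_on_def by (rule conjI)
  then show thesis using m(2) by (rule that)
qed

lemma mats_carrierI:
  assumes "\<And>i. i \<in> I \<Longrightarrow> f i \<in> carrier_mat (n i) (n i)" "\<And>i. i \<in> I \<Longrightarrow> opn (of_mat (f i)) \<le> K"
  shows "(\<lambda>i\<in>I. f i) \<in> carrier (mats I n)"
  unfolding mats_carrier using assms by (auto simp: mat_opnorm_opn[OF assms(1)])

lemma mats_carrierD: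
  assumes "a \<in> carrier (mats I n)"
  shows "i \<in> I \<Longrightarrow> a i \<in> carrier_mat (n i) (n i)" "\<exists>K\<ge>0. \<forall>i\<in>I. opn (of_mat (a i)) \<le> K"
proof -
  show c: "a i \<in> carrier_mat (n i) (n i)" if "i \<in> I" for i using assms that by (auto simp: mats_carrier)
  obtain K where "\<forall>i\<in>I. mat_opnorm (a i) \<le> K" using assms by (auto simp: mats_carrier)
  then have "\<forall>i\<in>I. opn (of_mat (a i)) \<le> max 0 K" using c by (auto simp: mat_opnorm_opn[OF c] le_max_iff_disj)
  then show "\<exists>K\<ge>0. \<forall>i\<in>I. opn (of_mat (a i)) \<le> K" by (intro exI[of _ "max 0 K"]) auto
qed

lemma mats_update: "mats I n\<lparr>carrier := carrier (mats I n)\<rparr> = mats I n"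
  by simp

lemma mats_closed:
  assumes a: "a \<in> carrier (mats I n)"
  shows "(\<lambda>i\<in>I. c \<cdot>\<^sub>m a i) \<in> carrier (mats I n)" "(\<lambda>i\<in>I. mat_adjoint (a i)) \<in> carrier (mats I n)"
    "b \<in> carrier (mats I n) \<Longrightarrow> (\<lambda>i\<in>I. a i + b i) \<in> carrier (mats I n)"
    "b \<in> carrier (mats I n) \<Longrightarrow> (\<lambda>i\<in>I. a i * b i) \<in> carrier (mats I n)"
proof -
  note ca = mats_carrierD(1)[OF a]
  obtain K where K: "K \<ge> 0" "\<And>i. i \<in> I \<Longrightarrow> opn (of_mat (a i)) \<le> K" using mats_carrierD(2)[OF a] by blast
  show "(\<lambda>i\<in>I. c \<cdot>\<^sub>m a i) \<in> carrier (mats I n)"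
    by (rule mats_carrierI[of _ _ _ "cmod c * K"]) (use ca K in \<open>auto simp: of_mat_hom(3)[OF ca ca] intro: mult_left_mono\<close>)
  show "(\<lambda>i\<in>I. mat_adjoint (a i)) \<in> carrier (mats I n)"
    by (rule mats_carrierI[of _ _ _ K]) (use ca K in \<open>auto simp: of_mat_hom(4)[OF ca ca]\<close>)
  assume b: "b \<in> carrier (mats I n)"
  note cb = mats_carrierD(1)[OF b]
  obtain L where L: "L \<ge> 0" "\<And>i. i \<in> I \<Longrightarrow> opn (of_mat (b i)) \<le> L" using mats_carrierD(2)[OF b] by blast
  show "(\<lambda>i\<in>I. a i + b i) \<in> carrier (mats I n)"
  proof (rule mats_carrierI[of _ _ _ "K + L"])
    fix i assume i: "i \<in> I"
    show "a i + b i \<in> carrier_mat (n i) (n i)" using cb[OF i] by (rule add_carrier_mat)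
    show "opn (of_mat (a i + b i)) \<le> K + L"
      using opn_triangle[of "of_mat (a i)" "of_mat (b i)"] K(2)[OF i] L(2)[OF i] unfolding of_mat_hom(1)[OF ca[OF i] cb[OF i]] by linarith
  qed
  show "(\<lambda>i\<in>I. a i * b i) \<in> carrier (mats I n)"
  proof (rule mats_carrierI[of _ _ _ "K * L"])
    fix i assume i: "i \<in> I"
    show "a i * b i \<in> carrier_mat (n i) (n i)" using ca[OF i] cb[OF i] by (rule mult_carrier_mat)
    show "opn (of_mat (a i * b i)) \<le> K * L"
      unfolding of_mat_hom(2)[OF ca[OF i] cb[OF i]]
      by (rule order_trans[OF opn_mult mult_mono[OF K(2)[OF i] L(2)[OF i] K(1) opn_nonneg]])
  qed
qed

lemma mats_consts: "(\<lambda>i\<in>I. 1\<^sub>m (n i)) \<in> carrier (mats I n)" "(\<lambda>i\<in>I. 0\<^sub>m (n i) (n i)) \<in> carrier (mats I n)"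
proof -
  have z: "0\<^sub>m m m \<in> carrier_mat m m" for m :: nat by simp
  show "(\<lambda>i\<in>I. 1\<^sub>m (n i)) \<in> carrier (mats I n)" "(\<lambda>i\<in>I. 0\<^sub>m (n i) (n i)) \<in> carrier (mats I n)"
    by (rule mats_carrierI[of _ _ _ 1]; simp add: of_mat_hom(5,6)[OF z z] opn_idn_le)+
qed

lemma ring_mats_full: "ring (mats I n)"
proof -
  have "ring (mats I n\<lparr>carrier := carrier (mats I n)\<rparr>)"
  proof (rule ring_mats)
    show "carrier (mats I n) \<subseteq> (\<Pi>\<^sub>E i\<in>I. carrier_mat (n i) (n i))" by (auto simp: mats_carrier)
  qed (rule mats_closed mats_consts; assumption?)+
  then show ?thesis by (simp only: mats_update)
qed

lemma of_mat_minus_full: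
  assumes "x \<in> carrier (mats I n)" "y \<in> carrier (mats I n)" "i \<in> I"
  shows "of_mat ((x \<ominus>\<^bsub>mats I n\<^esub> y) i) = of_mat (x i) - of_mat (y i)"
  by (rule of_mat_minus[where S = "carrier (mats I n)" and I = I and n = n, unfolded mats_update, OF ring_mats_full])
    (use assms in \<open>auto simp: mats_carrier\<close>)

lemma norm_trace_of_mat: "A \<in> carrier_mat n n \<Longrightarrow> norm_trace n A = tr (of_mat A) / of_nat n"
  using norm_trace_to_mat[of "of_mat A" n] by (simp add: to_of_mat)

lemma two_norm_mat:
  assumes A: "A \<in> carrier_mat n n"
  shows "two_norm (mat_cstar n) (norm_trace n) A = norm (of_mat A) / sqrt n"
proof -
  note c = mult_carrier_mat[OF mat_adjoint_carrier[OF A] A]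
  have "of_mat (mat_adjoint A * A) = adj (of_mat A) * of_mat A"
    by (simp only: of_mat_hom(2)[OF mat_adjoint_carrier[OF A] A] of_mat_hom(4)[OF A A])
  then have "norm_trace n (mat_adjoint A * A) = of_real ((norm (of_mat A))\<^sup>2 / n)"
    unfolding norm_trace_of_mat[OF c] by (simp add: tr_adj_self_norm)
  then show ?thesis by (simp add: two_norm_def mat_cstar_simps real_sqrt_divide del: of_real_power of_real_divide)
qed

lemma tracial_state_norm_trace:
  assumes "1 \<le> n" shows "tracial_state (mat_cstar n) (norm_trace n)"
  unfolding tracial_state_def mat_cstar_simps
proof (intro conjI ballI allI)
  fix A B :: "complex mat" and c assume A: "A \<in> carrier_mat n n" and B: "B \<in> carrier_mat n n"
  note h = of_mat_hom[OF A B] of_mat_hom[OF B A]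
  show "norm_trace n (A + B) = norm_trace n A + norm_trace n B"
    using A B by (simp add: norm_trace_of_mat h tr_simps add_divide_distrib)
  show "norm_trace n (A * B) = norm_trace n (B * A)"
    using A B by (simp add: norm_trace_of_mat[OF mult_carrier_mat[OF A B]] norm_trace_of_mat[OF mult_carrier_mat[OF B A]] h tr_commute)
next
  fix A :: "complex mat" and c assume A: "A \<in> carrier_mat n n"
  show "norm_trace n (c \<cdot>\<^sub>m A) = c * norm_trace n A"
    using A by (simp add: norm_trace_of_mat of_mat_hom(3)[OF A A] tr_simps)
  have "norm_trace n (mat_adjoint A * A) = of_real ((norm (of_mat A))\<^sup>2 / n)"
    unfolding norm_trace_of_mat[OF mult_carrier_mat[OF mat_adjoint_carrier[OF A] A]]
      of_mat_hom(2)[OF mat_adjoint_carrier[OF A] A] of_mat_hom(4)[OF A A] by (simp add: tr_adj_self_norm)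
  then show "0 \<le> norm_trace n (mat_adjoint A * A)" by (simp add: less_eq_complex_def del: of_real_power of_real_divide)
next
  show "norm_trace n (1\<^sub>m n) = 1" using assms by (simp add: norm_trace_def)
qed

section \<open>Tracial ultraproducts of matrix algebras\<close>

locale matrix_ultraproduct =
  fixes I :: "nat set" and \<alpha> :: "nat filter" and n :: "nat \<Rightarrow> nat"
  assumes \<alpha>_I: "eventually (\<lambda>i. i \<in> I) \<alpha>"
begin

abbreviation "J \<equiv> trace_ideal I \<alpha> (\<lambda>i. mat_cstar (n i)) (\<lambda>i. norm_trace (n i))"
abbreviation "U \<equiv> tracial_ultraproduct I \<alpha> (\<lambda>i. mat_cstar (n i)) (\<lambda>i. norm_trace (n i))"

text \<open>Membership in the ideal, expressed for families of finitely supported matrices, where differences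
  can be formed without side conditions.\<close>

definition null :: "(nat \<Rightarrow> fmat) \<Rightarrow> bool" where
  "null x \<longleftrightarrow> ((\<lambda>i. norm (x i) / sqrt (n i)) \<longlongrightarrow> 0) \<alpha>"

lemma null_bound:
  assumes "null x" "\<And>i. i \<in> I \<Longrightarrow> norm (y i) \<le> K * norm (x i)" shows "null y"
  unfolding null_def
proof (rule Lim_null_comparison)
  show "\<forall>\<^sub>F i in \<alpha>. norm (norm (y i) / sqrt (n i)) \<le> K * (norm (x i) / sqrt (n i))"
    using \<alpha>_I by eventually_elim (simp add: divide_right_mono assms(2))
  show "((\<lambda>i. K * (norm (x i) / sqrt (n i))) \<longlongrightarrow> 0) \<alpha>"
    using tendsto_mult_left[OF assms(1)[unfolded null_def], of K] by simp
qed

lemma null_cong: "null x \<Longrightarrow> (\<And>i. i \<in> I \<Longrightarrow> y i = x i) \<Longrightarrow> null y"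
  by (rule null_bound[of x _ 1]) auto

lemma null_add:
  assumes "null x" "null y" shows "null (\<lambda>i. x i + y i)"
  unfolding null_def
proof (rule Lim_null_comparison)
  show "\<forall>\<^sub>F i in \<alpha>. norm (norm (x i + y i) / sqrt (n i)) \<le> norm (x i) / sqrt (n i) + norm (y i) / sqrt (n i)"
    by (rule always_eventually) (simp add: add_divide_distrib[symmetric] divide_right_mono norm_triangle_ineq)
  show "((\<lambda>i. norm (x i) / sqrt (n i) + norm (y i) / sqrt (n i)) \<longlongrightarrow> 0) \<alpha>"
    using tendsto_add[OF assms[unfolded null_def]] by simp
qed

lemma J_iff: "a \<in> J \<longleftrightarrow> a \<in> carrier (mats I n) \<and> null (\<lambda>i. of_mat (a i))"
proof -
  have "((\<lambda>i. two_norm (mat_cstar (n i)) (norm_trace (n i)) (a i)) \<longlongrightarrow> 0) \<alpha> \<longleftrightarrow> null (\<lambda>i. of_mat (a i))"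
    if a: "a \<in> carrier (mats I n)"
    unfolding null_def
    by (rule tendsto_cong) (use \<alpha>_I in eventually_elim, simp add: two_norm_mat[OF mats_carrierD(1)[OF a]])
  then show ?thesis by (auto simp: trace_ideal_def)
qed

lemma J_ideal: "ideal J (mats I n)"
proof (rule idealI)
  interpret P: ring "mats I n" by (rule ring_mats_full)
  show "ring (mats I n)" by (rule ring_mats_full)
  have Jc: "x \<in> carrier (mats I n)" and Jn: "null (\<lambda>i. of_mat (x i))" if "x \<in> J" for x
    using that by (simp_all add: J_iff)
  show "subgroup J (add_monoid (mats I n))"
  proof (rule P.add.subgroupI)
    show "J \<subseteq> carrier (mats I n)" using Jc by blast
    have "\<zero>\<^bsub>mats I n\<^esub> \<in> J" unfolding J_iff
    proof
      show "\<zero>\<^bsub>mats I n\<^esub> \<in> carrier (mats I n)" by (rule P.zero_closed)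
      have z: "0\<^sub>m m m \<in> carrier_mat m m" for m :: nat by simp
      show "null (\<lambda>i. of_mat (\<zero>\<^bsub>mats I n\<^esub> i))"
        by (rule null_cong[of "\<lambda>i. 0"]) (simp_all add: null_def of_mat_hom(6)[OF z z])
    qed
    then show "J \<noteq> {}" by blast
    fix x y assume x: "x \<in> J"
    have "\<ominus>\<^bsub>mats I n\<^esub> x \<oplus>\<^bsub>mats I n\<^esub> x = \<zero>\<^bsub>mats I n\<^esub>" by (rule P.l_neg[OF Jc[OF x]])
    have nc: "\<ominus>\<^bsub>mats I n\<^esub> x \<in> carrier (mats I n)" by (rule P.a_inv_closed[OF Jc[OF x]])
    have "of_mat ((\<ominus>\<^bsub>mats I n\<^esub> x) i) = - of_mat (x i)" if "i \<in> I" for i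
    proof -
      have z: "0\<^sub>m m m \<in> carrier_mat m m" for m :: nat by simp
      have "\<zero>\<^bsub>mats I n\<^esub> \<ominus>\<^bsub>mats I n\<^esub> x = \<ominus>\<^bsub>mats I n\<^esub> x"
        by (simp only: P.minus_eq P.l_zero[OF nc])
      then show ?thesis
        using of_mat_minus_full[OF P.zero_closed Jc[OF x] that] that by (simp add: of_mat_hom(6)[OF z z])
    qed
    then show "\<ominus>\<^bsub>mats I n\<^esub> x \<in> J"
      unfolding J_iff using nc null_bound[OF Jn[OF x], of "\<lambda>i. of_mat ((\<ominus>\<^bsub>mats I n\<^esub> x) i)" 1] by simp
    assume y: "y \<in> J"
    have "null (\<lambda>i. of_mat ((x \<oplus>\<^bsub>mats I n\<^esub> y) i))"
      by (rule null_cong[OF null_add[OF Jn[OF x] Jn[OF y]]])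
        (simp add: of_mat_hom(1)[OF mats_carrierD(1)[OF Jc[OF x]] mats_carrierD(1)[OF Jc[OF y]]])
    then show "x \<oplus>\<^bsub>mats I n\<^esub> y \<in> J" unfolding J_iff using P.a_closed[OF Jc[OF x] Jc[OF y]] by blast
  qed
  fix a x assume a: "a \<in> J" and x: "x \<in> carrier (mats I n)"
  note ca = mats_carrierD(1)[OF Jc[OF a]] and cx = mats_carrierD(1)[OF x]
  obtain K where K: "K \<ge> 0" "\<And>i. i \<in> I \<Longrightarrow> opn (of_mat (x i)) \<le> K" using mats_carrierD(2)[OF x] by blast
  have "null (\<lambda>i. of_mat ((x \<otimes>\<^bsub>mats I n\<^esub> a) i))"
  proof (rule null_bound[OF Jn[OF a]])
    fix i assume i: "i \<in> I"
    show "norm (of_mat ((x \<otimes>\<^bsub>mats I n\<^esub> a) i)) \<le> K * norm (of_mat (a i))"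
      using order_trans[OF norm_mult_opn mult_right_mono[OF K(2)[OF i] norm_ge_zero]] i
      by (simp add: of_mat_hom(2)[OF cx[OF i] ca[OF i]])
  qed
  then show "x \<otimes>\<^bsub>mats I n\<^esub> a \<in> J" unfolding J_iff using P.m_closed[OF x Jc[OF a]] by blast
  have "null (\<lambda>i. of_mat ((a \<otimes>\<^bsub>mats I n\<^esub> x) i))"
  proof (rule null_bound[OF Jn[OF a]])
    fix i assume i: "i \<in> I"
    show "norm (of_mat ((a \<otimes>\<^bsub>mats I n\<^esub> x) i)) \<le> K * norm (of_mat (a i))"
      using order_trans[OF norm_mult_opn_right mult_left_mono[OF K(2)[OF i] norm_ge_zero]] i
      by (simp add: of_mat_hom(2)[OF ca[OF i] cx[OF i]] mult.commute)
  qed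
  then show "a \<otimes>\<^bsub>mats I n\<^esub> x \<in> J" unfolding J_iff using P.m_closed[OF Jc[OF a] x] by blast
qed

definition coset :: "(nat \<Rightarrow> complex mat) \<Rightarrow> (nat \<Rightarrow> complex mat) set" where
  "coset a = J +>\<^bsub>mats I n\<^esub> a"

lemma coset_eq_iff:
  assumes a: "a \<in> carrier (mats I n)" and b: "b \<in> carrier (mats I n)"
  shows "coset a = coset b \<longleftrightarrow> null (\<lambda>i. of_mat (a i) - of_mat (b i))"
proof -
  interpret P: ring "mats I n" by (rule ring_mats_full)
  have "null (\<lambda>i. of_mat ((a \<ominus>\<^bsub>mats I n\<^esub> b) i)) \<longleftrightarrow> null (\<lambda>i. of_mat (a i) - of_mat (b i))"
    using null_cong[of "\<lambda>i. of_mat ((a \<ominus>\<^bsub>mats I n\<^esub> b) i)" "\<lambda>i. of_mat (a i) - of_mat (b i)"]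
      null_cong[of "\<lambda>i. of_mat (a i) - of_mat (b i)" "\<lambda>i. of_mat ((a \<ominus>\<^bsub>mats I n\<^esub> b) i)"]
      of_mat_minus_full[OF a b] by auto
  then show ?thesis
    unfolding coset_def P.quotient_eq_iff_same_a_r_cos[OF J_ideal a b, symmetric] J_iff
    using P.minus_closed[OF a b] by blast
qed

lemma coset_memD:
  assumes "x \<in> coset a"
  shows "\<exists>j\<in>J. x = (\<lambda>i\<in>I. j i + a i)"
  using assms by (auto simp: coset_def a_r_coset_def')

lemma coset_self:
  assumes "a \<in> carrier (mats I n)" shows "a \<in> coset a"
proof -
  interpret i: ideal J "mats I n" by (rule J_ideal)
  show ?thesis unfolding coset_def by (rule i.a_rcos_self[OF assms])
qed

lemma coset_repr:
  assumes a: "a \<in> carrier (mats I n)" and x: "x \<in> coset a"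
  shows "x \<in> carrier (mats I n)" "coset a = coset x"
proof -
  interpret i: ideal J "mats I n" by (rule J_ideal)
  show "x \<in> carrier (mats I n)" using x a unfolding coset_def by (rule i.a_elemrcos_carrier[rotated])
  show "coset a = coset x" using x a i.a_subgroup unfolding coset_def by (rule i.a_repr_independence)
qed

text \<open>Scalar multiplication and star of the quotient are unions over a coset. Since the ideal is closed under
  both operations, all members of the union agree.\<close>

lemma U_ops:
  assumes a: "a \<in> carrier (mats I n)" and b: "b \<in> carrier (mats I n)"
  shows "coset a \<in> carrier U"
    "coset a \<oplus>\<^bsub>U\<^esub> coset b = coset (\<lambda>i\<in>I. a i + b i)" "coset a \<otimes>\<^bsub>U\<^esub> coset b = coset (\<lambda>i\<in>I. a i * b i)"
    "c \<odot>\<^bsub>U\<^esub> coset a = coset (\<lambda>i\<in>I. c \<cdot>\<^sub>m a i)" "star U (coset a) = coset (\<lambda>i\<in>I. mat_adjoint (a i))"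
    "\<one>\<^bsub>U\<^esub> = coset (\<lambda>i\<in>I. 1\<^sub>m (n i))"
proof -
  interpret i: ideal J "mats I n" by (rule J_ideal)
  have u: "U = cstar_quotient (mats I n) J" by (simp add: tracial_ultraproduct_def)
  show "coset a \<in> carrier U"
    unfolding u cstar_quotient_def coset_def using i.a_rcosetsI[OF i.a_subset a] by (simp add: FactRing_def)
  show "coset a \<oplus>\<^bsub>U\<^esub> coset b = coset (\<lambda>i\<in>I. a i + b i)"
    unfolding u cstar_quotient_def coset_def using i.a_rcos_sum[OF a b] by (simp add: FactRing_def)
  show "coset a \<otimes>\<^bsub>U\<^esub> coset b = coset (\<lambda>i\<in>I. a i * b i)"
    unfolding u cstar_quotient_def coset_def using i.rcoset_mult_add[OF a b] by (simp add: FactRing_def)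
  show "\<one>\<^bsub>U\<^esub> = coset (\<lambda>i\<in>I. 1\<^sub>m (n i))"
    unfolding u cstar_quotient_def coset_def by (simp add: FactRing_def)
  have sm: "c \<odot>\<^bsub>U\<^esub> coset a = (\<Union>x\<in>coset a. coset (\<lambda>i\<in>I. c \<cdot>\<^sub>m x i))"
    and st: "star U (coset a) = (\<Union>x\<in>coset a. coset (\<lambda>i\<in>I. mat_adjoint (x i)))"
    unfolding u cstar_quotient_def by (simp_all add: coset_def)
  have "coset (\<lambda>i\<in>I. c \<cdot>\<^sub>m x i) = coset (\<lambda>i\<in>I. c \<cdot>\<^sub>m a i)"
    and "coset (\<lambda>i\<in>I. mat_adjoint (x i)) = coset (\<lambda>i\<in>I. mat_adjoint (a i))" if x: "x \<in> coset a" for x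
  proof -
    note xc = coset_repr(1)[OF a x] and e = coset_repr(2)[OF a x]
    note mx = mats_carrierD(1)[OF xc] and ma = mats_carrierD(1)[OF a]
    have nl: "null (\<lambda>i. of_mat (x i) - of_mat (a i))" using e unfolding coset_eq_iff[OF xc a, symmetric] by simp
    show "coset (\<lambda>i\<in>I. c \<cdot>\<^sub>m x i) = coset (\<lambda>i\<in>I. c \<cdot>\<^sub>m a i)"
      unfolding coset_eq_iff[OF mats_closed(1)[OF xc] mats_closed(1)[OF a]]
    proof (rule null_bound[OF nl])
      fix i assume i: "i \<in> I"
      have "cscale c (of_mat (x i)) - cscale c (of_mat (a i)) = cscale c (of_mat (x i) - of_mat (a i))" by (simp add: cscale_simps)
      then show "norm (of_mat ((\<lambda>i\<in>I. c \<cdot>\<^sub>m x i) i) - of_mat ((\<lambda>i\<in>I. c \<cdot>\<^sub>m a i) i)) \<le> cmod c * norm (of_mat (x i) - of_mat (a i))"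
        using i by (simp add: of_mat_hom(3)[OF mx[OF i] mx[OF i]] of_mat_hom(3)[OF ma[OF i] ma[OF i]])
    qed
    show "coset (\<lambda>i\<in>I. mat_adjoint (x i)) = coset (\<lambda>i\<in>I. mat_adjoint (a i))"
      unfolding coset_eq_iff[OF mats_closed(2)[OF xc] mats_closed(2)[OF a]]
    proof (rule null_bound[OF nl])
      fix i assume i: "i \<in> I"
      have "norm (adj (of_mat (x i)) - adj (of_mat (a i))) = norm (of_mat (x i) - of_mat (a i))"
        using norm_adj[of "of_mat (x i) - of_mat (a i)"] by (simp add: adj_simps del: norm_adj)
      then show "norm (of_mat ((\<lambda>i\<in>I. mat_adjoint (x i)) i) - of_mat ((\<lambda>i\<in>I. mat_adjoint (a i)) i)) \<le> 1 * norm (of_mat (x i) - of_mat (a i))"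
        using i by (simp add: of_mat_hom(4)[OF mx[OF i] mx[OF i]] of_mat_hom(4)[OF ma[OF i] ma[OF i]])
    qed
  qed
  then show "c \<odot>\<^bsub>U\<^esub> coset a = coset (\<lambda>i\<in>I. c \<cdot>\<^sub>m a i)" "star U (coset a) = coset (\<lambda>i\<in>I. mat_adjoint (a i))"
    unfolding sm st using coset_self[OF a] by blast+
qed

end

section \<open>A homomorphism without approximate lift\<close>

context tower
begin

lemma k_lower: "i \<ge> 1 \<Longrightarrow> 10 ^ 6 \<le> k i"
  using k_growth[of 0 i] k_0 by simp

lemma k_ge_index: "i < k i"
proof (induction i)
  case 0
  show ?case by (rule k_pos)
next
  case (Suc i)
  then show ?case using k_growth[of i "Suc i"] by simp
qed

lemma unital_star_hom_imp_hom:
  assumes h: "h \<in> unital_star_hom calg (mat_cstar n)"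
  shows "hom n (\<lambda>a. of_mat (h (mseq a)))"
proof -
  have c: "h x \<in> carrier_mat n n" if "x \<in> carrier calg" for x
    using h that by (auto simp: unital_star_hom_def star_hom_def mat_cstar_simps)
  have o: "h (x \<oplus>\<^bsub>calg\<^esub> y) = h x + h y" "h (x \<otimes>\<^bsub>calg\<^esub> y) = h x * h y" "h (d \<odot>\<^bsub>calg\<^esub> x) = d \<cdot>\<^sub>m h x"
    "h (star calg x) = mat_adjoint (h x)" if "x \<in> carrier calg" "y \<in> carrier calg" for x y d
    using h that by (auto simp: unital_star_hom_def star_hom_def mat_cstar_simps)
  have one: "h \<one>\<^bsub>calg\<^esub> = 1\<^sub>m n" using h by (simp add: unital_star_hom_def mat_cstar_simps)
  have z: "0\<^sub>m m m \<in> carrier_mat m m" for m :: nat by simp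
  show ?thesis unfolding hom_def
  proof (intro conjI ballI allI)
    show "of_mat (h (mseq (\<lambda>j. idn (k j)))) = idn n"
      by (simp add: mseq_ops(5)[OF alg_zero alg_zero] one of_mat_hom(5)[OF z z])
    fix a assume a: "a \<in> alg"
    note ma = mseq_carrier[OF a]
    show "of_mat (h (mseq a)) \<in> corner n" by (rule of_mat_corner[OF c[OF ma]])
    show "of_mat (h (mseq (\<lambda>j. adj (a j)))) = adj (of_mat (h (mseq a)))"
      by (simp only: mseq_ops(4)[OF a a] o(4)[OF ma ma] of_mat_hom(4)[OF c[OF ma] c[OF ma]])
    show "of_mat (h (mseq (\<lambda>j. cscale d (a j)))) = cscale d (of_mat (h (mseq a)))" for d
      by (simp only: mseq_ops(3)[OF a a] o(3)[OF ma ma] of_mat_hom(3)[OF c[OF ma] c[OF ma]])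
    fix b assume b: "b \<in> alg"
    note mb = mseq_carrier[OF b]
    show "of_mat (h (mseq (\<lambda>j. a j + b j))) = of_mat (h (mseq a)) + of_mat (h (mseq b))"
      by (simp only: mseq_ops(1)[OF a b] o(1)[OF ma mb] of_mat_hom(1)[OF c[OF ma] c[OF mb]])
    show "of_mat (h (mseq (\<lambda>j. a j * b j))) = of_mat (h (mseq a)) * of_mat (h (mseq b))"
      by (simp only: mseq_ops(2)[OF a b] o(2)[OF ma mb] of_mat_hom(2)[OF c[OF ma] c[OF mb]])
  qed
qed

definition squeeze :: "nat \<Rightarrow> fmat \<Rightarrow> fmat" where
  "squeeze i x = idn (k i - 1) * x * idn (k i - 1)"

definition compression :: "(nat \<Rightarrow> complex mat) \<Rightarrow> nat \<Rightarrow> complex mat" where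
  "compression b = (\<lambda>i\<in>{1..}. to_mat (k i - 1) (squeeze i (fseq b i)))"

lemma of_mat_compression: "i \<in> {1..} \<Longrightarrow> of_mat (compression b i) = squeeze i (fseq b i)"
  by (simp add: compression_def squeeze_def of_to_mat[OF compress_corner])

lemma compression_carrier:
  assumes b: "b \<in> carrier calg" shows "compression b \<in> carrier (mats {1..} (\<lambda>i. k i - 1))"
  unfolding compression_def
proof (rule mats_carrierI)
  fix i :: nat assume "i \<in> {1..}"
  have "opn (squeeze i (fseq b i)) \<le> 1 * opn (fseq b i) * 1"
    unfolding squeeze_def
    by (intro order_trans[OF opn_mult] mult_mono order_refl opn_idn_le opn_nonneg mult_nonneg_nonneg zero_le_one)
  also have "\<dots> \<le> cnorm calg b" using opn_le_cnorm[OF b] by simp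
  finally show "opn (of_mat (to_mat (k i - 1) (squeeze i (fseq b i)))) \<le> cnorm calg b"
    by (simp add: squeeze_def of_to_mat[OF compress_corner])
qed simp

text \<open>With \<open>p\<close> the unit of the corner, \<open>p x y p - p x p y p = p x (1 - p) y p\<close>, and \<open>1 - p\<close> is a matrix unit, of
  Hilbert-Schmidt norm one.\<close>

lemma squeeze_mult_defect:
  assumes i: "i \<ge> 1" and x: "x \<in> corner (k i)" and y: "y \<in> corner (k i)"
  shows "norm (squeeze i (x * y) - squeeze i x * squeeze i y) \<le> opn x * opn y"
proof -
  define n where "n = k i - 1"
  have kn: "k i = Suc n" using k_pos[of i] by (simp add: n_def)
  have e: "idn (k i) = idn n + munit n n" by (rule fmat_eqI) (auto simp: ent_idn ent_munit kn)
  have "squeeze i (x * y) - squeeze i x * squeeze i y = idn n * (x * munit n n * y) * idn n"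
  proof -
    have "x * y = x * idn (k i) * y" by (simp only: idn_mult_right[OF x order_refl])
    also have "\<dots> = x * idn n * y + x * munit n n * y" by (simp add: e distrib_left distrib_right)
    finally have xy: "x * y = x * idn n * y + x * munit n n * y" .
    have "idn n * x * idn n * (idn n * y * idn n) = idn n * x * (idn n * idn n) * y * idn n" by (simp only: mult.assoc)
    also have "\<dots> = idn n * (x * idn n * y) * idn n" by (simp only: idn_mult_idn min.idem mult.assoc)
    finally have "idn n * x * idn n * (idn n * y * idn n) = idn n * (x * idn n * y) * idn n" .
    then show ?thesis unfolding squeeze_def n_def[symmetric] xy by (simp add: distrib_left distrib_right)
  qed
  also have "norm \<dots> \<le> norm (idn n * (x * munit n n * y)) * 1"
    by (rule order_trans[OF norm_mult_opn_right mult_left_mono[OF opn_idn_le norm_ge_zero]])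
  also have "\<dots> \<le> norm (x * munit n n * y)"
    using order_trans[OF norm_mult_opn mult_right_mono[OF opn_idn_le norm_ge_zero]] by simp
  also have "\<dots> \<le> norm (x * munit n n) * opn y" by (rule norm_mult_opn_right)
  also have "\<dots> \<le> opn x * opn y"
    using norm_mult_opn[of x "munit n n"] by (simp add: mult_right_mono)
  finally show ?thesis .
qed

text \<open>The compressions to the corners of size \<open>k i - 1\<close> form a homomorphism into the ultraproduct, since their
  multiplicative defect is bounded in Hilbert-Schmidt norm while \<open>k i\<close> tends to infinity. A lift would be
  within \<open>1 / 100\<close> of the compression in normalized norm on the three unitaries for some \<open>i\<close>, against
  \<open>compression_far_from_hom\<close>.\<close>

lemma calg_not_stable: "\<not> matricially_tracially_stable TYPE(nat) calg"
proof
  assume stable: "matricially_tracially_stable TYPE(nat) calg"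
  obtain \<alpha> :: "nat filter" where \<alpha>: "nontrivial_ultrafilter_on {1..} \<alpha>" "\<alpha> \<le> sequentially"
    by (rule ultrafilter_below_sequentially)
  have \<alpha>1: "\<alpha> \<noteq> bot" "eventually (\<lambda>i. i \<in> {1..}) \<alpha>"
    using \<alpha>(1) by (simp_all add: nontrivial_ultrafilter_on_def ultrafilter_on_def)
  interpret M: matrix_ultraproduct "{1..}" \<alpha> "\<lambda>i. k i - 1" by unfold_locales (rule \<alpha>1(2))
  let ?\<pi> = "\<lambda>b. M.coset (compression b)" and ?I = "{1..} :: nat set"
  have n1: "1 \<le> k i - 1" if "i \<in> ?I" for i using k_lower[of i] that by simp
  \<comment> \<open>Bounded families are null because the sizes tend to infinity along the ultrafilter.\<close>
  have small: "M.null x" if x: "\<And>i. i \<in> ?I \<Longrightarrow> norm (x i) \<le> C" for x C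
    unfolding M.null_def
  proof (rule Lim_null_comparison)
    show "\<forall>\<^sub>F i in \<alpha>. norm (norm (x i) / sqrt (real (k i - 1))) \<le> C * (1 / sqrt (real (k i - 1)))"
      using \<alpha>1(2) by eventually_elim (use x in \<open>simp add: divide_right_mono\<close>)
    have "i \<le> k i - 1" for i using k_ge_index[of i] by simp
    then have "filterlim (\<lambda>i. k i - 1) at_top sequentially"
      by (intro filterlim_at_top_mono[OF filterlim_ident] always_eventually) blast
    then have "filterlim (\<lambda>i. sqrt (real (k i - 1))) at_top sequentially"
      by (intro filterlim_compose[OF sqrt_at_top] filterlim_compose[OF filterlim_real_sequentially])
    then have "((\<lambda>i. 1 / sqrt (real (k i - 1))) \<longlongrightarrow> 0) sequentially"
      using tendsto_divide_0[OF tendsto_const filterlim_at_top_imp_at_infinity] by blast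
    then have "((\<lambda>i. 1 / sqrt (real (k i - 1))) \<longlongrightarrow> 0) \<alpha>" by (rule tendsto_mono[OF \<alpha>(2)])
    from tendsto_mult_left[OF this, of C]
    show "((\<lambda>i. C * (1 / sqrt (real (k i - 1)))) \<longlongrightarrow> 0) \<alpha>" by simp
  qed
  have "?\<pi> \<in> unital_star_hom calg M.U"
    unfolding unital_star_hom_def star_hom_def
  proof (intro CollectI conjI ballI allI Pi_I)
    fix a assume a: "a \<in> carrier calg"
    note ca = compression_carrier[OF a] and fa = alg_corner[OF calg_fseq[OF a]]
    show "?\<pi> a \<in> carrier M.U" by (rule M.U_ops(1)[OF ca ca])
    note ma = mats_carrierD(1)[OF ca]
    show "?\<pi> (c \<odot>\<^bsub>calg\<^esub> a) = c \<odot>\<^bsub>M.U\<^esub> ?\<pi> a" for c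
      unfolding M.U_ops(4)[OF ca ca] M.coset_eq_iff[OF compression_carrier[OF calg_closed(3)[OF a]] mats_closed(1)[OF ca]]
      by (rule small[of _ 0]) (simp add: of_mat_hom(3)[OF ma ma] of_mat_compression fseq_ops[OF a] squeeze_def cscale_mult_left cscale_mult_right)
    show "?\<pi> (star calg a) = star M.U (?\<pi> a)"
      unfolding M.U_ops(5)[OF ca ca] M.coset_eq_iff[OF compression_carrier[OF calg_closed(4)[OF a]] mats_closed(2)[OF ca]]
      by (rule small[of _ 0]) (simp add: of_mat_hom(4)[OF ma ma] of_mat_compression fseq_ops[OF a] squeeze_def adj_mult mult.assoc)
    fix b assume b: "b \<in> carrier calg"
    note cb = compression_carrier[OF b] and fb = alg_corner[OF calg_fseq[OF b]]
    note mb = mats_carrierD(1)[OF cb]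
    show "?\<pi> (a \<oplus>\<^bsub>calg\<^esub> b) = ?\<pi> a \<oplus>\<^bsub>M.U\<^esub> ?\<pi> b"
      unfolding M.U_ops(2)[OF ca cb] M.coset_eq_iff[OF compression_carrier[OF calg_closed(1)[OF a b]] mats_closed(3)[OF ca cb]]
      by (rule small[of _ 0]) (simp add: of_mat_hom(1)[OF ma mb] of_mat_compression fseq_ops(1)[OF a b] squeeze_def distrib_left distrib_right)
    show "?\<pi> (a \<otimes>\<^bsub>calg\<^esub> b) = ?\<pi> a \<otimes>\<^bsub>M.U\<^esub> ?\<pi> b"
      unfolding M.U_ops(3)[OF ca cb] M.coset_eq_iff[OF compression_carrier[OF calg_closed(2)[OF a b]] mats_closed(4)[OF ca cb]]
    proof (rule small[of _ "cnorm calg a * cnorm calg b"])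
      fix i :: nat assume i: "i \<in> ?I"
      have "norm (squeeze i (fseq a i * fseq b i) - squeeze i (fseq a i) * squeeze i (fseq b i)) \<le> opn (fseq a i) * opn (fseq b i)"
        by (rule squeeze_mult_defect[OF _ fa fb]) (use i in simp)
      also have "\<dots> \<le> cnorm calg a * cnorm calg b"
        by (intro mult_mono opn_le_cnorm[OF a] opn_le_cnorm[OF b] opn_nonneg order_trans[OF opn_nonneg opn_le_cnorm[OF a]])
      finally show "norm (of_mat (compression (a \<otimes>\<^bsub>calg\<^esub> b) i) - of_mat ((\<lambda>i\<in>?I. compression a i * compression b i) i)) \<le> cnorm calg a * cnorm calg b"
        using i by (simp add: of_mat_hom(2)[OF ma mb] of_mat_compression fseq_ops(2)[OF a b])
    qed
  next
    note c1 = compression_carrier[OF calg_consts(1)]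
    have "M.coset (compression \<one>\<^bsub>calg\<^esub>) = M.coset (\<lambda>i\<in>?I. 1\<^sub>m (k i - 1))"
      unfolding M.coset_eq_iff[OF c1 mats_consts(1)]
    proof (rule small[of _ 0])
      fix i :: nat assume i: "i \<in> ?I"
      have z: "0\<^sub>m m m \<in> carrier_mat m m" for m :: nat by simp
      show "norm (of_mat (compression \<one>\<^bsub>calg\<^esub> i) - of_mat ((\<lambda>i\<in>?I. 1\<^sub>m (k i - 1)) i)) \<le> 0"
        using i by (simp add: of_mat_compression fseq_consts squeeze_def idn_mult_idn of_mat_hom(5)[OF z z] min_def)
    qed
    then show "?\<pi> \<one>\<^bsub>calg\<^esub> = \<one>\<^bsub>M.U\<^esub>" unfolding M.U_ops(6)[OF c1 c1] .
  qed
  then have "approximately_liftable ?I \<alpha> (\<lambda>i. mat_cstar (k i - 1)) (\<lambda>i. norm_trace (k i - 1)) calg ?\<pi>"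
    using stable[unfolded matricially_tracially_stable_def] \<alpha>(1) n1 tracial_state_norm_trace
    by (metis infinite_Ici)
  then obtain E \<phi> where E: "E \<subseteq> ?I" "eventually (\<lambda>i. i \<in> E) \<alpha>"
    and \<phi>: "\<And>i. i \<in> E \<Longrightarrow> \<phi> i \<in> unital_star_hom calg (mat_cstar (k i - 1))"
    and lift: "\<And>a. a \<in> carrier calg \<Longrightarrow> ?\<pi> a = M.coset (\<lambda>i\<in>?I. if i \<in> E then \<phi> i a else \<zero>\<^bsub>mat_cstar (k i - 1)\<^esub>)"
    unfolding approximately_liftable_def ultra_coset_def M.coset_def by blast
  \<comment> \<open>The compression lies in the coset of the lift by definition, so the difference is read off an element of the ideal.\<close>
  have near: "\<forall>\<^sub>F i in \<alpha>. norm (squeeze i (fseq a i) - of_mat (\<phi> i a)) \<le> sqrt (real (k i - 1)) / 100"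
    if a: "a \<in> carrier calg" for a
  proof -
    have "compression a \<in> M.coset (\<lambda>i\<in>?I. if i \<in> E then \<phi> i a else \<zero>\<^bsub>mat_cstar (k i - 1)\<^esub>)"
      using M.coset_self[OF compression_carrier[OF a]] unfolding lift[OF a] .
    from M.coset_memD[OF this] obtain j where j: "j \<in> M.J"
      and e: "compression a = (\<lambda>i\<in>?I. j i + (\<lambda>i\<in>?I. if i \<in> E then \<phi> i a else \<zero>\<^bsub>mat_cstar (k i - 1)\<^esub>) i)" by blast
    from j have jc: "j \<in> carrier (mats ?I (\<lambda>i. k i - 1))" and "M.null (\<lambda>i. of_mat (j i))" unfolding M.J_iff by blast+
    then have "((\<lambda>i. norm (of_mat (j i)) / sqrt (real (k i - 1))) \<longlongrightarrow> 0) \<alpha>" unfolding M.null_def by blast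
    then have "\<forall>\<^sub>F i in \<alpha>. norm (of_mat (j i)) / sqrt (real (k i - 1)) < 1 / 100"
      by (rule order_tendstoD) simp
    with E(2) show ?thesis
    proof eventually_elim
      case (elim i)
      then have i: "i \<in> ?I" using E(1) by blast
      have pc: "\<phi> i a \<in> carrier_mat (k i - 1) (k i - 1)"
        using \<phi>[OF elim(1)] a by (auto simp: unital_star_hom_def star_hom_def mat_cstar_simps)
      have "compression a i = j i + \<phi> i a" using fun_cong[OF e, of i] i elim(1) by simp
      then have "squeeze i (fseq a i) = of_mat (j i) + of_mat (\<phi> i a)"
        using of_mat_compression[OF i, of a] of_mat_hom(1)[OF mats_carrierD(1)[OF jc i] pc] by simp
      then have "squeeze i (fseq a i) - of_mat (\<phi> i a) = of_mat (j i)" by simp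
      moreover have "sqrt (real (k i - 1)) > 0" using n1[OF i] by simp
      ultimately show ?case using elim(2) by (simp add: field_simps)
    qed
  qed
  have gen: "(\<lambda>j. g (k j)) \<in> alg" if "g \<in> {clock, chirp, fourier}" for g
    using D_expander D_alg that by auto
  have "\<forall>\<^sub>F i in \<alpha>. \<forall>g\<in>{clock, chirp, fourier}.
      norm (squeeze i (fseq (mseq (\<lambda>j. g (k j))) i) - of_mat (\<phi> i (mseq (\<lambda>j. g (k j))))) \<le> sqrt (real (k i - 1)) / 100"
    by (rule eventually_ball_finite) (use near mseq_carrier gen in auto)
  with E(2) have "\<forall>\<^sub>F i in \<alpha>. i \<in> E \<and> (\<forall>g\<in>{clock, chirp, fourier}.
      norm (squeeze i (fseq (mseq (\<lambda>j. g (k j))) i) - of_mat (\<phi> i (mseq (\<lambda>j. g (k j))))) \<le> sqrt (real (k i - 1)) / 100)"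
    by (rule eventually_conj)
  from eventually_happens'[OF \<alpha>1(1) this] obtain i where i: "i \<in> E"
    and close: "\<And>g. g \<in> {clock, chirp, fourier} \<Longrightarrow>
      norm (squeeze i (fseq (mseq (\<lambda>j. g (k j))) i) - of_mat (\<phi> i (mseq (\<lambda>j. g (k j))))) \<le> sqrt (real (k i - 1)) / 100"
    by blast
  have i1: "i \<ge> 1" using i E(1) by auto
  show False
  proof (rule compression_far_from_hom[OF i1 _ unital_star_hom_imp_hom[OF \<phi>[OF i]]])
    show "Suc (k i - 1) = k i" using k_pos[of i] by simp
    fix g :: "nat \<Rightarrow> fmat" assume g: "g \<in> {clock, chirp, fourier}"
    show "norm (idn (k i - 1) * g (k i) * idn (k i - 1) - of_mat (\<phi> i (mseq (\<lambda>j. g (k j))))) \<le> sqrt (real (k i - 1)) / 100"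
      using close[OF g] unfolding fseq_mseq[OF gen[OF g]] squeeze_def .
  qed
qed

end

theorem theorem4p6:
  shows "\<exists>A :: (nat \<Rightarrow> complex mat) cstar.
    unital_cstar_algebra A \<and> separable_cstar A \<and> residually_finite_dimensional A \<and>
    (\<forall>\<tau>. tracial_state A \<tau> \<longrightarrow>
       (\<exists>n0\<ge>1. \<exists>\<rho> :: nat \<Rightarrow> (nat \<Rightarrow> complex mat) \<Rightarrow> complex mat.
          (\<forall>n\<ge>n0. \<rho> n \<in> unital_star_hom A (mat_cstar n)) \<and>
          (\<forall>a\<in>carrier A. (\<lambda>n. norm_trace n (\<rho> n a)) \<longlonglongrightarrow> \<tau> a))) \<and>
    \<not> matricially_tracially_stable TYPE(nat) A"
proof -
  obtain k D where "tower k D" using tower_exists by blast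
  then interpret tower k D .
  show ?thesis
    using calg_cstar calg_separable calg_rfd calg_traces calg_not_stable by (intro exI[of _ calg] conjI allI impI)
qed

end
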